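(* Let $(A,[\cdot,\cdot],\rho)$ be a Lie algebroid over a smooth manifold $M$ and let $H\in\Gamma(\bigwedge^3A^* )$ satisfy $dH=0$. Let $\pi\in\Gamma(\bigwedge^2A)$, $N\in\Gamma(A\otimes A^* )$, $\sigma\in\Gamma(\bigwedge^2A^* )$, and let $J:A\oplus A^*\to A\oplus A^*$ be the endomorphism $$J(X+\alpha)=\big(NX+\pi^\sharp\alpha\big)+\big(\sigma^\flat X-{}^tN\alpha\big),\qquad X\in\Gamma(A),\ \alpha\in\Gamma(A^* ).$$ If $J$ is a c.p.s. structure on $A\oplus A^*$ equipped with the $H$-twisted Courant algebroid structure, then $(\pi,N,-d\sigma,H)$ is a Poisson quasi-Nijenhuis structure with background on $A$.
   Context: Conventions. $(A,[\cdot,\cdot],\rho)$ is a Lie algebroid with differential $d$ on $\Gamma(\bigwedge^\bullet A^* )$ and Lie derivative $\mathcal L_X=i_Xd+di_X$. For $\pi\in\Gamma(\bigwedge^2A)$, $\pi^\sharp(\alpha)=\pi(\alpha,\cdot)$, i.e. $\beta(\pi^\sharp\alpha)=\pi(\alpha,\beta)$; for a 2-form $\sigma$, $\sigma^\flat(X)=\sigma(X,\cdot)$. ${}^tN:A^*\to A^*$ is the transpose of $N:A\to A$. For 3-forms, $i_{X\wedge Y}:=i_X\circ i_Y$, i.e. $(i_{X\wedge Y}H)(Z)=H(Y,X,Z)$. Deformations. $[X,Y]_N=[NX,Y]+[X,NY]-N[X,Y]$. $i_N$ is the degree $0$ derivation of $\Gamma(\bigwedge^\bullet A^* )$ vanishing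 on functions with $i_N\alpha={}^tN\alpha$ on 1-forms, so $(i_N\eta)(X_1,\dots,X_k)=\sum_j\eta(X_1,\dots,NX_j,\dots,X_k)$. $d_N=i_N\circ d-d\circ i_N$. $\mathcal L^N_X=i_Xd_N+d_Ni_X$. $T_N(X,Y)=[NX,NY]-N([X,Y]_N)$. On $\Gamma(A^* )$: $[\alpha,\beta]_\pi=\mathcal L_{\pi^\sharp\alpha}\beta-\mathcal L_{\pi^\sharp\beta}\alpha-d(\pi(\alpha,\beta))$. A bivector $\pi$ is Poisson if its Schouten-Nijenhuis bracket with itself vanishes. Define $$C_{\pi,N}(\alpha,\beta)=\Big(\mathcal L^N_{\pi^\sharp\alpha}\beta-\mathcal L^N_{\pi^\sharp\beta}\alpha-d_N(\pi(\alpha,\beta))\Big)-\Big([{}^tN\alpha,\beta]_\pi+[\alpha,{}^tN\beta]_\pi-{}^tN[\alpha,\beta]_\pi\Big).$$ Poisson quasi-Nijenhuis structure with background on $A$: a quadruple $(\pi,N,\psi,H)$ with $\pi\in\Gamma(\bigwedge^2A)$, $N\in\Gamma(A\otimes A^* )$, $\psi,H\in\Gamma(\bigwedge^3A^* )$ such that $N\circ\pi^\sharp=\pi^\sharp\circ{}^tN$, $d\psi=0$, $dH=0$, and for all $X,Y\in\Gamma(A)$, $\alpha,\beta\in\Gamma(A^* )$: (1) $\pi$ is a Poisson bivector; (2) $C_{\pi,N}(\alpha,\beta)=-2\,i_{\pi^\sharp\alpha\wedge\pi^\sharp\beta}H$ (that is, $=2H(\pi^\sharp\alpha,\pi^\sharp\beta,\cdot)$);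 (3) $T_N(X,Y)=\pi^\sharp\big(i_{NX\wedge Y}H-i_{NY\wedge X}H+i_{X\wedge Y}\psi\big)$; (4) $d_N\psi=d\mathcal H$, where $\mathcal H(X,Y,Z)=H(NX,NY,Z)+H(NY,NZ,X)+H(NZ,NX,Y)$. $H$-twisted Courant structure on $A\oplus A^*$ (the one with hamiltonian $\mu+H$, $\mu$ being the hamiltonian of $A$): pairing $\langle X+\alpha,Y+\beta\rangle=\beta(X)+\alpha(Y)$, anchor $X+\alpha\mapsto\rho(X)$, Dorfman bracket $$[X+\alpha,Y+\beta]=[X,Y]+\mathcal L_X\beta-i_Yd\alpha+i_{X\wedge Y}H$$ (so the last term is $-H(X,Y,\cdot)$). c.p.s. structures: a vector bundle endomorphism $J$ of $A\oplus A^*$ is orthogonal if $\langle Ju,v\rangle+\langle u,Jv\rangle=0$ for all sections $u,v$. It is an almost c.p.s. structure if it is orthogonal and $J^2=\lambda\,\mathrm{id}$ for some $\lambda\in\{-1,0,1\}$. It is a c.p.s. structure (integrable) if moreover $T_J=0$, where $T_J(u,v)=[Ju,Jv]-J([Ju,v]+[u,Jv]-J[u,v])$. *)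

theory Defs
  imports "HOL-Analysis.Analysis" "HOL-Library.Function_Algebras"
begin

text \<open>
  Throughout, sums, differences, negatives and zeros of functions, sections and forms are the
  pointwise ones of \<^theory>\<open>HOL-Library.Function_Algebras\<close>.
\<close>


section \<open>Smooth manifolds\<close>

text \<open>
  \<open>ck_on k S f\<close>: on the open set \<open>S\<close>, all iterated directional derivatives of \<open>f\<close> of order
  at most \<open>k\<close> exist (as Frechet derivatives) and are continuous.
\<close>

primrec ck_on ::
    "nat \<Rightarrow> 'e::real_normed_vector set \<Rightarrow> ('e \<Rightarrow> 'f::real_normed_vector) \<Rightarrow> bool" where
  "ck_on 0 S f = continuous_on S f"
| "ck_on (Suc k) S f =
     ((\<forall>x\<in>S. f differentiable (at x)) \<and> (\<forall>v. ck_on k S (\<lambda>x. frechet_derivative f (at x) v)))"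

definition cinf_on :: "'e::real_normed_vector set \<Rightarrow> ('e \<Rightarrow> 'f::real_normed_vector) \<Rightarrow> bool" where
  "cinf_on S f \<longleftrightarrow> (\<forall>k. ck_on k S f)"

text \<open>
  The manifold is the whole type \<open>'m\<close>, given with a (not necessarily maximal) atlas. The model
  space is a finite-dimensional inner product space rather than a type of class
  \<^class>\<open>euclidean_space\<close>, because the latter excludes dimension \<open>0\<close>.
\<close>

definition smooth_manifold ::
    "('m::{t2_space,second_countable_topology} set \<times> ('m \<Rightarrow> 'e::real_inner)) set \<Rightarrow> bool" where
  "smooth_manifold C \<longleftrightarrow>
     (\<exists>B::'e set. finite B \<and> span B = UNIV) \<and>
     (\<forall>p. \<exists>(U, \<phi>)\<in>C. p \<in> U) \<and>
     (\<forall>(U, \<phi>)\<in>C. open U \<and> open (\<phi> ` U) \<and> homeomorphism U (\<phi> ` U) \<phi> (inv_into U \<phi>)) \<and>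
     (\<forall>(U, \<phi>)\<in>C. \<forall>(V, \<psi>)\<in>C. cinf_on (\<phi> ` (U \<inter> V)) (\<psi> \<circ> inv_into U \<phi>))"

definition smooth_fun_on ::
    "('m::topological_space set \<times> ('m \<Rightarrow> 'e::real_inner)) set \<Rightarrow> 'm set \<Rightarrow> ('m \<Rightarrow> real) \<Rightarrow> bool" where
  "smooth_fun_on C W f \<longleftrightarrow> (\<forall>(U, \<phi>)\<in>C. cinf_on (\<phi> ` (U \<inter> W)) (f \<circ> inv_into U \<phi>))"


section \<open>Vector bundles\<close>

text \<open>
  A vector bundle is a family of vector spaces \<open>E p\<close>, realised as subspaces of one ambient real
  vector space \<open>'v\<close> (which carries no topology; e.g. the direct sum of all fibres), together with
  local frames. A local frame over an open set \<open>U\<close> is a list of maps whose values at each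
  \<open>p \<in> U\<close> form a basis of \<open>E p\<close>; local frames cover the base and have smooth transition matrices.
  The rank may be \<open>0\<close>.
\<close>

definition smooth_wrt_frame ::
    "('m::topological_space set \<times> ('m \<Rightarrow> 'e::real_inner)) set \<Rightarrow> ('m \<Rightarrow> 'v::real_vector) list
      \<Rightarrow> 'm set \<Rightarrow> ('m \<Rightarrow> 'v) \<Rightarrow> bool" where
  "smooth_wrt_frame C es W s \<longleftrightarrow>
     (\<exists>c :: nat \<Rightarrow> 'm \<Rightarrow> real. (\<forall>i<length es. smooth_fun_on C W (c i)) \<and>
        (\<forall>p\<in>W. s p = (\<Sum>i<length es. c i p *\<^sub>R (es ! i) p)))"

definition vector_bundle ::
    "('m::topological_space set \<times> ('m \<Rightarrow> 'e::real_inner)) set \<Rightarrow> ('m \<Rightarrow> 'v::real_vector set)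
      \<Rightarrow> ('m set \<times> ('m \<Rightarrow> 'v) list) set \<Rightarrow> bool" where
  "vector_bundle C E F \<longleftrightarrow>
     (\<forall>p. subspace (E p)) \<and>
     (\<forall>p. \<exists>(U, es)\<in>F. p \<in> U) \<and>
     (\<forall>(U, es)\<in>F. open U \<and>
        (\<forall>p\<in>U. distinct (map (\<lambda>e. e p) es) \<and> independent ((\<lambda>e. e p) ` set es) \<and>
           span ((\<lambda>e. e p) ` set es) = E p)) \<and>
     (\<forall>(U, es)\<in>F. \<forall>(V, fs)\<in>F. \<forall>f\<in>set fs. smooth_wrt_frame C es (U \<inter> V) f)"


section \<open>Lie algebroids\<close>

text \<open>
  The anchor \<open>A \<rightarrow> TM\<close> is given by its action \<open>\<Gamma>(A) \<rightarrow> \<XX>(M)\<close> on sections, vector fields on \<open>M\<close>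
  being the derivations of \<open>C\<^sup>\<infinity>(M)\<close>.
\<close>

record ('m, 'e, 'v) algebroid =
  charts :: "('m set \<times> ('m \<Rightarrow> 'e)) set"
  fibre :: "'m \<Rightarrow> 'v set"
  frames :: "('m set \<times> ('m \<Rightarrow> 'v) list) set"
  bracket :: "('m \<Rightarrow> 'v) \<Rightarrow> ('m \<Rightarrow> 'v) \<Rightarrow> 'm \<Rightarrow> 'v"
  anchor :: "('m \<Rightarrow> 'v) \<Rightarrow> ('m \<Rightarrow> real) \<Rightarrow> 'm \<Rightarrow> real"

definition smooth_funs ::
    "('m::topological_space, 'e::real_inner, 'v::real_vector) algebroid \<Rightarrow> ('m \<Rightarrow> real) set" where
  "smooth_funs A = {f. smooth_fun_on (charts A) UNIV f}"

definition sections ::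
    "('m::topological_space, 'e::real_inner, 'v::real_vector) algebroid \<Rightarrow> ('m \<Rightarrow> 'v) set" where
  "sections A = {s. (\<forall>p. s p \<in> fibre A p) \<and>
     (\<forall>(U, es)\<in>frames A. smooth_wrt_frame (charts A) es U s)}"

definition smult :: "('m \<Rightarrow> real) \<Rightarrow> ('m \<Rightarrow> 'v::real_vector) \<Rightarrow> 'm \<Rightarrow> 'v" where
  "smult f X = (\<lambda>p. f p *\<^sub>R X p)"

definition lie_algebroid ::
    "('m::{t2_space,second_countable_topology}, 'e::real_inner, 'v::real_vector) algebroid
      \<Rightarrow> bool" where
  "lie_algebroid A \<longleftrightarrow>
     smooth_manifold (charts A) \<and> vector_bundle (charts A) (fibre A) (frames A) \<and>
     \<comment> \<open>real Lie algebra structure on \<open>\<Gamma>(A)\<close>\<close>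
     (\<forall>X\<in>sections A. \<forall>Y\<in>sections A. bracket A X Y \<in> sections A) \<and>
     (\<forall>X\<in>sections A. \<forall>Y\<in>sections A. \<forall>Z\<in>sections A.
        bracket A (X + Y) Z = bracket A X Z + bracket A Y Z \<and>
        bracket A X (Y + Z) = bracket A X Y + bracket A X Z) \<and>
     (\<forall>X\<in>sections A. \<forall>Y\<in>sections A. \<forall>c.
        bracket A (smult (\<lambda>_. c) X) Y = smult (\<lambda>_. c) (bracket A X Y) \<and>
        bracket A X (smult (\<lambda>_. c) Y) = smult (\<lambda>_. c) (bracket A X Y)) \<and>
     (\<forall>X\<in>sections A. bracket A X X = 0) \<and>
     (\<forall>X\<in>sections A. \<forall>Y\<in>sections A. \<forall>Z\<in>sections A.
        bracket A X (bracket A Y Z) = bracket A (bracket A X Y) Z + bracket A Y (bracket A X Z)) \<and>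
     \<comment> \<open>\<open>\<rho>(X)\<close> is a vector field, and \<open>\<rho>\<close> is \<open>C\<^sup>\<infinity>(M)\<close>-linear\<close>
     (\<forall>X\<in>sections A. \<forall>f\<in>smooth_funs A. anchor A X f \<in> smooth_funs A) \<and>
     (\<forall>X\<in>sections A. \<forall>f\<in>smooth_funs A. \<forall>g\<in>smooth_funs A.
        anchor A X (f + g) = anchor A X f + anchor A X g \<and>
        anchor A X (f * g) = f * anchor A X g + g * anchor A X f) \<and>
     (\<forall>X\<in>sections A. \<forall>f\<in>smooth_funs A. \<forall>c.
        anchor A X ((\<lambda>_. c) * f) = (\<lambda>_. c) * anchor A X f) \<and>
     (\<forall>X\<in>sections A. \<forall>Y\<in>sections A. \<forall>f\<in>smooth_funs A.
        anchor A (X + Y) f = anchor A X f + anchor A Y f) \<and>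
     (\<forall>X\<in>sections A. \<forall>f\<in>smooth_funs A. \<forall>g\<in>smooth_funs A.
        anchor A (smult g X) f = g * anchor A X f) \<and>
     \<comment> \<open>\<open>\<rho>\<close> is a Lie algebra morphism; Leibniz rule\<close>
     (\<forall>X\<in>sections A. \<forall>Y\<in>sections A. \<forall>f\<in>smooth_funs A.
        anchor A (bracket A X Y) f = anchor A X (anchor A Y f) - anchor A Y (anchor A X f)) \<and>
     (\<forall>X\<in>sections A. \<forall>Y\<in>sections A. \<forall>f\<in>smooth_funs A.
        bracket A X (smult f Y) = smult f (bracket A X Y) + smult (anchor A X f) Y)"


section \<open>Tensor fields\<close>

text \<open>
  Tensor fields are identified with the \<open>C\<^sup>\<infinity>(M)\<close>-multilinear maps on sections that they induce.
  A \<open>k\<close>-form takes a list of \<open>k\<close> sections; it is \<open>0\<close> on every other list, so that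
  equality of forms is equality of functions. A section \<open>\<alpha>\<close> of the dual bundle is a \<open>1\<close>-form, and
  \<open>\<alpha>(X)\<close> is written \<open>\<alpha> [X]\<close>. A function is a \<open>0\<close>-form through \<open>fun_form\<close> below.
\<close>

type_synonym ('m, 'v) form = "('m \<Rightarrow> 'v) list \<Rightarrow> 'm \<Rightarrow> real"

definition forms ::
    "('m::topological_space, 'e::real_inner, 'v::real_vector) algebroid \<Rightarrow> nat
      \<Rightarrow> ('m, 'v) form set" where
  "forms A k = {\<eta>.
     (\<forall>Xs. \<not> (length Xs = k \<and> set Xs \<subseteq> sections A) \<longrightarrow> \<eta> Xs = 0) \<and>
     (\<forall>Xs. length Xs = k \<and> set Xs \<subseteq> sections A \<longrightarrow>
        \<eta> Xs \<in> smooth_funs A \<and>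
        (\<not> distinct Xs \<longrightarrow> \<eta> Xs = 0) \<and>
        (\<forall>i<k. \<forall>X\<in>sections A. \<forall>Y\<in>sections A.
           \<eta> (Xs[i := X + Y]) = \<eta> (Xs[i := X]) + \<eta> (Xs[i := Y])) \<and>
        (\<forall>i<k. \<forall>X\<in>sections A. \<forall>f\<in>smooth_funs A.
           \<eta> (Xs[i := smult f X]) = f * \<eta> (Xs[i := X])))}"

abbreviation covectors ::
    "('m::topological_space, 'e::real_inner, 'v::real_vector) algebroid
      \<Rightarrow> ('m, 'v) form set" where
  "covectors A \<equiv> forms A 1"

definition smult_form :: "('m \<Rightarrow> real) \<Rightarrow> ('m, 'v) form \<Rightarrow> ('m, 'v) form" where
  "smult_form f \<eta> = (\<lambda>Xs. f * \<eta> Xs)"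

definition fun_form :: "('m \<Rightarrow> real) \<Rightarrow> ('m, 'v) form" where
  "fun_form f = (\<lambda>Xs. if Xs = [] then f else 0)"

definition on_sections ::
    "('m::topological_space, 'e::real_inner, 'v::real_vector) algebroid \<Rightarrow> ('m, 'v) form
      \<Rightarrow> ('m, 'v) form" where
  "on_sections A \<eta> = (\<lambda>Xs. if set Xs \<subseteq> sections A then \<eta> Xs else 0)"

definition bivectors ::
    "('m::topological_space, 'e::real_inner, 'v::real_vector) algebroid
      \<Rightarrow> (('m, 'v) form \<Rightarrow> ('m, 'v) form \<Rightarrow> 'm \<Rightarrow> real) set" where
  "bivectors A = {P.
     (\<forall>\<alpha>\<in>covectors A. \<forall>\<beta>\<in>covectors A. P \<alpha> \<beta> \<in> smooth_funs A) \<and>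
     (\<forall>\<alpha>\<in>covectors A. P \<alpha> \<alpha> = 0) \<and>
     (\<forall>\<alpha>\<in>covectors A. \<forall>\<beta>\<in>covectors A. \<forall>\<gamma>\<in>covectors A.
        P (\<alpha> + \<beta>) \<gamma> = P \<alpha> \<gamma> + P \<beta> \<gamma> \<and> P \<alpha> (\<beta> + \<gamma>) = P \<alpha> \<beta> + P \<alpha> \<gamma>) \<and>
     (\<forall>\<alpha>\<in>covectors A. \<forall>\<beta>\<in>covectors A. \<forall>f\<in>smooth_funs A.
        P (smult_form f \<alpha>) \<beta> = f * P \<alpha> \<beta> \<and> P \<alpha> (smult_form f \<beta>) = f * P \<alpha> \<beta>)}"

definition endomorphisms ::
    "('m::topological_space, 'e::real_inner, 'v::real_vector) algebroid
      \<Rightarrow> (('m \<Rightarrow> 'v) \<Rightarrow> 'm \<Rightarrow> 'v) set" where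
  "endomorphisms A = {N.
     (\<forall>X\<in>sections A. N X \<in> sections A) \<and>
     (\<forall>X\<in>sections A. \<forall>Y\<in>sections A. N (X + Y) = N X + N Y) \<and>
     (\<forall>X\<in>sections A. \<forall>f\<in>smooth_funs A. N (smult f X) = smult f (N X))}"

definition sharp ::
    "('m::topological_space, 'e::real_inner, 'v::real_vector) algebroid
      \<Rightarrow> (('m, 'v) form \<Rightarrow> ('m, 'v) form \<Rightarrow> 'm \<Rightarrow> real) \<Rightarrow> ('m, 'v) form \<Rightarrow> 'm \<Rightarrow> 'v" where
  "sharp A P \<alpha> = (THE X. X \<in> sections A \<and> (\<forall>\<beta>\<in>covectors A. \<beta> [X] = P \<alpha> \<beta>))"

definition flat :: "('m, 'v) form \<Rightarrow> ('m \<Rightarrow> 'v) \<Rightarrow> ('m, 'v) form" where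
  "flat \<sigma> X = (\<lambda>Ys. \<sigma> (X # Ys))"

text \<open>Only used for \<open>1\<close>-forms.\<close>

definition transp ::
    "('m::topological_space, 'e::real_inner, 'v::real_vector) algebroid
      \<Rightarrow> (('m \<Rightarrow> 'v) \<Rightarrow> 'm \<Rightarrow> 'v) \<Rightarrow> ('m, 'v) form \<Rightarrow> ('m, 'v) form" where
  "transp A N \<alpha> = on_sections A (\<lambda>Xs. \<alpha> (map N Xs))"


section \<open>Cartan calculus\<close>

definition ins :: "('m \<Rightarrow> 'v) \<Rightarrow> ('m, 'v) form \<Rightarrow> ('m, 'v) form" where
  "ins X \<eta> = (\<lambda>Ys. \<eta> (X # Ys))"

text \<open>\<open>i\<^bsub>X \<and> Y\<^esub> = i\<^sub>X \<circ> i\<^sub>Y\<close>, so \<open>ins2 X Y \<eta> [Z] = \<eta> [Y, X, Z]\<close>.\<close>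

definition ins2 :: "('m \<Rightarrow> 'v) \<Rightarrow> ('m \<Rightarrow> 'v) \<Rightarrow> ('m, 'v) form \<Rightarrow> ('m, 'v) form" where
  "ins2 X Y \<eta> = ins X (ins Y \<eta>)"

definition drop_nth :: "nat \<Rightarrow> 'a list \<Rightarrow> 'a list" where
  "drop_nth i xs = take i xs @ drop (Suc i) xs"

text \<open>The Koszul (Chevalley--Eilenberg) formula, with arguments indexed from \<open>0\<close>.\<close>

definition d ::
    "('m::topological_space, 'e::real_inner, 'v::real_vector) algebroid
      \<Rightarrow> ('m, 'v) form \<Rightarrow> ('m, 'v) form" where
  "d A \<eta> = on_sections A (\<lambda>Xs p.
     (\<Sum>i<length Xs. (-1) ^ i * anchor A (Xs ! i) (\<eta> (drop_nth i Xs)) p) +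
     (\<Sum>j<length Xs. \<Sum>i<j. (-1) ^ (i + j) *
        \<eta> (bracket A (Xs ! i) (Xs ! j) # drop_nth i (drop_nth j Xs)) p))"

definition lie ::
    "('m::topological_space, 'e::real_inner, 'v::real_vector) algebroid
      \<Rightarrow> ('m \<Rightarrow> 'v) \<Rightarrow> ('m, 'v) form \<Rightarrow> ('m, 'v) form" where
  "lie A X \<eta> = ins X (d A \<eta>) + d A (ins X \<eta>)"

definition ins_end ::
    "('m::topological_space, 'e::real_inner, 'v::real_vector) algebroid
      \<Rightarrow> (('m \<Rightarrow> 'v) \<Rightarrow> 'm \<Rightarrow> 'v) \<Rightarrow> ('m, 'v) form \<Rightarrow> ('m, 'v) form" where
  "ins_end A N \<eta> = on_sections A (\<lambda>Xs. \<Sum>j<length Xs. \<eta> (Xs[j := N (Xs ! j)]))"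

definition dN ::
    "('m::topological_space, 'e::real_inner, 'v::real_vector) algebroid
      \<Rightarrow> (('m \<Rightarrow> 'v) \<Rightarrow> 'm \<Rightarrow> 'v) \<Rightarrow> ('m, 'v) form \<Rightarrow> ('m, 'v) form" where
  "dN A N \<eta> = ins_end A N (d A \<eta>) - d A (ins_end A N \<eta>)"

definition lieN ::
    "('m::topological_space, 'e::real_inner, 'v::real_vector) algebroid
      \<Rightarrow> (('m \<Rightarrow> 'v) \<Rightarrow> 'm \<Rightarrow> 'v) \<Rightarrow> ('m \<Rightarrow> 'v) \<Rightarrow> ('m, 'v) form \<Rightarrow> ('m, 'v) form" where
  "lieN A N X \<eta> = ins X (dN A N \<eta>) + dN A N (ins X \<eta>)"


section \<open>Poisson bivectors\<close>

definition wedge2 :: "('m \<Rightarrow> 'v) \<Rightarrow> ('m \<Rightarrow> 'v)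
      \<Rightarrow> ('m, 'v) form \<Rightarrow> ('m, 'v) form \<Rightarrow> 'm \<Rightarrow> real" where
  "wedge2 X Y \<alpha> \<beta> = \<alpha> [X] * \<beta> [Y] - \<alpha> [Y] * \<beta> [X]"

definition wedge3 :: "('m \<Rightarrow> 'v) \<Rightarrow> ('m \<Rightarrow> 'v) \<Rightarrow> ('m \<Rightarrow> 'v)
      \<Rightarrow> ('m, 'v) form \<Rightarrow> ('m, 'v) form \<Rightarrow> ('m, 'v) form \<Rightarrow> 'm \<Rightarrow> real" where
  "wedge3 X Y Z \<alpha> \<beta> \<gamma> =
     \<alpha> [X] * wedge2 Y Z \<beta> \<gamma> - \<alpha> [Y] * wedge2 X Z \<beta> \<gamma> + \<alpha> [Z] * wedge2 X Y \<beta> \<gamma>"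

text \<open>
  \<open>[X\<^sub>1 \<and> X\<^sub>2, Y\<^sub>1 \<and> Y\<^sub>2] = \<Sum>\<^sub>i\<^sub>j (-1)\<^bsup>i+j\<^esup> [X\<^sub>i, Y\<^sub>j] \<and> X\<^bsub>3-i\<^esub> \<and> Y\<^bsub>3-j\<^esub>\<close>, which is what the graded Leibniz
  rule for the Schouten--Nijenhuis bracket gives on decomposable bivectors.
\<close>

definition schouten_decomposable ::
    "('m::topological_space, 'e::real_inner, 'v::real_vector) algebroid
      \<Rightarrow> ('m \<Rightarrow> 'v) \<times> ('m \<Rightarrow> 'v) \<Rightarrow> ('m \<Rightarrow> 'v) \<times> ('m \<Rightarrow> 'v)
      \<Rightarrow> ('m, 'v) form \<Rightarrow> ('m, 'v) form \<Rightarrow> ('m, 'v) form \<Rightarrow> 'm \<Rightarrow> real" where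
  "schouten_decomposable A = (\<lambda>(X1, X2) (Y1, Y2) \<alpha> \<beta> \<gamma>.
       wedge3 (bracket A X1 Y1) X2 Y2 \<alpha> \<beta> \<gamma> - wedge3 (bracket A X1 Y2) X2 Y1 \<alpha> \<beta> \<gamma>
     - wedge3 (bracket A X2 Y1) X1 Y2 \<alpha> \<beta> \<gamma> + wedge3 (bracket A X2 Y2) X1 Y1 \<alpha> \<beta> \<gamma>)"

definition decomposes_on ::
    "('m::topological_space, 'e::real_inner, 'v::real_vector) algebroid \<Rightarrow> 'm set
      \<Rightarrow> (('m, 'v) form \<Rightarrow> ('m, 'v) form \<Rightarrow> 'm \<Rightarrow> real)
      \<Rightarrow> (('m \<Rightarrow> 'v) \<times> ('m \<Rightarrow> 'v)) list \<Rightarrow> bool" where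
  "decomposes_on A U P xs \<longleftrightarrow>
     (\<forall>(X, Y)\<in>set xs. X \<in> sections A \<and> Y \<in> sections A) \<and>
     (\<forall>\<alpha>\<in>covectors A. \<forall>\<beta>\<in>covectors A. \<forall>p\<in>U. P \<alpha> \<beta> p = (\<Sum>(X, Y)\<leftarrow>xs. wedge2 X Y \<alpha> \<beta> p))"

text \<open>
  \<open>is_schouten A P Q R\<close>: the trivector field \<open>R\<close> is the Schouten--Nijenhuis bracket of the bivector
  fields \<open>P\<close> and \<open>Q\<close>. The bracket is the local bilinear extension of its values on decomposables;
  near every point, \<open>P\<close> and \<open>Q\<close> are finite sums of decomposables, and the result does not depend on
  the chosen decompositions.
\<close>

definition is_schouten ::
    "('m::topological_space, 'e::real_inner, 'v::real_vector) algebroid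
      \<Rightarrow> (('m, 'v) form \<Rightarrow> ('m, 'v) form \<Rightarrow> 'm \<Rightarrow> real)
      \<Rightarrow> (('m, 'v) form \<Rightarrow> ('m, 'v) form \<Rightarrow> 'm \<Rightarrow> real)
      \<Rightarrow> (('m, 'v) form \<Rightarrow> ('m, 'v) form \<Rightarrow> ('m, 'v) form \<Rightarrow> 'm \<Rightarrow> real) \<Rightarrow> bool" where
  "is_schouten A P Q R \<longleftrightarrow>
     (\<forall>p. \<exists>U xs ys. open U \<and> p \<in> U \<and> decomposes_on A U P xs \<and> decomposes_on A U Q ys \<and>
        (\<forall>\<alpha>\<in>covectors A. \<forall>\<beta>\<in>covectors A. \<forall>\<gamma>\<in>covectors A. \<forall>q\<in>U.
           R \<alpha> \<beta> \<gamma> q = (\<Sum>x\<leftarrow>xs. \<Sum>y\<leftarrow>ys. schouten_decomposable A x y \<alpha> \<beta> \<gamma> q)))"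

definition poisson ::
    "('m::topological_space, 'e::real_inner, 'v::real_vector) algebroid
      \<Rightarrow> (('m, 'v) form \<Rightarrow> ('m, 'v) form \<Rightarrow> 'm \<Rightarrow> real) \<Rightarrow> bool" where
  "poisson A P \<longleftrightarrow> P \<in> bivectors A \<and> is_schouten A P P 0"


section \<open>Poisson quasi-Nijenhuis structures with background\<close>

definition bracketN ::
    "('m::topological_space, 'e::real_inner, 'v::real_vector) algebroid
      \<Rightarrow> (('m \<Rightarrow> 'v) \<Rightarrow> 'm \<Rightarrow> 'v) \<Rightarrow> ('m \<Rightarrow> 'v) \<Rightarrow> ('m \<Rightarrow> 'v) \<Rightarrow> 'm \<Rightarrow> 'v" where
  "bracketN A N X Y = bracket A (N X) Y + bracket A X (N Y) - N (bracket A X Y)"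

definition torsion ::
    "('m::topological_space, 'e::real_inner, 'v::real_vector) algebroid
      \<Rightarrow> (('m \<Rightarrow> 'v) \<Rightarrow> 'm \<Rightarrow> 'v) \<Rightarrow> ('m \<Rightarrow> 'v) \<Rightarrow> ('m \<Rightarrow> 'v) \<Rightarrow> 'm \<Rightarrow> 'v" where
  "torsion A N X Y = bracket A (N X) (N Y) - N (bracketN A N X Y)"

definition bracket_pi ::
    "('m::topological_space, 'e::real_inner, 'v::real_vector) algebroid
      \<Rightarrow> (('m, 'v) form \<Rightarrow> ('m, 'v) form \<Rightarrow> 'm \<Rightarrow> real)
      \<Rightarrow> ('m, 'v) form \<Rightarrow> ('m, 'v) form \<Rightarrow> ('m, 'v) form" where
  "bracket_pi A P \<alpha> \<beta> =
     lie A (sharp A P \<alpha>) \<beta> - lie A (sharp A P \<beta>) \<alpha> - d A (fun_form (P \<alpha> \<beta>))"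

definition concomitant ::
    "('m::topological_space, 'e::real_inner, 'v::real_vector) algebroid
      \<Rightarrow> (('m, 'v) form \<Rightarrow> ('m, 'v) form \<Rightarrow> 'm \<Rightarrow> real) \<Rightarrow> (('m \<Rightarrow> 'v) \<Rightarrow> 'm \<Rightarrow> 'v)
      \<Rightarrow> ('m, 'v) form \<Rightarrow> ('m, 'v) form \<Rightarrow> ('m, 'v) form" where
  "concomitant A P N \<alpha> \<beta> =
     (lieN A N (sharp A P \<alpha>) \<beta> - lieN A N (sharp A P \<beta>) \<alpha> - dN A N (fun_form (P \<alpha> \<beta>)))
     - (bracket_pi A P (transp A N \<alpha>) \<beta> + bracket_pi A P \<alpha> (transp A N \<beta>)
        - transp A N (bracket_pi A P \<alpha> \<beta>))"

definition curly_H ::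
    "('m::topological_space, 'e::real_inner, 'v::real_vector) algebroid
      \<Rightarrow> (('m \<Rightarrow> 'v) \<Rightarrow> 'm \<Rightarrow> 'v) \<Rightarrow> ('m, 'v) form \<Rightarrow> ('m, 'v) form" where
  "curly_H A N H = on_sections A (\<lambda>Xs. case Xs of
       [X, Y, Z] \<Rightarrow> H [N X, N Y, Z] + H [N Y, N Z, X] + H [N Z, N X, Y]
     | _ \<Rightarrow> 0)"

definition poisson_quasi_nijenhuis_background ::
    "('m::topological_space, 'e::real_inner, 'v::real_vector) algebroid
      \<Rightarrow> (('m, 'v) form \<Rightarrow> ('m, 'v) form \<Rightarrow> 'm \<Rightarrow> real) \<Rightarrow> (('m \<Rightarrow> 'v) \<Rightarrow> 'm \<Rightarrow> 'v)
      \<Rightarrow> ('m, 'v) form \<Rightarrow> ('m, 'v) form \<Rightarrow> bool" where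
  "poisson_quasi_nijenhuis_background A P N \<psi> H \<longleftrightarrow>
     P \<in> bivectors A \<and> N \<in> endomorphisms A \<and> \<psi> \<in> forms A 3 \<and> H \<in> forms A 3 \<and>
     (\<forall>\<alpha>\<in>covectors A. N (sharp A P \<alpha>) = sharp A P (transp A N \<alpha>)) \<and>
     d A \<psi> = 0 \<and> d A H = 0 \<and>
     poisson A P \<and>
     (\<forall>\<alpha>\<in>covectors A. \<forall>\<beta>\<in>covectors A.
        concomitant A P N \<alpha> \<beta> = smult_form (\<lambda>_. -2) (ins2 (sharp A P \<alpha>) (sharp A P \<beta>) H)) \<and>
     (\<forall>X\<in>sections A. \<forall>Y\<in>sections A.
        torsion A N X Y =
          sharp A P (ins2 (N X) Y H - ins2 (N Y) X H + ins2 X Y \<psi>)) \<and>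
     dN A N \<psi> = d A (curly_H A N H)"


section \<open>The twisted Courant structure and c.p.s. structures\<close>

type_synonym ('m, 'v) dsection = "('m \<Rightarrow> 'v) \<times> ('m, 'v) form"

definition dsections ::
    "('m::topological_space, 'e::real_inner, 'v::real_vector) algebroid
      \<Rightarrow> ('m, 'v) dsection set" where
  "dsections A = sections A \<times> covectors A"

definition smult_dsection :: "('m \<Rightarrow> real) \<Rightarrow> ('m, 'v::real_vector) dsection \<Rightarrow> ('m, 'v) dsection"
  where
  "smult_dsection f = (\<lambda>(X, \<alpha>). (smult f X, smult_form f \<alpha>))"

definition pairing :: "('m, 'v) dsection \<Rightarrow> ('m, 'v) dsection \<Rightarrow> 'm \<Rightarrow> real" where
  "pairing = (\<lambda>(X, \<alpha>) (Y, \<beta>). \<beta> [X] + \<alpha> [Y])"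

definition dorfman ::
    "('m::topological_space, 'e::real_inner, 'v::real_vector) algebroid \<Rightarrow> ('m, 'v) form
      \<Rightarrow> ('m, 'v) dsection \<Rightarrow> ('m, 'v) dsection \<Rightarrow> ('m, 'v) dsection" where
  "dorfman A H = (\<lambda>(X, \<alpha>) (Y, \<beta>).
     (bracket A X Y, lie A X \<beta> - ins Y (d A \<alpha>) + ins2 X Y H))"

definition dendomorphisms ::
    "('m::topological_space, 'e::real_inner, 'v::real_vector) algebroid
      \<Rightarrow> (('m, 'v) dsection \<Rightarrow> ('m, 'v) dsection) set" where
  "dendomorphisms A = {J.
     (\<forall>u\<in>dsections A. J u \<in> dsections A) \<and>
     (\<forall>u\<in>dsections A. \<forall>v\<in>dsections A. J (u + v) = J u + J v) \<and>
     (\<forall>u\<in>dsections A. \<forall>f\<in>smooth_funs A. J (smult_dsection f u) = smult_dsection f (J u))}"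

definition orthogonal_endo ::
    "('m::topological_space, 'e::real_inner, 'v::real_vector) algebroid
      \<Rightarrow> (('m, 'v) dsection \<Rightarrow> ('m, 'v) dsection) \<Rightarrow> bool" where
  "orthogonal_endo A J \<longleftrightarrow>
     (\<forall>u\<in>dsections A. \<forall>v\<in>dsections A. pairing (J u) v + pairing u (J v) = 0)"

definition almost_cps ::
    "('m::topological_space, 'e::real_inner, 'v::real_vector) algebroid
      \<Rightarrow> (('m, 'v) dsection \<Rightarrow> ('m, 'v) dsection) \<Rightarrow> bool" where
  "almost_cps A J \<longleftrightarrow> J \<in> dendomorphisms A \<and> orthogonal_endo A J \<and>
     (\<exists>l\<in>{-1, 0, 1::real}. \<forall>u\<in>dsections A. J (J u) = smult_dsection (\<lambda>_. l) u)"

definition courant_torsion ::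
    "('m::topological_space, 'e::real_inner, 'v::real_vector) algebroid \<Rightarrow> ('m, 'v) form
      \<Rightarrow> (('m, 'v) dsection \<Rightarrow> ('m, 'v) dsection)
      \<Rightarrow> ('m, 'v) dsection \<Rightarrow> ('m, 'v) dsection \<Rightarrow> ('m, 'v) dsection" where
  "courant_torsion A H J u v =
     dorfman A H (J u) (J v)
     - J (dorfman A H (J u) v + dorfman A H u (J v) - J (dorfman A H u v))"

definition cps ::
    "('m::topological_space, 'e::real_inner, 'v::real_vector) algebroid \<Rightarrow> ('m, 'v) form
      \<Rightarrow> (('m, 'v) dsection \<Rightarrow> ('m, 'v) dsection) \<Rightarrow> bool" where
  "cps A H J \<longleftrightarrow> almost_cps A J \<and>
     (\<forall>u\<in>dsections A. \<forall>v\<in>dsections A. courant_torsion A H J u v = 0)"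

definition J_of ::
    "('m::topological_space, 'e::real_inner, 'v::real_vector) algebroid
      \<Rightarrow> (('m, 'v) form \<Rightarrow> ('m, 'v) form \<Rightarrow> 'm \<Rightarrow> real) \<Rightarrow> (('m \<Rightarrow> 'v) \<Rightarrow> 'm \<Rightarrow> 'v)
      \<Rightarrow> ('m, 'v) form \<Rightarrow> ('m, 'v) dsection \<Rightarrow> ('m, 'v) dsection" where
  "J_of A P N \<sigma> = (\<lambda>(X, \<alpha>). (N X + sharp A P \<alpha>, flat \<sigma> X - transp A N \<alpha>))"

end

theory Submission
  imports Defs
begin

text \<open>
  The proof evaluates the identities \<open>J\<^sup>2 = \<lambda>\<close> and \<open>T\<^sub>J = 0\<close> on pure sections and pure covectors and
  reads off their components. Write \<open>a = \<pi>\<^sup>\<sharp>\<alpha>\<close>, \<open>b = \<pi>\<^sup>\<sharp>\<beta>\<close>.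

  The components of \<open>J\<^sup>2 = \<lambda>\<close> give \<open>N\<pi>\<^sup>\<sharp> = \<pi>\<^sup>\<sharp> \<^sup>tN\<close>, \<open>\<sigma>\<^sup>\<flat>N = \<^sup>tN\<sigma>\<^sup>\<flat>\<close> and \<open>\<sigma>\<^sup>\<flat>\<pi>\<^sup>\<sharp> + (\<^sup>tN)\<^sup>2 = \<lambda>\<close>. The
  second of these makes \<open>\<sigma>(N\<cdot>, \<cdot>)\<close> a \<open>2\<close>-form.

  On two covectors, \<open>T\<^sub>J = 0\<close> says that \<open>[a, b] = \<pi>\<^sup>\<sharp>[\<alpha>, \<beta>]\<^sub>\<pi>\<close>, that is, \<open>\<pi>\<close> is Poisson, and that
  \<open>\<^sup>tN[\<alpha>, \<beta>]\<^sub>\<pi> = \<L>\<^sub>a(\<^sup>tN\<beta>) - i\<^sub>b d(\<^sup>tN\<alpha>) + H(a, b, \<cdot>)\<close>. A Cartan computation shows that \<open>C\<^sub>\<pi>\<^sub>,\<^sub>N(\<alpha>, \<beta>)\<close> is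
  twice the difference \<open>\<^sup>tN[\<alpha>, \<beta>]\<^sub>\<pi> - \<L>\<^sub>a(\<^sup>tN\<beta>) + i\<^sub>b d(\<^sup>tN\<alpha>)\<close>, so that the concomitant is \<open>2H(a, b, \<cdot>)\<close>.

  On two sections, the first component of \<open>T\<^sub>J = 0\<close> is the formula for \<open>T\<^sub>N\<close> with
  \<open>\<psi> = -d\<sigma>\<close>, and the second is
  \<open>i\<^sub>N d\<sigma> = d(\<sigma>(N\<cdot>, \<cdot>)) + \<H> + \<lambda>H\<close> (\<open>torsion_free_ins_end_d\<close>). Applying \<open>d\<close> and using \<open>d\<^sup>2 = 0\<close> and
  \<open>dH = 0\<close> gives \<open>d i\<^sub>N d\<sigma> = d\<H>\<close>, and this is the last condition, \<open>d\<^sub>N\<psi> = d\<H>\<close>,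
  because \<open>d\<^sub>N\<psi> = i\<^sub>N d\<psi> - d i\<^sub>N \<psi> = d i\<^sub>N d\<sigma>\<close>.

  Two facts in this outline depend on the geometry of the base. First, tensors are multilinear maps
  on global sections, so that \<open>\<pi>\<^sup>\<sharp>\<close> is defined only once covectors are known to separate sections and
  every \<open>\<pi>(\<alpha>, \<cdot>)\<close> is known to be evaluation at a section; both are local, and bump functions reduce
  them to frames (\<open>local_dual_frame\<close>, \<open>sharp_exists\<close>). Second, the Schouten bracket is given through
  local decompositions \<open>\<pi> = \<Sum>\<^sub>i X\<^sub>i \<and> Y\<^sub>i\<close>. The morphism property of \<open>\<pi>\<^sup>\<sharp>\<close> is equivalent to the cyclic
  identity of \<open>sharp_morphism_imp_cyclic_identity\<close>, whose left-hand side becomes half the Schouten sum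
  when such a decomposition is inserted (\<open>cyclic_expr_symmetrised\<close>, \<open>sharp_morphism_imp_poisson\<close>).
\<close>

section \<open>Calculus of smooth maps\<close>

text \<open>
  Derivatives are taken at a point of the ambient space, not within the set, so smoothness on a
  union of open sets can be checked on each of them.
\<close>

lemma ck_on_localI:
  assumes "\<And>x. x \<in> S \<Longrightarrow> \<exists>T. open T \<and> x \<in> T \<and> ck_on k T f"
  shows "ck_on k S f"
  using assms
proof (induction k arbitrary: f)
  case 0
  have "isCont f x" if "x \<in> S" for x
    using 0[OF that] by (auto simp: continuous_on_eq_continuous_at)
  then show ?case
    by (simp add: continuous_at_imp_continuous_on)
next
  case (Suc k)
  have "f differentiable (at x)" if "x \<in> S" for x
    using Suc.prems[OF that] by auto
  moreover have "ck_on k S (\<lambda>x. frechet_derivative f (at x) v)" for v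
    by (rule Suc.IH) (use Suc.prems in fastforce)
  ultimately show ?case
    by simp
qed

lemma ck_on_subset: "ck_on k T f \<Longrightarrow> S \<subseteq> T \<Longrightarrow> ck_on k S f"
  by (induction k arbitrary: f) (auto intro: continuous_on_subset)

lemma frechet_derivative_cong_open:
  assumes "open S" "x \<in> S" "\<And>y. y \<in> S \<Longrightarrow> f y = g y"
  shows "frechet_derivative f (at x) = frechet_derivative g (at x)"
proof -
  have "(f has_derivative f') (at x) \<longleftrightarrow> (g has_derivative f') (at x)" for f'
    using has_derivative_transform_within_open[of f f' x UNIV S g]
      has_derivative_transform_within_open[of g f' x UNIV S f] assms by auto
  then show ?thesis
    by (simp add: frechet_derivative_def)
qed

lemma ck_on_cong:
  assumes "open S" "\<And>y. y \<in> S \<Longrightarrow> f y = g y" "ck_on k S f"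
  shows "ck_on k S g"
  using assms(2,3)
proof (induction k arbitrary: f g)
  case 0
  then show ?case
    using continuous_on_cong[of S S f g] by simp
next
  case (Suc k)
  have "g differentiable (at x)" if "x \<in> S" for x
  proof -
    have "f differentiable (at x)"
      using Suc.prems that by simp
    then show ?thesis
      using has_derivative_transform_within_open[of f _ x UNIV S g] assms(1) that Suc.prems(1)
      unfolding differentiable_def by blast
  qed
  moreover have "ck_on k S (\<lambda>x. frechet_derivative g (at x) v)" for v
  proof (rule Suc.IH)
    show "frechet_derivative f (at y) v = frechet_derivative g (at y) v" if "y \<in> S" for y
      by (rule fun_cong[OF frechet_derivative_cong_open[OF assms(1) that Suc.prems(1)]])
    show "ck_on k S (\<lambda>x. frechet_derivative f (at x) v)"
      using Suc.prems(2) by simp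
  qed
  ultimately show ?case
    by simp
qed

lemma ck_on_Suc_D: "ck_on (Suc k) S f \<Longrightarrow> ck_on k S f"
proof (induction k arbitrary: f)
  case 0
  then show ?case
    by (simp add: continuous_at_imp_continuous_on differentiable_imp_continuous_within)
next
  case (Suc k)
  have "ck_on k S (\<lambda>x. frechet_derivative f (at x) v)" for v
    using Suc.IH Suc.prems by (metis ck_on.simps(2))
  then show ?case
    using Suc.prems by simp
qed

lemma ck_on_const [simp]: "ck_on k S (\<lambda>x. c)"
  by (induction k arbitrary: c) auto

lemma ck_on_add:
  assumes "open S" "ck_on k S f" "ck_on k S g"
  shows "ck_on k S (\<lambda>x. f x + g x)"
  using assms(2,3)
proof (induction k arbitrary: f g)
  case 0
  then show ?case by (simp add: continuous_on_add)
next
  case (Suc k)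
  have "ck_on k S (\<lambda>x. frechet_derivative (\<lambda>x. f x + g x) (at x) v)" for v
  proof (rule ck_on_cong[OF assms(1)])
    show "ck_on k S (\<lambda>x. frechet_derivative f (at x) v + frechet_derivative g (at x) v)"
      by (rule Suc.IH) (use Suc.prems in auto)
    show "frechet_derivative f (at x) v + frechet_derivative g (at x) v
        = frechet_derivative (\<lambda>x. f x + g x) (at x) v" if "x \<in> S" for x
    proof -
      have "((\<lambda>x. f x + g x) has_derivative
          (\<lambda>v. frechet_derivative f (at x) v + frechet_derivative g (at x) v)) (at x)"
        using Suc.prems that by (intro has_derivative_add) (auto simp: frechet_derivative_works)
      from frechet_derivative_at[OF this] show ?thesis by metis
    qed
  qed
  then show ?case
    using Suc.prems by (auto intro: differentiable_add)
qed

lemma ck_on_bilinear: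
  assumes "bounded_bilinear pr" "open S" "ck_on k S f" "ck_on k S g"
  shows "ck_on k S (\<lambda>x. pr (f x) (g x))"
  using assms(3,4)
proof (induction k arbitrary: f g)
  case 0
  then show ?case by (simp add: bounded_bilinear.continuous_on[OF assms(1)])
next
  case (Suc k)
  have D: "((\<lambda>x. pr (f x) (g x)) has_derivative
      (\<lambda>v. pr (f x) (frechet_derivative g (at x) v) + pr (frechet_derivative f (at x) v) (g x)))
      (at x)" if "x \<in> S" for x
    using Suc.prems that
    by (intro bounded_bilinear.FDERIV[OF assms(1)]) (auto simp: frechet_derivative_works)
  have "ck_on k S (\<lambda>x. frechet_derivative (\<lambda>x. pr (f x) (g x)) (at x) v)" for v
  proof (rule ck_on_cong[OF assms(2)])
    have "ck_on k S f" "ck_on k S g"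
      using Suc.prems ck_on_Suc_D by blast+
    then show "ck_on k S (\<lambda>x. pr (f x) (frechet_derivative g (at x) v)
        + pr (frechet_derivative f (at x) v) (g x))"
      by (intro ck_on_add assms(2) Suc.IH) (use Suc.prems in auto)
    show "pr (f x) (frechet_derivative g (at x) v) + pr (frechet_derivative f (at x) v) (g x)
        = frechet_derivative (\<lambda>x. pr (f x) (g x)) (at x) v" if "x \<in> S" for x
      using frechet_derivative_at[OF D[OF that]] by metis
  qed
  then show ?case
    using D by (auto simp: differentiable_def)
qed

text \<open>
  The inner function is real-valued, so the directional derivatives of the outer function are
  multiples of its ordinary derivative and the induction needs only the product rule.
\<close>

lemma ck_on_compose_real:
  fixes b :: "real \<Rightarrow> real" and f :: "'e::real_normed_vector \<Rightarrow> real"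
  assumes "open S" "ck_on k UNIV b" "ck_on k S f"
  shows "ck_on k S (\<lambda>x. b (f x))"
  using assms(2,3)
proof (induction k arbitrary: b)
  case 0
  then show ?case by (auto intro: continuous_on_compose2)
next
  case (Suc k)
  define b' where "b' = (\<lambda>t. frechet_derivative b (at t) 1)"
  have b: "(b has_derivative (\<lambda>h. h * b' t)) (at t)" for t
  proof -
    have *: "(b has_derivative frechet_derivative b (at t)) (at t)"
      using Suc.prems by (simp add: frechet_derivative_works)
    then have "linear (frechet_derivative b (at t))"
      by (rule has_derivative_linear)
    then have "frechet_derivative b (at t) (h *\<^sub>R 1) = h *\<^sub>R b' t" for h
      unfolding b'_def by (rule linear_cmul)
    then have "frechet_derivative b (at t) = (\<lambda>h. h * b' t)"
      by (intro ext) simp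
    with * show ?thesis by simp
  qed
  have D: "((\<lambda>x. b (f x)) has_derivative (\<lambda>v. frechet_derivative f (at x) v * b' (f x))) (at x)"
    if "x \<in> S" for x
    by (rule has_derivative_compose[OF _ b])
      (use Suc.prems(2) that frechet_derivative_works in auto)
  have "ck_on k S (\<lambda>x. frechet_derivative (\<lambda>x. b (f x)) (at x) v)" for v
  proof (rule ck_on_cong[OF assms(1)])
    have "ck_on k UNIV b'"
      using Suc.prems(1) by (simp add: b'_def)
    then have b'f: "ck_on k S (\<lambda>x. b' (f x))"
      using ck_on_Suc_D[OF Suc.prems(2)] by (rule Suc.IH)
    have "ck_on k S (\<lambda>x. frechet_derivative f (at x) v)"
      using Suc.prems(2) by simp
    then show "ck_on k S (\<lambda>x. frechet_derivative f (at x) v * b' (f x))"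
      using b'f by (rule ck_on_bilinear[OF bounded_bilinear_mult assms(1)])
    show "frechet_derivative f (at x) v * b' (f x) = frechet_derivative (\<lambda>x. b (f x)) (at x) v"
      if "x \<in> S" for x
      using frechet_derivative_at[OF D[OF that]] by metis
  qed
  then show ?case
    using D by (auto simp: differentiable_def)
qed

text \<open>
  The factor \<open>t\<^sup>-\<^sup>n\<close> makes the family closed under differentiation up to linear combinations, so
  all its members are smooth by a simultaneous induction on the order.
\<close>

definition flat_exp :: "nat \<Rightarrow> real \<Rightarrow> real" where
  "flat_exp n t = (if t > 0 then (1 / t) ^ n * exp (- (1 / t)) else 0)"

lemma flat_exp_tendsto_0: "(flat_exp n \<longlongrightarrow> 0) (at 0)"
proof -
  have "((\<lambda>x::real. x ^ n / exp x) \<longlongrightarrow> 0) at_top"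
    by (rule tendsto_power_div_exp_0)
  moreover have "filterlim (\<lambda>t::real. 1 / t) at_top (at_right 0)"
    using filterlim_inverse_at_top_right by (simp add: inverse_eq_divide)
  ultimately have "((\<lambda>t::real. (1 / t) ^ n / exp (1 / t)) \<longlongrightarrow> 0) (at_right 0)"
    by (rule filterlim_compose)
  moreover have "\<forall>\<^sub>F t in at_right 0. (1 / t) ^ n / exp (1 / t) = flat_exp n t"
    by (auto simp: eventually_at_filter flat_exp_def exp_minus field_simps)
  ultimately have right: "(flat_exp n \<longlongrightarrow> 0) (at_right 0)"
    by (rule Lim_transform_eventually)
  have "\<forall>\<^sub>F t in at_left 0. 0 = flat_exp n t"
    by (auto simp: eventually_at_filter flat_exp_def)
  then have "(flat_exp n \<longlongrightarrow> 0) (at_left 0)"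
    by (rule Lim_transform_eventually[OF tendsto_const])
  with right show ?thesis
    by (simp add: filterlim_at_split)
qed

lemma flat_exp_deriv:
  "(flat_exp n has_real_derivative flat_exp (n + 2) t - real n * flat_exp (n + 1) t) (at t)"
proof (cases t "0::real" rule: linorder_cases)
  case less
  have "((\<lambda>_. 0) has_real_derivative 0) (at t)" by simp
  then have "(flat_exp n has_real_derivative 0) (at t)"
    by (rule has_field_derivative_transform_within_open[where S = "{..<0}"])
      (use less in \<open>auto simp: flat_exp_def\<close>)
  with less show ?thesis by (simp add: flat_exp_def)
next
  case equal
  have "((\<lambda>h. flat_exp n h / h) \<longlongrightarrow> 0) (at 0)"
  proof (rule Lim_transform_eventually[OF flat_exp_tendsto_0[of "n + 1"]])
    show "\<forall>\<^sub>F h in at 0. flat_exp (n + 1) h = flat_exp n h / h"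
      by (auto simp: eventually_at_filter flat_exp_def field_simps)
  qed
  with equal show ?thesis
    by (simp add: has_field_derivative_iff flat_exp_def)
next
  case greater
  define u where "u = 1 / t"
  have h: "((\<lambda>t. 1 / t) has_real_derivative - u\<^sup>2) (at t)"
    using greater by (auto intro!: derivative_eq_intros simp: u_def field_simps power2_eq_square)
  have "((\<lambda>t. (1 / t) ^ n * exp (- (1 / t))) has_real_derivative
      real n * (- u\<^sup>2 * u ^ (n - Suc 0)) * exp (- u) + exp (- u) * u\<^sup>2 * u ^ n) (at t)"
    using DERIV_mult[OF DERIV_power[OF h, of n] DERIV_fun_exp[OF DERIV_minus[OF h]]]
    by (simp add: u_def)
  moreover have "real n * (- u\<^sup>2 * u ^ (n - Suc 0)) * exp (- u) + exp (- u) * u\<^sup>2 * u ^ n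
      = u ^ (n + 2) * exp (- u) - real n * (u ^ (n + 1) * exp (- u))"
    by (cases n) (simp_all add: algebra_simps power2_eq_square)
  ultimately have "((\<lambda>t. (1 / t) ^ n * exp (- (1 / t))) has_real_derivative
      (1 / t) ^ (n + 2) * exp (- (1 / t)) - real n * ((1 / t) ^ (n + 1) * exp (- (1 / t)))) (at t)"
    by (simp add: u_def)
  then have "(flat_exp n has_real_derivative
      (1 / t) ^ (n + 2) * exp (- (1 / t)) - real n * ((1 / t) ^ (n + 1) * exp (- (1 / t)))) (at t)"
    by (rule has_field_derivative_transform_within_open[where S = "{0<..}"])
      (use greater in \<open>auto simp: flat_exp_def\<close>)
  with greater show ?thesis by (simp add: flat_exp_def)
qed

lemma ck_on_flat_exp: "ck_on k UNIV (flat_exp n)"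
proof (induction k arbitrary: n)
  case 0
  have "isCont (flat_exp n) t" for t
    using flat_exp_deriv DERIV_isCont by blast
  then show ?case by (simp add: continuous_at_imp_continuous_on)
next
  case (Suc k)
  have D: "(flat_exp n has_derivative
      (\<lambda>v. v * flat_exp (n + 2) t + (- real n * v) * flat_exp (n + 1) t)) (at t)" for t
    by (rule has_derivative_eq_rhs[OF flat_exp_deriv[unfolded has_field_derivative_def]])
      (auto simp: algebra_simps)
  have "(\<lambda>t. frechet_derivative (flat_exp n) (at t) v) =
      (\<lambda>t. v * flat_exp (n + 2) t + (- real n * v) * flat_exp (n + 1) t)" for v
    using frechet_derivative_at[OF D] by metis
  then have "ck_on k UNIV (\<lambda>t. frechet_derivative (flat_exp n) (at t) v)" for v
    by (simp only:) (intro ck_on_add ck_on_bilinear[OF bounded_bilinear_mult] open_UNIV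
        ck_on_const Suc.IH)
  with D show ?case by (auto simp: differentiable_def)
qed

lemma smooth_step_exists:
  obtains b :: "real \<Rightarrow> real"
  where "\<And>k. ck_on k UNIV b" "\<And>t. t \<le> 1 \<Longrightarrow> b t = 1" "\<And>t. t \<ge> 2 \<Longrightarrow> b t = 0"
proof -
  let ?f = "flat_exp 0" and ?c = "flat_exp 0 1"
  \<comment> \<open>\<open>c - f (t - 1)\<close> is the constant \<open>c\<close> for \<open>t \<le> 1\<close> and non-positive for \<open>t \<ge> 2\<close>.\<close>
  define b where "b t = ?f (?c + (- 1) * ?f (t + (- 1))) * (1 / ?f ?c)" for t
  have id: "ck_on k UNIV (\<lambda>t::real. t)" for k
  proof (cases k)
    case (Suc j)
    have "frechet_derivative (\<lambda>t::real. t) (at x) v = v" for x v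
      using frechet_derivative_at[OF has_derivative_ident] by metis
    then show ?thesis using Suc by simp
  qed simp
  have f: "ck_on k UNIV ?f" for k
    by (rule ck_on_flat_exp)
  have "ck_on k UNIV b" for k
    unfolding b_def
    by (intro ck_on_bilinear[OF bounded_bilinear_mult] ck_on_compose_real[OF _ f] ck_on_add id
        open_UNIV ck_on_const)
  moreover have "b t = 1" if "t \<le> 1" for t
    using that by (simp add: b_def flat_exp_def)
  moreover have "b t = 0" if "t \<ge> 2" for t
  proof -
    have "?f (t + (- 1)) \<ge> ?c"
      using that by (simp add: flat_exp_def field_simps)
    then show ?thesis by (simp add: b_def flat_exp_def)
  qed
  ultimately show thesis using that by blast
qed

section \<open>Bump functions\<close>

lemma orthonormal_spanning_set_exists:
  fixes B :: "'e::real_inner set"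
  assumes "finite B"
  shows "\<exists>C. finite C \<and> (\<forall>b\<in>C. \<forall>c\<in>C. b \<bullet> c = (if b = c then 1 else 0)) \<and> span B \<subseteq> span C"
  using assms
proof (induction B)
  case empty
  then show ?case by (intro exI[of _ "{}"]) auto
next
  case (insert x B)
  then obtain C where C: "finite C" "\<forall>b\<in>C. \<forall>c\<in>C. b \<bullet> c = (if b = c then 1 else 0)"
    "span B \<subseteq> span C" by blast
  define y where "y = x - (\<Sum>c\<in>C. (x \<bullet> c) *\<^sub>R c)"
  have s: "(\<Sum>c\<in>C. (x \<bullet> c) *\<^sub>R c) \<in> span C"
    by (simp add: span_base span_scale span_sum)
  have orth: "y \<bullet> c = 0" if "c \<in> C" for c
  proof -
    have "(\<Sum>b\<in>C. (x \<bullet> b) * (b \<bullet> c)) = (\<Sum>b\<in>C. if b = c then x \<bullet> b else 0)"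
      by (rule sum.cong) (use C that in auto)
    then show ?thesis
      using that C(1) by (simp add: y_def inner_diff_left inner_sum_left)
  qed
  show ?case
  proof (cases "y = 0")
    case True
    then have "x \<in> span C" using s by (simp add: y_def)
    then have "span (insert x B) \<subseteq> span C"
      using C(3) span_superset[of B] by (intro span_minimal) auto
    with C show ?thesis by blast
  next
    case False
    define z where "z = (1 / norm y) *\<^sub>R y"
    have zz: "z \<bullet> z = 1"
      using False by (simp add: z_def power2_norm_eq_inner[symmetric] power2_eq_square)
    have zc: "z \<bullet> c = 0" "c \<bullet> z = 0" if "c \<in> C" for c
      using orth[OF that] by (simp_all add: z_def inner_commute)
    have "y = norm y *\<^sub>R z" using False by (simp add: z_def)
    then have "y \<in> span (insert z C)"
      by (metis insertI1 span_base span_scale)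
    moreover have "(\<Sum>c\<in>C. (x \<bullet> c) *\<^sub>R c) \<in> span (insert z C)"
      using s span_mono[of C "insert z C"] by blast
    ultimately have "x \<in> span (insert z C)"
      using span_add[of y "insert z C" "\<Sum>c\<in>C. (x \<bullet> c) *\<^sub>R c"] by (simp add: y_def)
    then have "span (insert x B) \<subseteq> span (insert z C)"
      using C(3) span_superset[of B] span_mono[of C "insert z C"]
      by (intro span_minimal) auto
    moreover have "\<forall>b\<in>insert z C. \<forall>c\<in>insert z C. b \<bullet> c = (if b = c then 1 else 0)"
      using C(2) zz zc by fastforce
    ultimately show ?thesis using C(1) by blast
  qed
qed

text \<open>
  In coordinates with respect to an orthonormal spanning set the ball lies in a cube, which is a
  finite sum of compact segments.
\<close>

lemma compact_cball_finite_span: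
  fixes a :: "'e::real_inner"
  assumes "finite B" "span B = (UNIV::'e set)"
  shows "compact (cball a r)"
proof -
  obtain C :: "'e set" where C: "finite C" "\<forall>b\<in>C. \<forall>c\<in>C. b \<bullet> c = (if b = c then 1 else 0)"
    "span C = UNIV"
    using orthonormal_spanning_set_exists[OF assms(1)] assms(2) by auto
  define Q where "Q D = {\<Sum>c\<in>D. u c *\<^sub>R c | u. \<forall>c\<in>D. \<bar>u c\<bar> \<le> r}" for D :: "'e set"
  have comp: "compact (Q D)" if "finite D" for D
    using that
  proof (induction D)
    case empty
    then show ?case by (simp add: Q_def)
  next
    case (insert x D)
    have "compact ((\<lambda>t. t *\<^sub>R x) ` {- r..r})"
      by (intro compact_continuous_image continuous_intros compact_Icc)
    then have "compact {p + q | p q. p \<in> (\<lambda>t. t *\<^sub>R x) ` {- r..r} \<and> q \<in> Q D}"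
      using insert.IH by (rule compact_sums)
    moreover have "{p + q | p q. p \<in> (\<lambda>t. t *\<^sub>R x) ` {- r..r} \<and> q \<in> Q D} = Q (insert x D)"
      (is "?L = ?R")
    proof
      show "?L \<subseteq> ?R"
      proof
        fix z assume "z \<in> ?L"
        then obtain t u where z: "z = t *\<^sub>R x + (\<Sum>c\<in>D. u c *\<^sub>R c)" "\<bar>t\<bar> \<le> r" "\<forall>c\<in>D. \<bar>u c\<bar> \<le> r"
          by (auto simp: Q_def abs_le_iff)
        have "(\<Sum>c\<in>D. u c *\<^sub>R c) = (\<Sum>c\<in>D. (u(x := t)) c *\<^sub>R c)"
          by (rule sum.cong) (use insert.hyps in auto)
        with z insert.hyps show "z \<in> ?R"
          by (auto simp: Q_def intro!: exI[of _ "u(x := t)"])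
      qed
      show "?R \<subseteq> ?L"
      proof
        fix z assume "z \<in> ?R"
        then obtain u where u: "z = (\<Sum>c\<in>insert x D. u c *\<^sub>R c)" "\<forall>c\<in>insert x D. \<bar>u c\<bar> \<le> r"
          by (auto simp: Q_def)
        then have "u x *\<^sub>R x \<in> (\<lambda>t. t *\<^sub>R x) ` {- r..r}" "(\<Sum>c\<in>D. u c *\<^sub>R c) \<in> Q D"
          by (auto simp: Q_def abs_le_iff)
        moreover have "z = u x *\<^sub>R x + (\<Sum>c\<in>D. u c *\<^sub>R c)"
          using u(1) insert.hyps by simp
        ultimately show "z \<in> ?L" by blast
      qed
    qed
    ultimately show ?case by simp
  qed
  have expand: "x = (\<Sum>c\<in>C. (x \<bullet> c) *\<^sub>R c)" for x
  proof -
    have "x \<in> span C" using C(3) by simp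
    then obtain u where u: "x = (\<Sum>c\<in>C. u c *\<^sub>R c)"
      using span_finite[OF C(1)] by auto
    have "x \<bullet> c = u c" if "c \<in> C" for c
    proof -
      have "x \<bullet> c = (\<Sum>b\<in>C. u b * (b \<bullet> c))"
        by (simp add: u inner_sum_left)
      also have "\<dots> = (\<Sum>b\<in>C. if b = c then u b else 0)"
        by (rule sum.cong) (use C that in auto)
      finally show ?thesis using that C(1) by simp
    qed
    then show ?thesis using u by simp
  qed
  have "cball 0 r \<subseteq> Q C"
  proof
    fix x :: 'e assume x: "x \<in> cball 0 r"
    have "\<bar>x \<bullet> c\<bar> \<le> r" if "c \<in> C" for c
    proof -
      have "norm c = 1" using C(2) that by (simp add: norm_eq_1)
      then show ?thesis
        using Cauchy_Schwarz_ineq2[of x c] x by simp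
    qed
    then show "x \<in> Q C"
      using expand[of x] by (auto simp: Q_def)
  qed
  then have "compact (cball (0::'e) r)"
    using compact_Int_closed[OF comp[OF C(1)] closed_cball[of 0 r]] by (simp add: Int_absorb1)
  then have "compact ((+) a ` cball 0 r)"
    by (rule compact_translation)
  then show ?thesis by simp
qed

lemma chart_open_image:
  assumes "smooth_manifold C" "(U, \<phi>) \<in> C" "open W"
  shows "open (\<phi> ` (U \<inter> W))"
proof -
  have h: "open (\<phi> ` U)" "homeomorphism U (\<phi> ` U) \<phi> (inv_into U \<phi>)"
    using assms by (auto simp: smooth_manifold_def)
  have "openin (top_of_set U) (U \<inter> W)"
    using assms(3) by (simp add: openin_open_Int)
  then have "openin (top_of_set (\<phi> ` U)) (\<phi> ` (U \<inter> W))"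
    by (rule homeomorphism_imp_open_map[OF h(2)])
  then show ?thesis
    using h(1) openin_open_trans by blast
qed

lemma chart_open: "smooth_manifold C \<Longrightarrow> (U, \<phi>) \<in> C \<Longrightarrow> open U"
  by (auto simp: smooth_manifold_def)

lemma chart_exists:
  assumes "smooth_manifold C"
  obtains U \<phi> where "(U, \<phi>) \<in> C" "p \<in> U"
proof -
  have "\<exists>(U, \<phi>)\<in>C. p \<in> U"
    using assms unfolding smooth_manifold_def by blast
  then show thesis using that by blast
qed

lemma chart_transition_smooth:
  assumes "smooth_manifold C" "(U, \<phi>) \<in> C" "(V, \<psi>) \<in> C"
  shows "ck_on k (\<phi> ` (U \<inter> V)) (\<lambda>x. \<psi> (inv_into U \<phi> x))"
proof -
  have "\<forall>(U, \<phi>)\<in>C. \<forall>(V, \<psi>)\<in>C. cinf_on (\<phi> ` (U \<inter> V)) (\<psi> \<circ> inv_into U \<phi>)"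
    using assms(1) unfolding smooth_manifold_def by blast
  then have "cinf_on (\<phi> ` (U \<inter> V)) (\<psi> \<circ> inv_into U \<phi>)"
    using assms(2,3) by blast
  then show ?thesis by (simp add: cinf_on_def comp_def)
qed

lemma chart_inv:
  assumes "smooth_manifold C" "(U, \<phi>) \<in> C" "p \<in> U"
  shows "inv_into U \<phi> (\<phi> p) = p"
  using assms by (auto simp: smooth_manifold_def homeomorphism_def)

lemma smooth_fun_on_localI:
  assumes C: "smooth_manifold C"
    and loc: "\<And>p. p \<in> W \<Longrightarrow> \<exists>V g. open V \<and> p \<in> V \<and> smooth_fun_on C V g \<and> (\<forall>q\<in>V. f q = g q)"
  shows "smooth_fun_on C W f"
  unfolding smooth_fun_on_def cinf_on_def
proof (clarify)
  fix U \<phi> k assume c: "(U, \<phi>) \<in> C"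
  show "ck_on k (\<phi> ` (U \<inter> W)) (f \<circ> inv_into U \<phi>)"
  proof (rule ck_on_localI)
    fix x assume "x \<in> \<phi> ` (U \<inter> W)"
    then obtain p where p: "x = \<phi> p" "p \<in> U" "p \<in> W" by blast
    obtain V g where V: "open V" "p \<in> V" "smooth_fun_on C V g" "\<forall>q\<in>V. f q = g q"
      using loc[OF p(3)] by blast
    have "ck_on k (\<phi> ` (U \<inter> V)) (f \<circ> inv_into U \<phi>)"
    proof (rule ck_on_cong)
      show "open (\<phi> ` (U \<inter> V))" by (rule chart_open_image[OF C c V(1)])
      show "ck_on k (\<phi> ` (U \<inter> V)) (g \<circ> inv_into U \<phi>)"
        using V(3) c by (auto simp: smooth_fun_on_def cinf_on_def)
      show "\<And>y. y \<in> \<phi> ` (U \<inter> V) \<Longrightarrow> (g \<circ> inv_into U \<phi>) y = (f \<circ> inv_into U \<phi>) y"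
        using V(4) chart_inv[OF C c] by auto
    qed
    then show "\<exists>T. open T \<and> x \<in> T \<and> ck_on k T (f \<circ> inv_into U \<phi>)"
      using p V chart_open_image[OF C c V(1)] by blast
  qed
qed

lemma smooth_fun_onD:
  "smooth_fun_on C W f \<Longrightarrow> (U, \<phi>) \<in> C \<Longrightarrow>
    ck_on k (\<phi> ` (U \<inter> W)) (\<lambda>x. f (inv_into U \<phi> x))"
  by (auto simp: smooth_fun_on_def cinf_on_def comp_def)

lemma smooth_fun_onI:
  "(\<And>U \<phi> k. (U, \<phi>) \<in> C \<Longrightarrow> ck_on k (\<phi> ` (U \<inter> W)) (\<lambda>x. f (inv_into U \<phi> x))) \<Longrightarrow>
    smooth_fun_on C W f"
  by (auto simp: smooth_fun_on_def cinf_on_def comp_def)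

lemma smooth_fun_on_subset: "smooth_fun_on C V f \<Longrightarrow> W \<subseteq> V \<Longrightarrow> smooth_fun_on C W f"
  by (rule smooth_fun_onI, rule ck_on_subset[OF smooth_fun_onD]) auto

lemma smooth_fun_on_const [simp]: "smooth_fun_on C W (\<lambda>_. c)"
  by (auto simp: smooth_fun_on_def cinf_on_def comp_def)

lemma smooth_fun_on_add:
  assumes "smooth_manifold C" "open W" "smooth_fun_on C W f" "smooth_fun_on C W g"
  shows "smooth_fun_on C W (\<lambda>p. f p + g p)"
proof (rule smooth_fun_onI)
  fix U \<phi> k assume c: "(U, \<phi>) \<in> C"
  show "ck_on k (\<phi> ` (U \<inter> W)) (\<lambda>x. f (inv_into U \<phi> x) + g (inv_into U \<phi> x))"
    by (rule ck_on_add[OF chart_open_image[OF assms(1) c assms(2)]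
          smooth_fun_onD[OF assms(3) c] smooth_fun_onD[OF assms(4) c]])
qed

lemma smooth_fun_on_mult:
  assumes "smooth_manifold C" "open W" "smooth_fun_on C W f" "smooth_fun_on C W g"
  shows "smooth_fun_on C W (\<lambda>p. f p * g p)"
proof (rule smooth_fun_onI)
  fix U \<phi> k assume c: "(U, \<phi>) \<in> C"
  show "ck_on k (\<phi> ` (U \<inter> W)) (\<lambda>x. f (inv_into U \<phi> x) * g (inv_into U \<phi> x))"
    by (rule ck_on_bilinear[OF bounded_bilinear_mult chart_open_image[OF assms(1) c assms(2)]
          smooth_fun_onD[OF assms(3) c] smooth_fun_onD[OF assms(4) c]])
qed

text \<open>
  The bump function is a smooth step applied to the squared distance in a chart. Its support is
  compact because the model space is finite-dimensional, hence closed because the manifold is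
  Hausdorff; this makes the extension by zero smooth.
\<close>

lemma bump_function_exists:
  fixes C :: "('m::{t2_space,second_countable_topology} set \<times> ('m \<Rightarrow> 'e::real_inner)) set"
  assumes C: "smooth_manifold C" and U: "open U" "p \<in> U"
  obtains h W K where "smooth_fun_on C UNIV h" "open W" "p \<in> W" "closed K" "K \<subseteq> U"
    "\<And>q. q \<in> W \<Longrightarrow> h q = 1" "\<And>q. q \<notin> K \<Longrightarrow> h q = 0"
proof -
  obtain V \<phi> where V: "(V, \<phi>) \<in> C" "p \<in> V"
    using chart_exists[OF C] .
  obtain B :: "'e set" where B: "finite B" "span B = UNIV"
    using C unfolding smooth_manifold_def by blast
  have hom: "homeomorphism V (\<phi> ` V) \<phi> (inv_into V \<phi>)"
    using C V(1) by (auto simp: smooth_manifold_def)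
  have inv: "inv_into V \<phi> (\<phi> q) = q" if "q \<in> V" for q
    by (rule chart_inv[OF C V(1) that])
  obtain r where r: "r > 0" "cball (\<phi> p) r \<subseteq> \<phi> ` (V \<inter> U)"
    using chart_open_image[OF C V(1) U(1)] V(2) U(2) open_contains_cball by blast
  obtain b :: "real \<Rightarrow> real" where b: "\<And>k. ck_on k UNIV b" "\<And>t. t \<le> 1 \<Longrightarrow> b t = 1"
    "\<And>t. t \<ge> 2 \<Longrightarrow> b t = 0"
    using smooth_step_exists by blast
  \<comment> \<open>Scaled so that the step, which ends at \<open>2\<close>, ends on the sphere of radius \<open>r\<close>.\<close>
  define s where "s q = (\<phi> q - \<phi> p) \<bullet> (\<phi> q - \<phi> p) * (2 / r\<^sup>2)" for q
  define h where "h q = (if q \<in> V then b (s q) else 0)" for q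
  define K where "K = inv_into V \<phi> ` cball (\<phi> p) r"
  have cont: "continuous_on (cball (\<phi> p) r) (inv_into V \<phi>)"
    using hom r(2) by (auto simp: homeomorphism_def intro: continuous_on_subset)
  have "closed K"
    unfolding K_def
    by (intro compact_imp_closed compact_continuous_image cont compact_cball_finite_span[OF B])
  have K: "q \<in> K \<longleftrightarrow> q \<in> V \<and> \<phi> q \<in> cball (\<phi> p) r" for q
  proof
    assume "q \<in> K"
    then obtain x where x: "x \<in> cball (\<phi> p) r" "q = inv_into V \<phi> x" by (auto simp: K_def)
    then obtain q' where "q' \<in> V" "x = \<phi> q'" using r(2) by blast
    with x show "q \<in> V \<and> \<phi> q \<in> cball (\<phi> p) r" using inv by simp
  next
    assume q: "q \<in> V \<and> \<phi> q \<in> cball (\<phi> p) r"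
    then have "inv_into V \<phi> (\<phi> q) \<in> K" unfolding K_def by blast
    with q show "q \<in> K" using inv by simp
  qed
  have "K \<subseteq> U"
  proof
    fix q assume "q \<in> K"
    then have q: "q \<in> V" "\<phi> q \<in> cball (\<phi> p) r" using K by auto
    then obtain q' where "q' \<in> V" "q' \<in> U" "\<phi> q = \<phi> q'" using r(2) by blast
    with q inv show "q \<in> U" by metis
  qed
  define W where "W = V \<inter> \<phi> -` ball (\<phi> p) (r / 2)"
  have W: "q \<in> W \<longleftrightarrow> q \<in> V \<and> \<phi> q \<in> ball (\<phi> p) (r / 2)" for q
    by (auto simp: W_def)
  have "open W"
  proof -
    have "continuous_on V \<phi>" using hom by (simp add: homeomorphism_def)
    then show ?thesis
      unfolding W_def using chart_open[OF C V(1)] by (intro continuous_open_preimage) auto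
  qed
  have one: "h q = 1" if "q \<in> W" for q
  proof -
    have "norm (\<phi> q - \<phi> p) < r / 2" using that W by (simp add: dist_norm norm_minus_commute)
    then have "(norm (\<phi> q - \<phi> p))\<^sup>2 \<le> (r / 2)\<^sup>2" by (intro power_mono) auto
    moreover have "(r / 2)\<^sup>2 \<le> r\<^sup>2 / 2" by (simp add: power_divide)
    ultimately have "(norm (\<phi> q - \<phi> p))\<^sup>2 \<le> r\<^sup>2 / 2" by linarith
    then have "s q \<le> 1"
      using r(1) by (simp add: s_def power2_norm_eq_inner[symmetric] field_simps)
    then show ?thesis using b(2) that W by (simp add: h_def)
  qed
  have zero: "h q = 0" if "q \<notin> K" for q
  proof (cases "q \<in> V")
    case True
    then have "norm (\<phi> q - \<phi> p) \<ge> r"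
      using that K by (simp add: dist_norm norm_minus_commute)
    then have "(norm (\<phi> q - \<phi> p))\<^sup>2 \<ge> r\<^sup>2" using r(1) by (intro power_mono) auto
    then have "s q \<ge> 2"
      using r(1) by (simp add: s_def power2_norm_eq_inner[symmetric] field_simps)
    then show ?thesis using b(3) by (simp add: h_def)
  qed (simp add: h_def)
  have onV: "smooth_fun_on C V (\<lambda>q. b (s q))"
    unfolding smooth_fun_on_def cinf_on_def
  proof clarify
    fix V' \<phi>' k assume c: "(V', \<phi>') \<in> C"
    have op: "open (\<phi>' ` (V' \<inter> V))"
      by (rule chart_open_image[OF C c chart_open[OF C V(1)]])
    have "ck_on k (\<phi>' ` (V' \<inter> V)) (\<lambda>x. \<phi> (inv_into V' \<phi>' x))"
      by (rule chart_transition_smooth[OF C c V(1)])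
    then have 1: "ck_on k (\<phi>' ` (V' \<inter> V)) (\<lambda>x. \<phi> (inv_into V' \<phi>' x) + (- \<phi> p))"
      by (intro ck_on_add op) auto
    show "ck_on k (\<phi>' ` (V' \<inter> V)) ((\<lambda>q. b (s q)) \<circ> inv_into V' \<phi>')"
      unfolding comp_def s_def
      by (intro ck_on_compose_real[OF op b(1)] ck_on_bilinear[OF bounded_bilinear_mult op]
          ck_on_bilinear[OF bounded_bilinear_inner op] ck_on_const) (use 1 in simp_all)
  qed
  have "smooth_fun_on C UNIV h"
  proof (rule smooth_fun_on_localI[OF C])
    fix q
    show "\<exists>V g. open V \<and> q \<in> V \<and> smooth_fun_on C V g \<and> (\<forall>q\<in>V. h q = g q)"
    proof (cases "q \<in> V")
      case True
      then show ?thesis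
        using onV chart_open[OF C V(1)] by (auto simp: h_def)
    next
      case False
      then have "q \<in> - K" using K by auto
      then show ?thesis
        using zero \<open>closed K\<close> by (intro exI[of _ "- K"] exI[of _ "\<lambda>_. 0"]) auto
    qed
  qed
  moreover have "p \<in> W" using W V(2) r(1) by simp
  ultimately show thesis
    using that \<open>open W\<close> \<open>closed K\<close> \<open>K \<subseteq> U\<close> one zero by blast
qed

lemma smooth_fun_on_extend_by_zero:
  assumes C: "smooth_manifold C" and "open U" "open V" "closed K" "K \<subseteq> U"
    and h: "smooth_fun_on C UNIV h" "\<And>q. q \<notin> K \<Longrightarrow> h q = 0"
    and f: "smooth_fun_on C (U \<inter> V) f"
  shows "smooth_fun_on C V (\<lambda>q. if q \<in> U then h q * f q else 0)"
proof (rule smooth_fun_on_localI[OF C])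
  fix q assume q: "q \<in> V"
  show "\<exists>V' g. open V' \<and> q \<in> V' \<and> smooth_fun_on C V' g \<and>
      (\<forall>q\<in>V'. (if q \<in> U then h q * f q else 0) = g q)"
  proof (cases "q \<in> U")
    case True
    have "smooth_fun_on C (U \<inter> V) (\<lambda>q. h q * f q)"
      using assms by (intro smooth_fun_on_mult smooth_fun_on_subset[OF h(1)]) auto
    then show ?thesis
      using True q assms by (intro exI[of _ "U \<inter> V"] exI[of _ "\<lambda>q. h q * f q"]) auto
  next
    case False
    then show ?thesis
      using assms by (intro exI[of _ "- K"] exI[of _ "\<lambda>_. 0"]) auto
  qed
qed

section \<open>Sections of vector bundles\<close>

lemma sum_fun_apply: "(\<Sum>i\<in>I. f i) x = (\<Sum>i\<in>I. f i x)"
  by (induction I rule: infinite_finite_induct) auto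

lemma frame_coefficients_unique:
  assumes "distinct (map (\<lambda>e. e p) es)" "independent ((\<lambda>e. e p) ` set es)"
    and "(\<Sum>i<length es. a i *\<^sub>R (es ! i) p) = (\<Sum>i<length es. b i *\<^sub>R (es ! i) p)"
    and i: "i < length es"
  shows "a i = b i"
proof -
  define g where "g j = (es ! j) p" for j
  let ?I = "{..<length es}"
  have inj: "inj_on g ?I"
    using assms(1) by (auto simp: inj_on_def g_def distinct_conv_nth)
  have img: "g ` ?I = (\<lambda>e. e p) ` set es"
    by (auto simp: g_def set_conv_nth)
  define u where "u x = a (inv_into ?I g x) - b (inv_into ?I g x)" for x
  have ug: "u (g j) = a j - b j" if "j < length es" for j
    using inv_into_f_f[OF inj] that by (simp add: u_def)
  have "(\<Sum>x\<in>g ` ?I. u x *\<^sub>R x) = (\<Sum>j<length es. u (g j) *\<^sub>R g j)"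
    by (simp add: sum.reindex[OF inj])
  also have "\<dots> = (\<Sum>j<length es. a j *\<^sub>R g j - b j *\<^sub>R g j)"
    by (rule sum.cong) (simp_all add: ug scaleR_left_diff_distrib)
  also have "\<dots> = 0"
    using assms(3) by (simp add: sum_subtractf g_def)
  finally have "u (g i) = 0"
    using independentD[OF assms(2)[folded img], of "g ` ?I" u "g i"] i by auto
  then show ?thesis using ug[OF i] by simp
qed

locale lie_algebroid_on =
  fixes A :: "('m::{t2_space,second_countable_topology}, 'e::real_inner, 'v::real_vector) algebroid"
  assumes lie_algebroid: "lie_algebroid A"
begin

(* Keeps \<open>forms A 1\<close> usable on the left-hand sides of simplification rules. *)
declare One_nat_def [simp del]

abbreviation \<Gamma> where "\<Gamma> \<equiv> sections A"
abbreviation F where "F \<equiv> smooth_funs A"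

lemma manifold: "smooth_manifold (charts A)"
  using lie_algebroid unfolding lie_algebroid_def by blast

lemma algebroid_bundle: "vector_bundle (charts A) (fibre A) (frames A)"
  using lie_algebroid unfolding lie_algebroid_def by blast

lemma fibre_subspace: "subspace (fibre A p)"
  using algebroid_bundle unfolding vector_bundle_def by blast

lemma frame_exists: obtains U es where "(U, es) \<in> frames A" "p \<in> U"
proof -
  have "\<exists>(U, es)\<in>frames A. p \<in> U"
    using algebroid_bundle unfolding vector_bundle_def by blast
  then show thesis using that by blast
qed

lemma frame_basis:
  assumes "(U, es) \<in> frames A"
  shows "open U"
    and "p \<in> U \<Longrightarrow> distinct (map (\<lambda>e. e p) es)"
    and "p \<in> U \<Longrightarrow> independent ((\<lambda>e. e p) ` set es)"
    and "p \<in> U \<Longrightarrow> span ((\<lambda>e. e p) ` set es) = fibre A p"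
proof -
  have "\<forall>(U, es)\<in>frames A. open U \<and> (\<forall>p\<in>U. distinct (map (\<lambda>e. e p) es) \<and>
      independent ((\<lambda>e. e p) ` set es) \<and> span ((\<lambda>e. e p) ` set es) = fibre A p)"
    using algebroid_bundle unfolding vector_bundle_def by blast
  then have "open U \<and> (\<forall>p\<in>U. distinct (map (\<lambda>e. e p) es) \<and>
      independent ((\<lambda>e. e p) ` set es) \<and> span ((\<lambda>e. e p) ` set es) = fibre A p)"
    using assms by blast
  then show "open U" and "p \<in> U \<Longrightarrow> distinct (map (\<lambda>e. e p) es)"
    and "p \<in> U \<Longrightarrow> independent ((\<lambda>e. e p) ` set es)"
    and "p \<in> U \<Longrightarrow> span ((\<lambda>e. e p) ` set es) = fibre A p"
    by blast+
qed

lemma frame_transition: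
  assumes "(U, es) \<in> frames A" "(V, fs) \<in> frames A" "f \<in> set fs"
  shows "smooth_wrt_frame (charts A) es (U \<inter> V) f"
proof -
  have "\<forall>(U, es)\<in>frames A. \<forall>(V, fs)\<in>frames A. \<forall>f\<in>set fs.
      smooth_wrt_frame (charts A) es (U \<inter> V) f"
    using algebroid_bundle unfolding vector_bundle_def by blast
  then show ?thesis using assms by blast
qed

lemma in_F: "f \<in> F \<longleftrightarrow> smooth_fun_on (charts A) UNIV f"
  by (simp add: smooth_funs_def)

lemma F_smooth_on: "f \<in> F \<Longrightarrow> smooth_fun_on (charts A) W f"
  by (rule smooth_fun_on_subset[of _ UNIV]) (simp_all add: in_F)

lemma F_const [simp]: "(\<lambda>_. c) \<in> F"
  by (simp add: in_F)

lemma F_zero [simp]: "0 \<in> F"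
  using F_const[of 0] by (simp add: zero_fun_def)

lemma F_add [simp]: "f \<in> F \<Longrightarrow> g \<in> F \<Longrightarrow> f + g \<in> F"
  by (simp add: in_F plus_fun_def smooth_fun_on_add[OF manifold])

lemma F_mult [simp]: "f \<in> F \<Longrightarrow> g \<in> F \<Longrightarrow> f * g \<in> F"
  by (simp add: in_F times_fun_def smooth_fun_on_mult[OF manifold])

lemma F_uminus [simp]: "f \<in> F \<Longrightarrow> - f \<in> F"
  using F_mult[of "\<lambda>_. - 1" f] by (simp add: times_fun_def fun_Compl_def)

lemma F_diff [simp]: "f \<in> F \<Longrightarrow> g \<in> F \<Longrightarrow> f - g \<in> F"
  using F_add[of f "- g"] by simp

lemma F_sum: "(\<And>i. i \<in> I \<Longrightarrow> f i \<in> F) \<Longrightarrow> (\<Sum>i\<in>I. f i) \<in> F"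
  by (induction I rule: infinite_finite_induct) auto

lemma smooth_wrt_frameI:
  assumes "\<And>i. i < length es \<Longrightarrow> smooth_fun_on C W (c i)"
    "\<And>p. p \<in> W \<Longrightarrow> s p = (\<Sum>i<length es. c i p *\<^sub>R (es ! i) p)"
  shows "smooth_wrt_frame C es W s"
  using assms unfolding smooth_wrt_frame_def by blast

lemma section_fibre: "X \<in> \<Gamma> \<Longrightarrow> X p \<in> fibre A p"
  by (simp add: sections_def)

lemma section_smooth: "X \<in> \<Gamma> \<Longrightarrow> (U, es) \<in> frames A \<Longrightarrow> smooth_wrt_frame (charts A) es U X"
  unfolding sections_def by blast

lemma sectionI:
  assumes "\<And>p. X p \<in> fibre A p"
    and "\<And>U es. (U, es) \<in> frames A \<Longrightarrow> smooth_wrt_frame (charts A) es U X"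
  shows "X \<in> \<Gamma>"
  using assms unfolding sections_def by blast

lemma section_add [simp]: "X \<in> \<Gamma> \<Longrightarrow> Y \<in> \<Gamma> \<Longrightarrow> X + Y \<in> \<Gamma>"
proof (rule sectionI)
  assume X: "X \<in> \<Gamma>" and Y: "Y \<in> \<Gamma>"
  show "(X + Y) p \<in> fibre A p" for p
    using X Y subspace_add[OF fibre_subspace] by (simp add: section_fibre)
  fix U es assume f: "(U, es) \<in> frames A"
  obtain c where "\<forall>i<length es. smooth_fun_on (charts A) U (c i)"
    "\<forall>p\<in>U. X p = (\<Sum>i<length es. c i p *\<^sub>R (es ! i) p)"
    using section_smooth[OF X f] unfolding smooth_wrt_frame_def by blast
  note c = this[rule_format]
  obtain c' where "\<forall>i<length es. smooth_fun_on (charts A) U (c' i)"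
    "\<forall>p\<in>U. Y p = (\<Sum>i<length es. c' i p *\<^sub>R (es ! i) p)"
    using section_smooth[OF Y f] unfolding smooth_wrt_frame_def by blast
  note c' = this[rule_format]
  show "smooth_wrt_frame (charts A) es U (X + Y)"
  proof (rule smooth_wrt_frameI)
    show "smooth_fun_on (charts A) U (\<lambda>p. c i p + c' i p)" if "i < length es" for i
      by (rule smooth_fun_on_add[OF manifold frame_basis(1)[OF f] c(1)[OF that] c'(1)[OF that]])
    show "(X + Y) p = (\<Sum>i<length es. (c i p + c' i p) *\<^sub>R (es ! i) p)" if "p \<in> U" for p
      using c(2) c'(2) that by (simp add: scaleR_left_distrib sum.distrib)
  qed
qed

lemma section_smult [simp]: "f \<in> F \<Longrightarrow> X \<in> \<Gamma> \<Longrightarrow> smult f X \<in> \<Gamma>"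
proof (rule sectionI)
  assume h: "f \<in> F" and X: "X \<in> \<Gamma>"
  show "smult f X p \<in> fibre A p" for p
    using X subspace_scale[OF fibre_subspace] by (simp add: section_fibre smult_def)
  fix U es assume f: "(U, es) \<in> frames A"
  obtain c where "\<forall>i<length es. smooth_fun_on (charts A) U (c i)"
    "\<forall>p\<in>U. X p = (\<Sum>i<length es. c i p *\<^sub>R (es ! i) p)"
    using section_smooth[OF X f] unfolding smooth_wrt_frame_def by blast
  note c = this[rule_format]
  show "smooth_wrt_frame (charts A) es U (smult f X)"
  proof (rule smooth_wrt_frameI)
    show "smooth_fun_on (charts A) U (\<lambda>p. f p * c i p)" if "i < length es" for i
      by (rule smooth_fun_on_mult[OF manifold frame_basis(1)[OF f] F_smooth_on[OF h] c(1)[OF that]])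
    show "smult f X p = (\<Sum>i<length es. (f p * c i p) *\<^sub>R (es ! i) p)" if "p \<in> U" for p
      using c(2) that by (simp add: smult_def scaleR_right.sum)
  qed
qed

lemma smult_minus_one: "smult (\<lambda>_. - 1) X = - X"
  by (auto simp: smult_def)

lemma smult_zero [simp]: "smult 0 X = 0"
  by (auto simp: smult_def)

lemma section_zero [simp]: "0 \<in> \<Gamma>"
proof (rule sectionI)
  show "0 p \<in> fibre A p" for p
    using subspace_0[OF fibre_subspace] by simp
  show "smooth_wrt_frame (charts A) es U 0" for U and es :: "('m \<Rightarrow> 'v) list"
    by (rule smooth_wrt_frameI[where c = "\<lambda>_ _. 0"]) auto
qed

lemma section_uminus [simp]: "X \<in> \<Gamma> \<Longrightarrow> - X \<in> \<Gamma>"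
  using section_smult[of "\<lambda>_. - 1" X] by (simp add: smult_minus_one)

lemma section_diff [simp]: "X \<in> \<Gamma> \<Longrightarrow> Y \<in> \<Gamma> \<Longrightarrow> X - Y \<in> \<Gamma>"
  using section_add[of X "- Y"] by simp

lemma section_sum: "(\<And>i. i \<in> I \<Longrightarrow> X i \<in> \<Gamma>) \<Longrightarrow> (\<Sum>i\<in>I. X i) \<in> \<Gamma>"
  by (induction I rule: infinite_finite_induct) auto

text \<open>
  The coefficients in a frame are determined by the section, so local coefficient functions glue.
\<close>

lemma section_localI:
  assumes loc: "\<And>p. \<exists>W Y. open W \<and> p \<in> W \<and> Y \<in> \<Gamma> \<and> (\<forall>q\<in>W. X q = Y q)"
  shows "X \<in> \<Gamma>"
proof (rule sectionI)
  show "X p \<in> fibre A p" for p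
  proof -
    obtain W Y where "p \<in> W" "Y \<in> \<Gamma>" "\<forall>q\<in>W. X q = Y q" using loc by blast
    then show ?thesis using section_fibre[of Y p] by simp
  qed
  fix U es assume f: "(U, es) \<in> frames A"
  let ?n = "length es"
  have "\<exists>W c. open W \<and> p \<in> W \<and> (\<forall>i<?n. smooth_fun_on (charts A) U (c i)) \<and>
      (\<forall>q\<in>U \<inter> W. X q = (\<Sum>i<?n. c i q *\<^sub>R (es ! i) q))" for p
  proof -
    obtain W Y where W: "open W" "p \<in> W" "Y \<in> \<Gamma>" "\<forall>q\<in>W. X q = Y q" using loc by blast
    obtain c where "\<forall>i<?n. smooth_fun_on (charts A) U (c i)"
      "\<forall>p\<in>U. Y p = (\<Sum>i<?n. c i p *\<^sub>R (es ! i) p)"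
      using section_smooth[OF W(3) f] unfolding smooth_wrt_frame_def by blast
    with W show ?thesis by (intro exI[of _ W] exI[of _ c]) auto
  qed
  then have "\<forall>p. \<exists>W c. open W \<and> p \<in> W \<and> (\<forall>i<?n. smooth_fun_on (charts A) U (c i)) \<and>
      (\<forall>q\<in>U \<inter> W. X q = (\<Sum>i<?n. c i q *\<^sub>R (es ! i) q))" ..
  then obtain W c where Wc: "\<forall>p. open (W p) \<and> p \<in> W p \<and>
      (\<forall>i<?n. smooth_fun_on (charts A) U (c p i)) \<and>
      (\<forall>q\<in>U \<inter> W p. X q = (\<Sum>i<?n. c p i q *\<^sub>R (es ! i) q))"
    unfolding choice_iff by (elim exE)
  then have W: "\<And>p. open (W p)" "\<And>p. p \<in> W p"
    and c: "\<And>p i. i < ?n \<Longrightarrow> smooth_fun_on (charts A) U (c p i)"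
    and X: "\<And>p q. q \<in> U \<Longrightarrow> q \<in> W p \<Longrightarrow> X q = (\<Sum>i<?n. c p i q *\<^sub>R (es ! i) q)"
    by blast+
  show "smooth_wrt_frame (charts A) es U X"
  proof (rule smooth_wrt_frameI[where c = "\<lambda>i q. c q i q"])
    show "X p = (\<Sum>i<?n. c p i p *\<^sub>R (es ! i) p)" if "p \<in> U" for p
      using X[OF that W(2)] .
    fix i assume i: "i < ?n"
    show "smooth_fun_on (charts A) U (\<lambda>q. c q i q)"
    proof (rule smooth_fun_on_localI[OF manifold])
      fix p assume p: "p \<in> U"
      have "c q i q = c p i q" if "q \<in> U \<inter> W p" for q
        by (rule frame_coefficients_unique[OF frame_basis(2,3)[OF f]])
          (use that i X[of q q] X[of q p] W(2) in auto)
      moreover have "smooth_fun_on (charts A) (U \<inter> W p) (c p i)"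
        by (rule smooth_fun_on_subset[OF c[OF i]]) simp
      ultimately show "\<exists>V g. open V \<and> p \<in> V \<and> smooth_fun_on (charts A) V g \<and>
          (\<forall>q\<in>V. c q i q = g q)"
        using p W frame_basis(1)[OF f]
        by (intro exI[of _ "U \<inter> W p"] exI[of _ "c p i"]) auto
    qed
  qed
qed

lemma bump:
  assumes "open U" "p \<in> U"
  obtains h W K where "h \<in> F" "open W" "p \<in> W" "closed K" "K \<subseteq> U"
    "\<And>q. q \<in> W \<Longrightarrow> h q = 1" "\<And>q. q \<notin> K \<Longrightarrow> h q = 0"
  using bump_function_exists[OF manifold assms] in_F by metis

section \<open>Covectors and bivectors\<close>

lemma form_outside:
  assumes "\<eta> \<in> forms A k" "\<not> (length Xs = k \<and> set Xs \<subseteq> \<Gamma>)" shows "\<eta> Xs = 0"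
  using assms unfolding forms_def by blast

lemma form_smooth:
  assumes "\<eta> \<in> forms A k" shows "\<eta> Xs \<in> F"
proof (cases "length Xs = k \<and> set Xs \<subseteq> \<Gamma>")
  case True
  then show ?thesis using assms unfolding forms_def by blast
next
  case False
  then show ?thesis using form_outside[OF assms] by simp
qed

lemma form_slot:
  assumes "\<eta> \<in> forms A k" "length Xs = k" "set Xs \<subseteq> \<Gamma>" "i < k"
  shows "X \<in> \<Gamma> \<Longrightarrow> Y \<in> \<Gamma> \<Longrightarrow> \<eta> (Xs[i := X + Y]) = \<eta> (Xs[i := X]) + \<eta> (Xs[i := Y])"
    and "X \<in> \<Gamma> \<Longrightarrow> f \<in> F \<Longrightarrow> \<eta> (Xs[i := smult f X]) = f * \<eta> (Xs[i := X])"
proof -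
  have "\<forall>Xs. length Xs = k \<and> set Xs \<subseteq> \<Gamma> \<longrightarrow>
        (\<forall>i<k. \<forall>X\<in>\<Gamma>. \<forall>Y\<in>\<Gamma>. \<eta> (Xs[i := X + Y]) = \<eta> (Xs[i := X]) + \<eta> (Xs[i := Y])) \<and>
        (\<forall>i<k. \<forall>X\<in>\<Gamma>. \<forall>f\<in>F. \<eta> (Xs[i := smult f X]) = f * \<eta> (Xs[i := X]))"
    using assms(1) unfolding forms_def by blast
  then show "X \<in> \<Gamma> \<Longrightarrow> Y \<in> \<Gamma> \<Longrightarrow> \<eta> (Xs[i := X + Y]) = \<eta> (Xs[i := X]) + \<eta> (Xs[i := Y])"
    and "X \<in> \<Gamma> \<Longrightarrow> f \<in> F \<Longrightarrow> \<eta> (Xs[i := smult f X]) = f * \<eta> (Xs[i := X])"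
    using assms by blast+
qed

lemma form_alternating:
  assumes "\<eta> \<in> forms A k" "\<not> distinct Xs" shows "\<eta> Xs = 0"
  using assms unfolding forms_def by blast

lemma covector_add:
  "\<alpha> \<in> covectors A \<Longrightarrow> X \<in> \<Gamma> \<Longrightarrow> Y \<in> \<Gamma> \<Longrightarrow> \<alpha> [X + Y] = \<alpha> [X] + \<alpha> [Y]"
  using form_slot(1)[of \<alpha> 1 "[X]" 0 X Y] by simp

lemma covector_smult:
  "\<alpha> \<in> covectors A \<Longrightarrow> X \<in> \<Gamma> \<Longrightarrow> f \<in> F \<Longrightarrow> \<alpha> [smult f X] = f * \<alpha> [X]"
  using form_slot(2)[of \<alpha> 1 "[X]" 0 X f] by simp

lemma covectorI:
  assumes "\<And>Xs. \<not> (\<exists>X\<in>\<Gamma>. Xs = [X]) \<Longrightarrow> \<alpha> Xs = 0"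
    and "\<And>X. X \<in> \<Gamma> \<Longrightarrow> \<alpha> [X] \<in> F"
    and "\<And>X Y. X \<in> \<Gamma> \<Longrightarrow> Y \<in> \<Gamma> \<Longrightarrow> \<alpha> [X + Y] = \<alpha> [X] + \<alpha> [Y]"
    and "\<And>X f. X \<in> \<Gamma> \<Longrightarrow> f \<in> F \<Longrightarrow> \<alpha> [smult f X] = f * \<alpha> [X]"
  shows "\<alpha> \<in> covectors A"
  using assms(2-) by (auto simp: forms_def One_nat_def length_Suc_conv intro!: assms(1))

lemma covector_zero: "\<alpha> \<in> covectors A \<Longrightarrow> \<alpha> [0] = 0"
  using covector_smult[of \<alpha> 0 0] by simp

lemma covector_uminus: "\<alpha> \<in> covectors A \<Longrightarrow> X \<in> \<Gamma> \<Longrightarrow> \<alpha> [- X] = - \<alpha> [X]"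
  using covector_smult[of \<alpha> X "\<lambda>_. - 1"] by (auto simp: smult_minus_one)

lemma covector_diff:
  "\<alpha> \<in> covectors A \<Longrightarrow> X \<in> \<Gamma> \<Longrightarrow> Y \<in> \<Gamma> \<Longrightarrow> \<alpha> [X - Y] = \<alpha> [X] - \<alpha> [Y]"
  using covector_add[of \<alpha> X "- Y"] by (simp add: covector_uminus[of \<alpha>])

lemmas covector_linear = covector_add covector_smult covector_zero covector_uminus covector_diff

lemma covector_sum:
  assumes "\<alpha> \<in> covectors A" "finite I" "\<And>i. i \<in> I \<Longrightarrow> X i \<in> \<Gamma>"
  shows "\<alpha> [\<Sum>i\<in>I. X i] = (\<Sum>i\<in>I. \<alpha> [X i])"
  using assms(2,3)
  by (induction I rule: finite_induct)
    (simp_all add: section_sum covector_linear[OF assms(1)])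

lemma covector_combination:
  assumes "\<alpha> \<in> covectors A" "finite I" "\<And>i. i \<in> I \<Longrightarrow> X i \<in> \<Gamma>" "\<And>i. i \<in> I \<Longrightarrow> f i \<in> F"
  shows "\<alpha> [\<Sum>i\<in>I. smult (f i) (X i)] = (\<Sum>i\<in>I. f i * \<alpha> [X i])"
proof -
  have "\<alpha> [\<Sum>i\<in>I. smult (f i) (X i)] = (\<Sum>i\<in>I. \<alpha> [smult (f i) (X i)])"
    by (rule covector_sum[OF assms(1,2)]) (simp add: assms(3,4))
  also have "\<dots> = (\<Sum>i\<in>I. f i * \<alpha> [X i])"
    by (rule sum.cong[OF refl], rule covector_smult[OF assms(1,3,4)])
  finally show ?thesis .
qed

lemma covector_smooth [simp]: "\<alpha> \<in> covectors A \<Longrightarrow> \<alpha> [X] \<in> F"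
  by (rule form_smooth)

lemma covector_eqI:
  assumes "\<alpha> \<in> covectors A" "\<beta> \<in> covectors A" "\<And>X. X \<in> \<Gamma> \<Longrightarrow> \<alpha> [X] = \<beta> [X]"
  shows "\<alpha> = \<beta>"
proof
  fix Xs show "\<alpha> Xs = \<beta> Xs"
  proof (cases "\<exists>X\<in>\<Gamma>. Xs = [X]")
    case False
    then have "\<not> (length Xs = 1 \<and> set Xs \<subseteq> \<Gamma>)" by (auto simp: One_nat_def length_Suc_conv)
    then show ?thesis using form_outside assms by metis
  qed (use assms in auto)
qed

text \<open>
  Global objects that take the place of a frame and its dual near a point. The relation that carries
  all later arguments is the expansion of sections, which is exact where \<open>h = 1\<close>.
\<close>

definition dual_frame_on :: "'m set \<Rightarrow> ('m \<Rightarrow> real) \<Rightarrow> nat \<Rightarrow> (nat \<Rightarrow> 'm \<Rightarrow> 'v) \<Rightarrow>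
    (nat \<Rightarrow> ('m, 'v) form) \<Rightarrow> bool" where
  "dual_frame_on W h n E \<epsilon> \<longleftrightarrow> open W \<and> h \<in> F \<and> (\<forall>q\<in>W. h q = 1) \<and> (\<forall>i<n. E i \<in> \<Gamma>) \<and>
     (\<forall>i<n. \<epsilon> i \<in> covectors A) \<and> (\<forall>X\<in>\<Gamma>. smult h X = (\<Sum>i<n. smult (\<epsilon> i [X]) (E i)))"

lemma dual_frame_onD:
  assumes "dual_frame_on W h n E \<epsilon>"
  shows "open W" "h \<in> F" "q \<in> W \<Longrightarrow> h q = 1" "i < n \<Longrightarrow> E i \<in> \<Gamma>" "i < n \<Longrightarrow> \<epsilon> i \<in> covectors A"
    "X \<in> \<Gamma> \<Longrightarrow> smult h X = (\<Sum>i<n. smult (\<epsilon> i [X]) (E i))"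
  using assms unfolding dual_frame_on_def by blast+

text \<open>
  A frame and its dual, cut off by the square of a bump function (one factor for the sections, one
  for the covectors), become global sections and covectors that still expand every section near the
  given point. This is what turns global tensors into local coordinates and back.
\<close>

lemma local_dual_frame:
  obtains W h n E \<epsilon> where "p \<in> W" "dual_frame_on W h n E \<epsilon>"
proof -
  obtain U es where f: "(U, es) \<in> frames A" "p \<in> U" using frame_exists by blast
  note U = frame_basis(1)[OF f(1)]
  obtain h W K where h: "h \<in> F" "open W" "p \<in> W" "closed K" "K \<subseteq> U"
    "\<And>q. q \<in> W \<Longrightarrow> h q = 1" "\<And>q. q \<notin> K \<Longrightarrow> h q = 0"
    using bump[OF U f(2)] by blast
  let ?n = "length es"
  have h0: "h q = 0" if "q \<notin> U" for q using h(5,7) that by blast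
  define E where "E i = smult h (es ! i)" for i
  have E: "E i \<in> \<Gamma>" if i: "i < ?n" for i
  proof (rule sectionI)
    show "E i q \<in> fibre A q" for q
    proof (cases "q \<in> U")
      case True
      have "(es ! i) q \<in> span ((\<lambda>e. e q) ` set es)"
        using i by (intro span_base) auto
      then show ?thesis
        using frame_basis(4)[OF f(1) True] subspace_scale[OF fibre_subspace]
        by (simp add: E_def smult_def)
    next
      case False
      then show ?thesis using subspace_0[OF fibre_subspace] by (simp add: E_def smult_def h0)
    qed
    fix V fs assume V: "(V, fs) \<in> frames A"
    obtain t where "\<forall>j<length fs. smooth_fun_on (charts A) (V \<inter> U) (t j)"
      "\<forall>q\<in> V \<inter> U. (es ! i) q = (\<Sum>j<length fs. t j q *\<^sub>R (fs ! j) q)"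
      using frame_transition[OF V f(1) nth_mem[OF i]] unfolding smooth_wrt_frame_def by blast
    note t = this[rule_format]
    show "smooth_wrt_frame (charts A) fs V (E i)"
    proof (rule smooth_wrt_frameI)
      show "smooth_fun_on (charts A) V (\<lambda>q. if q \<in> U then h q * t j q else 0)"
        if "j < length fs" for j
        by (rule smooth_fun_on_extend_by_zero[OF manifold U frame_basis(1)[OF V] h(4,5)
              F_smooth_on[OF h(1)] h(7) t(1)[OF that, unfolded Int_commute[of V U]]])
      show "E i q = (\<Sum>j<length fs. (if q \<in> U then h q * t j q else 0) *\<^sub>R (fs ! j) q)"
        if "q \<in> V" for q
        using that t(2)[of q] h0[of q]
        by (cases "q \<in> U") (simp_all add: E_def smult_def scaleR_right.sum)
    qed
  qed
  have "\<exists>c. (\<forall>i<?n. smooth_fun_on (charts A) U (c i)) \<and>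
      (\<forall>q\<in>U. X q = (\<Sum>i<?n. c i q *\<^sub>R (es ! i) q))" if "X \<in> \<Gamma>" for X
    using section_smooth[OF that f(1)] unfolding smooth_wrt_frame_def by blast
  then have "\<forall>X\<in>\<Gamma>. \<exists>c. (\<forall>i<?n. smooth_fun_on (charts A) U (c i)) \<and>
      (\<forall>q\<in>U. X q = (\<Sum>i<?n. c i q *\<^sub>R (es ! i) q))" ..
  then obtain c where "\<forall>X\<in>\<Gamma>. (\<forall>i<?n. smooth_fun_on (charts A) U (c X i)) \<and>
      (\<forall>q\<in>U. X q = (\<Sum>i<?n. c X i q *\<^sub>R (es ! i) q))"
    unfolding bchoice_iff by (elim exE)
  then have c: "\<And>X i. X \<in> \<Gamma> \<Longrightarrow> i < ?n \<Longrightarrow> smooth_fun_on (charts A) U (c X i)"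
    and cX: "\<And>X q. X \<in> \<Gamma> \<Longrightarrow> q \<in> U \<Longrightarrow> X q = (\<Sum>i<?n. c X i q *\<^sub>R (es ! i) q)"
    by blast+
  have c_eqI: "c X i q = b i"
    if "X \<in> \<Gamma>" "q \<in> U" "i < ?n" "X q = (\<Sum>i<?n. b i *\<^sub>R (es ! i) q)" for X i q b
    by (rule frame_coefficients_unique[OF frame_basis(2,3)[OF f(1) that(2)] _ that(3)])
      (use cX[OF that(1,2)] that(4) in simp)
  define \<epsilon> where "\<epsilon> i = (\<lambda>Xs. if \<exists>X\<in>\<Gamma>. Xs = [X]
      then (\<lambda>q. if q \<in> U then h q * c (hd Xs) i q else 0) else 0)" for i
  have \<epsilon>1: "\<epsilon> i [X] = (\<lambda>q. if q \<in> U then h q * c X i q else 0)" if "X \<in> \<Gamma>" for i X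
    using that by (auto simp: \<epsilon>_def)
  have \<epsilon>: "\<epsilon> i \<in> covectors A" if i: "i < ?n" for i
  proof (rule covectorI)
    show "\<epsilon> i Xs = 0" if "\<not> (\<exists>X\<in>\<Gamma>. Xs = [X])" for Xs
      using that by (simp add: \<epsilon>_def)
    show "\<epsilon> i [X] \<in> F" if X: "X \<in> \<Gamma>" for X
      unfolding \<epsilon>1[OF X] in_F
      by (rule smooth_fun_on_extend_by_zero[OF manifold U open_UNIV h(4,5) F_smooth_on[OF h(1)] h(7)])
        (use c[OF X i] in simp_all)
    show "\<epsilon> i [X + Y] = \<epsilon> i [X] + \<epsilon> i [Y]" if X: "X \<in> \<Gamma>" and Y: "Y \<in> \<Gamma>" for X Y
    proof -
      have "c (X + Y) i q = c X i q + c Y i q" if q: "q \<in> U" for q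
        by (rule c_eqI[OF section_add[OF X Y] q i])
          (use cX[OF X q] cX[OF Y q] in \<open>simp add: scaleR_left_distrib sum.distrib\<close>)
      then show ?thesis
        using X Y by (auto simp: \<epsilon>1 algebra_simps)
    qed
    show "\<epsilon> i [smult g X] = g * \<epsilon> i [X]" if X: "X \<in> \<Gamma>" and g: "g \<in> F" for X g
    proof -
      have "c (smult g X) i q = g q * c X i q" if q: "q \<in> U" for q
        by (rule c_eqI[OF section_smult[OF g X] q i])
          (use cX[OF X q] in \<open>simp add: smult_def scaleR_right.sum\<close>)
      then show ?thesis
        using X g by (auto simp: \<epsilon>1)
    qed
  qed
  have exp: "smult (h * h) X = (\<Sum>i<?n. smult (\<epsilon> i [X]) (E i))" if X: "X \<in> \<Gamma>" for X
  proof
    fix q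
    show "smult (h * h) X q = (\<Sum>i<?n. smult (\<epsilon> i [X]) (E i)) q"
    proof (cases "q \<in> U")
      case True
      then show ?thesis
        using cX[OF X True] X
        by (simp add: sum_fun_apply smult_def \<epsilon>1 E_def scaleR_right.sum mult_ac)
    next
      case False
      then show ?thesis by (simp add: sum_fun_apply smult_def E_def h0)
    qed
  qed
  show thesis
    by (rule that[of W "h * h" ?n E \<epsilon>]) (use h E \<epsilon> exp in \<open>auto simp: dual_frame_on_def\<close>)
qed

text \<open>
  The covectors of a local dual frame already determine the value of a section at the point.
\<close>

lemma covectors_separate_sections:
  assumes X: "X \<in> \<Gamma>" and Y: "Y \<in> \<Gamma>" and eq: "\<And>\<beta>. \<beta> \<in> covectors A \<Longrightarrow> \<beta> [X] p = \<beta> [Y] p"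
  shows "X p = Y p"
proof -
  obtain W h n E \<epsilon> where W: "p \<in> W" and f: "dual_frame_on W h n E \<epsilon>"
    using local_dual_frame by blast
  note h = dual_frame_onD[OF f]
  have "smult h X p = smult h Y p"
    unfolding h(6)[OF X] h(6)[OF Y] sum_fun_apply
    by (rule sum.cong) (simp_all add: smult_def eq[OF h(5)])
  then show ?thesis using h(3)[OF W] by (simp add: smult_def)
qed

lemma covector_local:
  assumes "\<beta> \<in> covectors A" "X \<in> \<Gamma>" "Y \<in> \<Gamma>" "open W" "p \<in> W" "\<And>q. q \<in> W \<Longrightarrow> X q = Y q"
  shows "\<beta> [X] p = \<beta> [Y] p"
proof -
  obtain h V K where h: "h \<in> F" "p \<in> V" "K \<subseteq> W"
    "\<And>q. q \<in> V \<Longrightarrow> h q = 1" "\<And>q. q \<notin> K \<Longrightarrow> h q = 0"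
    using bump[OF assms(4,5)] by metis
  have "smult h X = smult h Y"
    using h(3,5) assms(6) by (fastforce simp: smult_def)
  then have "h * \<beta> [X] = h * \<beta> [Y]"
    using covector_smult[OF assms(1,2) h(1)] covector_smult[OF assms(1,3) h(1)] by simp
  then have "(h * \<beta> [X]) p = (h * \<beta> [Y]) p" by simp
  then show ?thesis using h(2,4) by simp
qed

lemma covector_outside: "\<alpha> \<in> covectors A \<Longrightarrow> \<not> (\<exists>X\<in>\<Gamma>. Xs = [X]) \<Longrightarrow> \<alpha> Xs = 0"
  by (rule form_outside[of \<alpha> 1]) (auto simp: One_nat_def length_Suc_conv)

lemma smult_form_covector [simp]:
  assumes "\<alpha> \<in> covectors A" "f \<in> F" shows "smult_form f \<alpha> \<in> covectors A"
  by (rule covectorI)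
    (simp_all add: smult_form_def covector_outside[OF assms(1)] covector_linear[OF assms(1)]
      covector_smooth[OF assms(1)] assms(2) algebra_simps)

lemma form_add_covector [simp]:
  assumes "\<alpha> \<in> covectors A" "\<beta> \<in> covectors A" shows "\<alpha> + \<beta> \<in> covectors A"
  by (rule covectorI)
    (simp_all add: covector_outside[OF assms(1)] covector_outside[OF assms(2)]
      covector_linear[OF assms(1)] covector_linear[OF assms(2)]
      covector_smooth[OF assms(1)] covector_smooth[OF assms(2)] algebra_simps)

lemma covector_0 [simp]: "0 \<in> covectors A"
  by (rule covectorI) auto

lemma form_uminus_covector [simp]: "\<alpha> \<in> covectors A \<Longrightarrow> - \<alpha> \<in> covectors A"
  using smult_form_covector[of \<alpha> "\<lambda>_. - 1"] by (simp add: smult_form_def fun_Compl_def times_fun_def)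

lemma form_diff_covector [simp]: "\<alpha> \<in> covectors A \<Longrightarrow> \<beta> \<in> covectors A \<Longrightarrow> \<alpha> - \<beta> \<in> covectors A"
  using form_add_covector[of \<alpha> "- \<beta>"] by simp

lemma bivectorD:
  assumes "P \<in> bivectors A" "\<alpha> \<in> covectors A" "\<beta> \<in> covectors A"
  shows "P \<alpha> \<beta> \<in> F" "P \<alpha> \<alpha> = 0"
    and "\<gamma> \<in> covectors A \<Longrightarrow> P (\<alpha> + \<beta>) \<gamma> = P \<alpha> \<gamma> + P \<beta> \<gamma>"
    and "\<gamma> \<in> covectors A \<Longrightarrow> P \<gamma> (\<alpha> + \<beta>) = P \<gamma> \<alpha> + P \<gamma> \<beta>"
    and "f \<in> F \<Longrightarrow> P (smult_form f \<alpha>) \<beta> = f * P \<alpha> \<beta>"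
    and "f \<in> F \<Longrightarrow> P \<alpha> (smult_form f \<beta>) = f * P \<alpha> \<beta>"
  using assms unfolding bivectors_def by blast+

lemma bivector_skew:
  assumes "P \<in> bivectors A" "\<alpha> \<in> covectors A" "\<beta> \<in> covectors A"
  shows "P \<alpha> \<beta> = - P \<beta> \<alpha>"
proof -
  have "0 = P (\<alpha> + \<beta>) (\<alpha> + \<beta>)" using assms by (simp add: bivectorD[OF assms(1)])
  also have "\<dots> = P \<alpha> \<alpha> + P \<alpha> \<beta> + (P \<beta> \<alpha> + P \<beta> \<beta>)"
    using assms by (simp only: bivectorD(3,4)[OF assms(1)] form_add_covector add_ac)
  also have "\<dots> = P \<alpha> \<beta> + P \<beta> \<alpha>"
    using assms by (simp add: bivectorD(2)[OF assms(1)])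
  finally show ?thesis by (metis add_eq_0_iff2)
qed

lemma bivector_sum:
  assumes "P \<in> bivectors A" "\<alpha> \<in> covectors A"
  shows "finite I \<Longrightarrow> (\<And>i. i \<in> I \<Longrightarrow> \<beta> i \<in> covectors A) \<Longrightarrow>
    P \<alpha> (\<Sum>i\<in>I. \<beta> i) = (\<Sum>i\<in>I. P \<alpha> (\<beta> i)) \<and> (\<Sum>i\<in>I. \<beta> i) \<in> covectors A"
proof (induction I rule: finite_induct)
  case empty
  have "P \<alpha> (smult_form 0 0) = 0 * P \<alpha> 0"
    by (rule bivectorD(6)[OF assms covector_0 F_zero])
  moreover have "smult_form 0 0 = (0 :: ('m, 'v) form)"
    by (auto simp: smult_form_def)
  ultimately have "P \<alpha> 0 = 0" by simp
  then show ?case unfolding sum.empty using covector_0 by blast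
next
  case (insert i I)
  then have "\<beta> i \<in> covectors A" "sum \<beta> I \<in> covectors A" "P \<alpha> (sum \<beta> I) = (\<Sum>i\<in>I. P \<alpha> (\<beta> i))"
    by blast+
  then show ?case
    using assms form_add_covector
    by (simp only: sum.insert[OF insert.hyps] bivectorD(4)[OF assms(1)])
qed

text \<open>
  A covector \<open>\<alpha>\<close>, multiplied by the cut-off function of a local dual frame, expands as
  \<open>\<Sum>\<^sub>i \<alpha>(E\<^sub>i) \<epsilon>\<^sub>i\<close>; a bivector is therefore determined near a point by its values on the \<open>\<epsilon>\<^sub>i\<close>.
\<close>

lemma bivector_expansion:
  assumes P: "P \<in> bivectors A" and \<alpha>: "\<alpha> \<in> covectors A" and \<beta>: "\<beta> \<in> covectors A"
    and f: "dual_frame_on W h n E \<epsilon>"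
  shows "h * P \<alpha> \<beta> = (\<Sum>i<n. \<beta> [E i] * P \<alpha> (\<epsilon> i))"
proof -
  note h = dual_frame_onD(2,4,5,6)[OF f]
  let ?s = "\<Sum>i<n. smult_form (\<beta> [E i]) (\<epsilon> i)"
  have s: "P \<alpha> ?s = (\<Sum>i<n. P \<alpha> (smult_form (\<beta> [E i]) (\<epsilon> i))) \<and> ?s \<in> covectors A"
    by (rule bivector_sum[OF P \<alpha>]) (use h \<beta> in auto)
  have "smult_form h \<beta> = ?s"
  proof (rule covector_eqI)
    show "smult_form h \<beta> [X] = ?s [X]" if X: "X \<in> \<Gamma>" for X
    proof -
      have "smult_form h \<beta> [X] = \<beta> [smult h X]"
        using X h(1) covector_smult[OF \<beta>] by (simp add: smult_form_def)
      also have "\<dots> = (\<Sum>i<n. \<epsilon> i [X] * \<beta> [E i])"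
        unfolding h(4)[OF X]
        by (rule covector_combination[OF \<beta>]) (auto intro: h(2) covector_smooth[OF h(3)])
      finally show ?thesis
        by (simp add: sum_fun_apply smult_form_def mult.commute)
    qed
  qed (use s \<beta> h(1) in auto)
  then have "h * P \<alpha> \<beta> = P \<alpha> ?s"
    using bivectorD(6)[OF P \<alpha> \<beta> h(1)] by simp
  also have "\<dots> = (\<Sum>i<n. P \<alpha> (smult_form (\<beta> [E i]) (\<epsilon> i)))"
    using s by simp
  also have "\<dots> = (\<Sum>i<n. \<beta> [E i] * P \<alpha> (\<epsilon> i))"
    by (rule sum.cong[OF refl], rule bivectorD(6)[OF P \<alpha> h(3)])
      (simp_all add: covector_smooth[OF \<beta>])
  finally show ?thesis .
qed

text \<open>
  That \<open>\<pi>\<^sup>\<sharp>\<alpha>\<close> exists is the reflexivity of the module of sections. It is built from local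
  dual frames; the local pieces agree on overlaps because covectors separate sections.
\<close>

lemma sharp_exists:
  assumes P: "P \<in> bivectors A" and \<alpha>: "\<alpha> \<in> covectors A"
  shows "\<exists>X\<in>\<Gamma>. \<forall>\<beta>\<in>covectors A. \<beta> [X] = P \<alpha> \<beta>"
proof -
  have "\<exists>W Y. open W \<and> p \<in> W \<and> Y \<in> \<Gamma> \<and> (\<forall>q\<in>W. \<forall>\<beta>\<in>covectors A. \<beta> [Y] q = P \<alpha> \<beta> q)" for p
  proof -
    obtain W h n E \<epsilon> where W: "p \<in> W" and f: "dual_frame_on W h n E \<epsilon>"
      using local_dual_frame by blast
    note h = dual_frame_onD[OF f]
    let ?Y = "\<Sum>i<n. smult (P \<alpha> (\<epsilon> i)) (E i)"
    have Y: "?Y \<in> \<Gamma>" using h(4,5) \<alpha> P by (intro section_sum) (auto simp: bivectorD[OF P])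
    have "\<beta> [?Y] q = P \<alpha> \<beta> q" if q: "q \<in> W" and \<beta>: "\<beta> \<in> covectors A" for q \<beta>
    proof -
      have "\<beta> [?Y] = (\<Sum>i<n. P \<alpha> (\<epsilon> i) * \<beta> [E i])"
        by (rule covector_combination[OF \<beta>]) (auto intro: h(4) bivectorD(1)[OF P \<alpha> h(5)])
      also have "\<dots> = h * P \<alpha> \<beta>"
        using bivector_expansion[OF P \<alpha> \<beta> f] by (simp add: mult.commute)
      finally show ?thesis using h(3)[OF q] by simp
    qed
    with h(1) W Y show ?thesis by blast
  qed
  then have "\<forall>p. \<exists>W Y. open W \<and> p \<in> W \<and> Y \<in> \<Gamma> \<and> (\<forall>q\<in>W. \<forall>\<beta>\<in>covectors A. \<beta> [Y] q = P \<alpha> \<beta> q)" ..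
  then obtain W Y where "\<forall>p. open (W p) \<and> p \<in> W p \<and> Y p \<in> \<Gamma> \<and>
      (\<forall>q\<in>W p. \<forall>\<beta>\<in>covectors A. \<beta> [Y p] q = P \<alpha> \<beta> q)"
    unfolding choice_iff by (elim exE)
  then have W: "\<And>p. open (W p)" "\<And>p. p \<in> W p" and Y: "\<And>p. Y p \<in> \<Gamma>"
    and PY: "\<And>p q \<beta>. q \<in> W p \<Longrightarrow> \<beta> \<in> covectors A \<Longrightarrow> \<beta> [Y p] q = P \<alpha> \<beta> q"
    by blast+
  define X where "X = (\<lambda>p. Y p p)"
  have loc: "X q = Y p q" if "q \<in> W p" for p q
    unfolding X_def by (rule covectors_separate_sections[OF Y Y]) (simp add: PY that W)
  have X: "X \<in> \<Gamma>"
  proof (rule section_localI)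
    fix p
    show "\<exists>V Z. open V \<and> p \<in> V \<and> Z \<in> \<Gamma> \<and> (\<forall>q\<in>V. X q = Z q)"
      by (intro exI[of _ "W p"] exI[of _ "Y p"] conjI ballI W Y loc)
  qed
  moreover have "\<beta> [X] = P \<alpha> \<beta>" if \<beta>: "\<beta> \<in> covectors A" for \<beta>
  proof
    fix p
    have "\<beta> [X] p = \<beta> [Y p] p"
      by (rule covector_local[OF \<beta> X Y W(1) W(2)]) (rule loc)
    then show "\<beta> [X] p = P \<alpha> \<beta> p" using PY[OF W(2) \<beta>] by simp
  qed
  ultimately show ?thesis by blast
qed

lemma section_eqI:
  assumes "X \<in> \<Gamma>" "Y \<in> \<Gamma>" "\<And>\<beta>. \<beta> \<in> covectors A \<Longrightarrow> \<beta> [X] = \<beta> [Y]"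
  shows "X = Y"
  by (rule ext, rule covectors_separate_sections[OF assms(1,2)]) (simp add: assms(3))

lemma sharp:
  assumes "P \<in> bivectors A" "\<alpha> \<in> covectors A"
  shows sharp_section: "sharp A P \<alpha> \<in> \<Gamma>"
    and covector_sharp: "\<beta> \<in> covectors A \<Longrightarrow> \<beta> [sharp A P \<alpha>] = P \<alpha> \<beta>"
proof -
  have "\<exists>!X. X \<in> \<Gamma> \<and> (\<forall>\<beta>\<in>covectors A. \<beta> [X] = P \<alpha> \<beta>)"
    using sharp_exists[OF assms] section_eqI by (metis (no_types, lifting))
  from theI'[OF this] show "sharp A P \<alpha> \<in> \<Gamma>"
    and "\<beta> \<in> covectors A \<Longrightarrow> \<beta> [sharp A P \<alpha>] = P \<alpha> \<beta>"
    unfolding sharp_def by blast+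
qed

lemma sharp_eqI:
  assumes "P \<in> bivectors A" "\<alpha> \<in> covectors A" "X \<in> \<Gamma>"
    "\<And>\<beta>. \<beta> \<in> covectors A \<Longrightarrow> \<beta> [X] = P \<alpha> \<beta>"
  shows "sharp A P \<alpha> = X"
  by (rule section_eqI) (use assms sharp in auto)

lemma sharp_add:
  assumes "P \<in> bivectors A" "\<alpha> \<in> covectors A" "\<beta> \<in> covectors A"
  shows "sharp A P (\<alpha> + \<beta>) = sharp A P \<alpha> + sharp A P \<beta>"
  by (rule sharp_eqI) (use assms sharp in \<open>auto simp: bivectorD[OF assms(1)] covector_add\<close>)

lemma sharp_0:
  assumes "P \<in> bivectors A" shows "sharp A P 0 = 0"
  using sharp_add[OF assms, of 0 0] by simp

text \<open>
  The decomposition is \<open>\<Sum>\<^sub>i \<onehalf>E\<^sub>i \<and> \<pi>\<^sup>\<sharp>\<epsilon>\<^sub>i\<close>; the factor makes up for each pair of frame indices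
  being counted twice.
\<close>

lemma bivector_decomposes_locally:
  assumes P: "P \<in> bivectors A"
  obtains U X Y n where "open U" "p \<in> U" "\<And>i. i < (n::nat) \<Longrightarrow> X i \<in> \<Gamma>" "\<And>i. i < n \<Longrightarrow> Y i \<in> \<Gamma>"
    "\<And>\<alpha> \<beta> q. \<alpha> \<in> covectors A \<Longrightarrow> \<beta> \<in> covectors A \<Longrightarrow> q \<in> U \<Longrightarrow>
      P \<alpha> \<beta> q = (\<Sum>i<n. wedge2 (X i) (Y i) \<alpha> \<beta> q)"
proof -
  obtain W h n E \<epsilon> where W: "p \<in> W" and f: "dual_frame_on W h n E \<epsilon>"
    using local_dual_frame by blast
  note h = dual_frame_onD[OF f]
  let ?X = "\<lambda>i. smult (\<lambda>_. 1 / 2) (E i)" and ?Y = "\<lambda>i. sharp A P (\<epsilon> i)"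
  show thesis
  proof (rule that[OF h(1) W, where X = ?X and Y = ?Y and n = n])
    show "?X i \<in> \<Gamma>" "?Y i \<in> \<Gamma>" if "i < n" for i
      using h(4,5) that sharp_section[OF P] by auto
    fix \<alpha> \<beta> q assume \<alpha>: "\<alpha> \<in> covectors A" and \<beta>: "\<beta> \<in> covectors A" and q: "q \<in> W"
    have w: "wedge2 (?X i) (?Y i) \<alpha> \<beta> q
        = (\<beta> [E i] * P \<alpha> (\<epsilon> i)) q / 2 - (\<alpha> [E i] * P \<beta> (\<epsilon> i)) q / 2" if "i < n" for i
    proof -
      have "P (\<epsilon> i) \<alpha> = - P \<alpha> (\<epsilon> i)" "P (\<epsilon> i) \<beta> = - P \<beta> (\<epsilon> i)"
        using bivector_skew[OF P] h(5)[OF that] \<alpha> \<beta> by blast+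
      then show ?thesis
        using h(4,5) that \<alpha> \<beta>
        by (simp add: wedge2_def covector_sharp[OF P] covector_smult[OF \<alpha>] covector_smult[OF \<beta>])
    qed
    have "(\<Sum>i<n. wedge2 (?X i) (?Y i) \<alpha> \<beta> q)
        = (\<Sum>i<n. (\<beta> [E i] * P \<alpha> (\<epsilon> i)) q) / 2 - (\<Sum>i<n. (\<alpha> [E i] * P \<beta> (\<epsilon> i)) q) / 2"
      by (simp only: sum_divide_distrib sum_subtractf[symmetric], rule sum.cong, simp, rule w) simp
    also have "\<dots> = (h * P \<alpha> \<beta>) q / 2 - (h * P \<beta> \<alpha>) q / 2"
      unfolding bivector_expansion[OF P \<alpha> \<beta> f] bivector_expansion[OF P \<beta> \<alpha> f]
      by (simp add: sum_fun_apply)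
    also have "\<dots> = P \<alpha> \<beta> q"
      using bivector_skew[OF P \<alpha> \<beta>] h(3)[OF q] by simp
    finally show "P \<alpha> \<beta> q = (\<Sum>i<n. wedge2 (?X i) (?Y i) \<alpha> \<beta> q)" by simp
  qed
qed

section \<open>Cartan calculus on forms of low degree\<close>

abbreviation \<rho> where "\<rho> \<equiv> anchor A"
abbreviation br where "br \<equiv> bracket A"

lemmas axioms = lie_algebroid[unfolded lie_algebroid_def, THEN conjunct2, THEN conjunct2]

lemmas bracket_section [simp] = axioms[THEN conjunct1, rule_format]
lemmas axioms4 = axioms[THEN conjunct2]
lemmas bracket_add_left = axioms4[THEN conjunct1, rule_format, THEN conjunct1]
lemmas bracket_add_right = axioms4[THEN conjunct1, rule_format, THEN conjunct2]
lemmas axioms5 = axioms4[THEN conjunct2]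
lemmas bracket_const_left = axioms5[THEN conjunct1, rule_format, THEN conjunct1]
lemmas bracket_const_right = axioms5[THEN conjunct1, rule_format, THEN conjunct2]
lemmas axioms6 = axioms5[THEN conjunct2]
lemmas bracket_self = axioms6[THEN conjunct1, rule_format]
lemmas axioms7 = axioms6[THEN conjunct2]
lemmas jacobi = axioms7[THEN conjunct1, rule_format]
lemmas axioms8 = axioms7[THEN conjunct2]
lemmas anchor_smooth [simp] = axioms8[THEN conjunct1, rule_format]
lemmas axioms9 = axioms8[THEN conjunct2]
lemmas anchor_fun_add = axioms9[THEN conjunct1, rule_format, THEN conjunct1]
lemmas anchor_fun_mult = axioms9[THEN conjunct1, rule_format, THEN conjunct2]
lemmas axioms10 = axioms9[THEN conjunct2]
lemmas anchor_fun_const = axioms10[THEN conjunct1, rule_format]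
lemmas axioms11 = axioms10[THEN conjunct2]
lemmas anchor_add = axioms11[THEN conjunct1, rule_format]
lemmas axioms12 = axioms11[THEN conjunct2]
lemmas anchor_smult = axioms12[THEN conjunct1, rule_format]
lemmas axioms13 = axioms12[THEN conjunct2]
lemmas anchor_bracket = axioms13[THEN conjunct1, rule_format]
lemmas leibniz = axioms13[THEN conjunct2, rule_format]

lemma anchor_fun_zero [simp]: "X \<in> \<Gamma> \<Longrightarrow> \<rho> X 0 = 0"
proof -
  assume X: "X \<in> \<Gamma>"
  have "\<rho> X ((\<lambda>_. 0) * 0) = (\<lambda>_. 0) * \<rho> X 0"
    by (rule anchor_fun_const[OF X F_zero])
  moreover have "(\<lambda>_. 0) * g = 0" for g :: "'m \<Rightarrow> real" by (rule ext) simp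
  ultimately show ?thesis by metis
qed

lemma anchor_fun_scale: "X \<in> \<Gamma> \<Longrightarrow> f \<in> F \<Longrightarrow> \<rho> X ((\<lambda>_. c) * f) p = c * \<rho> X f p"
  using anchor_fun_const[of X f c] by simp

lemma neg_as_scale: "- f = (\<lambda>_. - 1) * (f :: 'm \<Rightarrow> real)"
  by (rule ext) simp

lemma anchor_fun_uminus: "X \<in> \<Gamma> \<Longrightarrow> f \<in> F \<Longrightarrow> \<rho> X (- f) = - \<rho> X f"
  unfolding neg_as_scale by (rule anchor_fun_const)

lemma anchor_fun_diff: "X \<in> \<Gamma> \<Longrightarrow> f \<in> F \<Longrightarrow> g \<in> F \<Longrightarrow> \<rho> X (f - g) = \<rho> X f - \<rho> X g"
  unfolding diff_conv_add_uminus by (simp only: anchor_fun_add F_uminus anchor_fun_uminus)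

lemma anchor_uminus: "X \<in> \<Gamma> \<Longrightarrow> f \<in> F \<Longrightarrow> \<rho> (- X) f = - \<rho> X f"
  using anchor_smult[of X f "\<lambda>_. - 1"] by (simp only: smult_minus_one neg_as_scale F_const)

lemma anchor_diff: "X \<in> \<Gamma> \<Longrightarrow> Y \<in> \<Gamma> \<Longrightarrow> f \<in> F \<Longrightarrow> \<rho> (X - Y) f = \<rho> X f - \<rho> Y f"
  unfolding diff_conv_add_uminus by (simp only: anchor_add section_uminus anchor_uminus)

lemma bracket_skew: "X \<in> \<Gamma> \<Longrightarrow> Y \<in> \<Gamma> \<Longrightarrow> br X Y = - br Y X"
proof -
  assume X: "X \<in> \<Gamma>" and Y: "Y \<in> \<Gamma>"
  have "0 = br (X + Y) (X + Y)"
    using bracket_self[OF section_add[OF X Y]] by simp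
  also have "\<dots> = br X X + br X Y + (br Y X + br Y Y)"
    using X Y by (simp only: bracket_add_left bracket_add_right section_add) (simp only: add_ac)
  also have "\<dots> = br X Y + br Y X"
    using X Y by (simp only: bracket_self add_0 add_0_right)
  finally show ?thesis by (metis eq_neg_iff_add_eq_0)
qed

lemma bracket_zero_right: "X \<in> \<Gamma> \<Longrightarrow> br X 0 = 0"
proof -
  assume X: "X \<in> \<Gamma>"
  have z: "smult (\<lambda>_. 0) Y = 0" for Y :: "'m \<Rightarrow> 'v"
    by (rule ext) (simp add: smult_def)
  show ?thesis
    using bracket_const_right[OF X section_zero, of 0] by (simp only: z)
qed

lemma bracket_zero_left: "X \<in> \<Gamma> \<Longrightarrow> br 0 X = 0"
  using bracket_skew[of 0 X] by (simp add: bracket_zero_right)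

lemma bracket_smult_left:
  assumes X: "X \<in> \<Gamma>" and Y: "Y \<in> \<Gamma>" and f: "f \<in> F"
  shows "br (smult f X) Y = smult f (br X Y) - smult (\<rho> Y f) X"
proof -
  have "br (smult f X) Y = - br Y (smult f X)"
    using X Y f by (intro bracket_skew) auto
  also have "\<dots> = - (smult f (br Y X) + smult (\<rho> Y f) X)"
    by (simp only: leibniz[OF Y X f])
  also have "\<dots> = smult f (br X Y) - smult (\<rho> Y f) X"
    unfolding bracket_skew[OF X Y] by (rule ext) (simp add: smult_def)
  finally show ?thesis .
qed

subsection \<open>Forms of degree 2 and 3\<close>

text \<open>
  Forms are functions of lists, so an equality of forms must also be checked on lists of the wrong
  length and on lists with entries that are not sections. The operations of the Cartan
  calculus respect this predicate, which leaves only the evaluation on sections.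
\<close>

definition supported :: "nat \<Rightarrow> ('m, 'v) form \<Rightarrow> bool" where
  "supported k \<eta> \<longleftrightarrow> (\<forall>Xs. \<not> (length Xs = k \<and> set Xs \<subseteq> \<Gamma>) \<longrightarrow> \<eta> Xs = 0)"

lemma supportedD: "supported k \<eta> \<Longrightarrow> \<not> (length Xs = k \<and> set Xs \<subseteq> \<Gamma>) \<Longrightarrow> \<eta> Xs = 0"
  by (simp add: supported_def)

lemma form_supported: "\<eta> \<in> forms A k \<Longrightarrow> supported k \<eta>"
  unfolding supported_def using form_outside by blast

lemma supported_0 [simp]: "supported k 0"
  by (simp add: supported_def)

lemma supported_add [simp]: "supported k \<eta> \<Longrightarrow> supported k \<theta> \<Longrightarrow> supported k (\<eta> + \<theta>)"
  by (simp add: supported_def)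

lemma supported_uminus [simp]: "supported k \<eta> \<Longrightarrow> supported k (- \<eta>)"
  by (auto simp: supported_def fun_eq_iff)

lemma supported_diff [simp]: "supported k \<eta> \<Longrightarrow> supported k \<theta> \<Longrightarrow> supported k (\<eta> - \<theta>)"
  by (auto simp: supported_def fun_eq_iff)

lemma supported_smult_form [simp]: "supported k \<eta> \<Longrightarrow> supported k (smult_form f \<eta>)"
  by (auto simp: supported_def smult_form_def fun_eq_iff)

lemma supported_fun_form [simp]: "supported 0 (fun_form f)"
  by (simp add: supported_def fun_form_def)

lemma supported_ins [simp]: "supported (Suc k) \<eta> \<Longrightarrow> X \<in> \<Gamma> \<Longrightarrow> supported k (ins X \<eta>)"
  by (auto simp: supported_def ins_def)

lemma supported_ins_end [simp]: "supported k \<eta> \<Longrightarrow> supported k (ins_end A N \<eta>)"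
  unfolding supported_def
proof (intro allI impI)
  fix Xs assume \<eta>: "\<forall>Xs. \<not> (length Xs = k \<and> set Xs \<subseteq> \<Gamma>) \<longrightarrow> \<eta> Xs = 0"
    and Xs: "\<not> (length Xs = k \<and> set Xs \<subseteq> \<Gamma>)"
  show "ins_end A N \<eta> Xs = 0"
  proof (cases "set Xs \<subseteq> \<Gamma>")
    case True
    with Xs \<eta> have "\<eta> (Xs[j := N (Xs ! j)]) = 0" for j by simp
    then show ?thesis by (simp add: ins_end_def on_sections_def)
  qed (simp add: ins_end_def on_sections_def)
qed

lemma length_drop_nth: "i < length Xs \<Longrightarrow> length (drop_nth i Xs) = length Xs - 1"
  by (simp add: drop_nth_def)

lemma supported_d [simp]: "supported k \<eta> \<Longrightarrow> supported (Suc k) (d A \<eta>)"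
  unfolding supported_def
proof (intro allI impI)
  fix Xs assume \<eta>: "\<forall>Xs. \<not> (length Xs = k \<and> set Xs \<subseteq> \<Gamma>) \<longrightarrow> \<eta> Xs = 0"
    and Xs: "\<not> (length Xs = Suc k \<and> set Xs \<subseteq> \<Gamma>)"
  show "d A \<eta> Xs = 0"
  proof (cases "set Xs \<subseteq> \<Gamma>")
    case True
    with Xs have l: "length Xs \<noteq> Suc k" by simp
    have 1: "\<rho> (Xs ! i) (\<eta> (drop_nth i Xs)) = 0" if "i < length Xs" for i
    proof -
      have "length (drop_nth i Xs) \<noteq> k"
        using l that length_drop_nth[OF that] by linarith
      then have "\<eta> (drop_nth i Xs) = 0" using \<eta> by blast
      then show ?thesis using True that nth_mem by (metis anchor_fun_zero subsetD)
    qed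
    have 2: "\<eta> (br (Xs ! i) (Xs ! j) # drop_nth i (drop_nth j Xs)) = 0"
      if "j < length Xs" "i < j" for i j
    proof -
      have "length (drop_nth i (drop_nth j Xs)) = length Xs - 2"
        using that by (simp add: length_drop_nth)
      then have "length (br (Xs ! i) (Xs ! j) # drop_nth i (drop_nth j Xs)) \<noteq> k"
        using l that by auto
      then show ?thesis using \<eta> by blast
    qed
    show ?thesis
      by (rule ext) (use True 1 2 in \<open>simp add: d_def on_sections_def\<close>)
  qed (simp add: d_def on_sections_def)
qed

lemma supported1_eqI:
  assumes "supported 1 \<eta>" "supported 1 \<theta>" "\<And>Z p. Z \<in> \<Gamma> \<Longrightarrow> \<eta> [Z] p = \<theta> [Z] p"
  shows "\<eta> = \<theta>"
proof
  fix Xs show "\<eta> Xs = \<theta> Xs"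
  proof (cases "length Xs = 1 \<and> set Xs \<subseteq> \<Gamma>")
    case True
    then obtain Z where "Xs = [Z]" "Z \<in> \<Gamma>" by (auto simp: One_nat_def length_Suc_conv)
    then show ?thesis using assms(3) by blast
  qed (use supportedD[OF assms(1)] supportedD[OF assms(2)] in metis)
qed

lemma supported3_eqI:
  assumes "supported 3 \<eta>" "supported 3 \<theta>"
    "\<And>X Y Z p. X \<in> \<Gamma> \<Longrightarrow> Y \<in> \<Gamma> \<Longrightarrow> Z \<in> \<Gamma> \<Longrightarrow> \<eta> [X, Y, Z] p = \<theta> [X, Y, Z] p"
  shows "\<eta> = \<theta>"
proof
  fix Xs show "\<eta> Xs = \<theta> Xs"
  proof (cases "length Xs = 3 \<and> set Xs \<subseteq> \<Gamma>")
    case True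
    then obtain X Y Z where "Xs = [X, Y, Z]" "X \<in> \<Gamma>" "Y \<in> \<Gamma>" "Z \<in> \<Gamma>"
      by (auto simp: numeral_3_eq_3 length_Suc_conv)
    then show ?thesis using assms(3) by blast
  qed (use supportedD[OF assms(1)] supportedD[OF assms(2)] in metis)
qed

lemma form2_skew:
  assumes \<eta>: "\<eta> \<in> forms A 2" and X: "X \<in> \<Gamma>" and Y: "Y \<in> \<Gamma>"
  shows "\<eta> [X, Y] = - \<eta> [Y, X]"
proof -
  have add: "\<eta> [U + V, Z] = \<eta> [U, Z] + \<eta> [V, Z]" "\<eta> [Z, U + V] = \<eta> [Z, U] + \<eta> [Z, V]"
    if "U \<in> \<Gamma>" "V \<in> \<Gamma>" "Z \<in> \<Gamma>" for U V Z
    using form_slot(1)[OF \<eta>, of "[Z, Z]" 0 U V] form_slot(1)[OF \<eta>, of "[Z, Z]" 1 U V] that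
    by (simp_all add: One_nat_def)
  have alt: "\<eta> [Z, Z] p = 0" for Z p
    using form_alternating[OF \<eta>, of "[Z, Z]"] by simp
  show ?thesis
  proof
    fix p
    show "\<eta> [X, Y] p = (- \<eta> [Y, X]) p"
      using alt[of "X + Y" p] alt[of X p] alt[of Y p] X Y by (simp add: add)
  qed
qed

lemma form2_linear:
  assumes \<eta>: "\<eta> \<in> forms A 2" and "U \<in> \<Gamma>" "V \<in> \<Gamma>" "Z \<in> \<Gamma>"
  shows "\<eta> [U + V, Z] = \<eta> [U, Z] + \<eta> [V, Z]"
    and "\<eta> [Z, U + V] = \<eta> [Z, U] + \<eta> [Z, V]"
    and "f \<in> F \<Longrightarrow> \<eta> [smult f U, Z] = f * \<eta> [U, Z]"
    and "f \<in> F \<Longrightarrow> \<eta> [Z, smult f U] = f * \<eta> [Z, U]"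
  using form_slot(1)[OF \<eta>, of "[Z, Z]" 0 U V] form_slot(1)[OF \<eta>, of "[Z, Z]" 1 U V]
    form_slot(2)[OF \<eta>, of "[Z, Z]" 0 U f] form_slot(2)[OF \<eta>, of "[Z, Z]" 1 U f] assms
  by (simp_all add: One_nat_def)

text \<open>
  Skew-symmetry reduces multilinearity to the first slot.
\<close>

lemma form2I:
  assumes "supported 2 \<eta>" and smooth: "\<And>X Y. X \<in> \<Gamma> \<Longrightarrow> Y \<in> \<Gamma> \<Longrightarrow> \<eta> [X, Y] \<in> F"
    and skew: "\<And>X Y p. X \<in> \<Gamma> \<Longrightarrow> Y \<in> \<Gamma> \<Longrightarrow> \<eta> [X, Y] p = - \<eta> [Y, X] p"
    and add: "\<And>X X' Y p. X \<in> \<Gamma> \<Longrightarrow> X' \<in> \<Gamma> \<Longrightarrow> Y \<in> \<Gamma> \<Longrightarrow>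
      \<eta> [X + X', Y] p = \<eta> [X, Y] p + \<eta> [X', Y] p"
    and smult: "\<And>X Y f p. X \<in> \<Gamma> \<Longrightarrow> Y \<in> \<Gamma> \<Longrightarrow> f \<in> F \<Longrightarrow> \<eta> [smult f X, Y] p = f p * \<eta> [X, Y] p"
  shows "\<eta> \<in> forms A 2"
proof -
  have alt: "\<eta> [X, X] = 0" if "X \<in> \<Gamma>" for X
    by (rule ext) (use skew[OF that that] in \<open>simp add: eq_neg_iff_add_eq_0\<close>)
  have add': "\<eta> [X + X', Y] = \<eta> [X, Y] + \<eta> [X', Y]" "\<eta> [Y, X + X'] = \<eta> [Y, X] + \<eta> [Y, X']"
    if "X \<in> \<Gamma>" "X' \<in> \<Gamma>" "Y \<in> \<Gamma>" for X X' Y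
    using that by (auto simp: fun_eq_iff add skew[of Y])
  have smult': "\<eta> [smult f X, Y] = f * \<eta> [X, Y]" "\<eta> [Y, smult f X] = f * \<eta> [Y, X]"
    if "X \<in> \<Gamma>" "Y \<in> \<Gamma>" "f \<in> F" for f X Y
    using that by (auto simp: fun_eq_iff smult skew[of Y])
  show ?thesis
    unfolding forms_def
    using assms(1) smooth alt add' smult'
    by (auto simp: supported_def numeral_2_eq_2 One_nat_def length_Suc_conv less_Suc_eq)
qed

lemma form3_swap:
  assumes \<eta>: "\<eta> \<in> forms A 3" and "X \<in> \<Gamma>" "Y \<in> \<Gamma>" "Z \<in> \<Gamma>"
  shows "\<eta> [Y, X, Z] p = - \<eta> [X, Y, Z] p" and "\<eta> [X, Z, Y] p = - \<eta> [X, Y, Z] p"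
proof -
  have add: "\<eta> [U + V, W, T] = \<eta> [U, W, T] + \<eta> [V, W, T]"
    "\<eta> [W, U + V, T] = \<eta> [W, U, T] + \<eta> [W, V, T]"
    "\<eta> [W, T, U + V] = \<eta> [W, T, U] + \<eta> [W, T, V]"
    if "U \<in> \<Gamma>" "V \<in> \<Gamma>" "W \<in> \<Gamma>" "T \<in> \<Gamma>" for U V W T
    using form_slot(1)[OF \<eta>, of "[W, W, T]" 0 U V] form_slot(1)[OF \<eta>, of "[W, W, T]" 1 U V]
      form_slot(1)[OF \<eta>, of "[W, T, T]" 2 U V] that
    by (simp_all add: One_nat_def numeral_2_eq_2)
  have alt: "\<eta> [W, W, T] p = 0" "\<eta> [T, W, W] p = 0" for W T p
    using form_alternating[OF \<eta>, of "[W, W, T]"] form_alternating[OF \<eta>, of "[T, W, W]"] by simp_all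
  show "\<eta> [Y, X, Z] p = - \<eta> [X, Y, Z] p"
    using alt(1)[of "X + Y" Z p] alt(1)[of X Z p] alt(1)[of Y Z p] assms by (simp add: add)
  show "\<eta> [X, Z, Y] p = - \<eta> [X, Y, Z] p"
    using alt(2)[of X "Y + Z" p] alt(2)[of X Y p] alt(2)[of X Z p] assms by (simp add: add)
qed

lemma form3I:
  assumes "supported 3 \<eta>"
    and smooth: "\<And>X Y Z. X \<in> \<Gamma> \<Longrightarrow> Y \<in> \<Gamma> \<Longrightarrow> Z \<in> \<Gamma> \<Longrightarrow> \<eta> [X, Y, Z] \<in> F"
    and swap12: "\<And>X Y Z p. X \<in> \<Gamma> \<Longrightarrow> Y \<in> \<Gamma> \<Longrightarrow> Z \<in> \<Gamma> \<Longrightarrow> \<eta> [Y, X, Z] p = - \<eta> [X, Y, Z] p"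
    and swap23: "\<And>X Y Z p. X \<in> \<Gamma> \<Longrightarrow> Y \<in> \<Gamma> \<Longrightarrow> Z \<in> \<Gamma> \<Longrightarrow> \<eta> [X, Z, Y] p = - \<eta> [X, Y, Z] p"
    and add: "\<And>X X' Y Z p. X \<in> \<Gamma> \<Longrightarrow> X' \<in> \<Gamma> \<Longrightarrow> Y \<in> \<Gamma> \<Longrightarrow> Z \<in> \<Gamma> \<Longrightarrow>
      \<eta> [X + X', Y, Z] p = \<eta> [X, Y, Z] p + \<eta> [X', Y, Z] p"
    and smult: "\<And>X Y Z f p. X \<in> \<Gamma> \<Longrightarrow> Y \<in> \<Gamma> \<Longrightarrow> Z \<in> \<Gamma> \<Longrightarrow> f \<in> F \<Longrightarrow>
      \<eta> [smult f X, Y, Z] p = f p * \<eta> [X, Y, Z] p"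
  shows "\<eta> \<in> forms A 3"
proof -
  have to2: "\<eta> [Y, X, Z] p = - \<eta> [X, Y, Z] p" and to3: "\<eta> [Y, Z, X] p = \<eta> [X, Y, Z] p"
    if "X \<in> \<Gamma>" "Y \<in> \<Gamma>" "Z \<in> \<Gamma>" for X Y Z p
    using swap12[OF that, of p] swap23[OF that(2,1,3), of p] by linarith+
  have alt: "\<eta> [X, X, Y] = 0" "\<eta> [X, Y, X] = 0" "\<eta> [Y, X, X] = 0" if "X \<in> \<Gamma>" "Y \<in> \<Gamma>" for X Y
  proof -
    have *: "\<eta> [X, X, Y] p = 0" "\<eta> [Y, X, X] p = 0" for p
      using swap12[OF that(1,1,2), of p] swap23[OF that(2,1,1), of p] by linarith+
    then show "\<eta> [X, X, Y] = 0" "\<eta> [Y, X, X] = 0" by (auto simp: fun_eq_iff)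
    show "\<eta> [X, Y, X] = 0"
      by (rule ext) (use * swap12[OF that(2,1,1)] in simp)
  qed
  have add1: "\<eta> [X + X', Y, Z] = \<eta> [X, Y, Z] + \<eta> [X', Y, Z]"
    if "X \<in> \<Gamma>" "X' \<in> \<Gamma>" "Y \<in> \<Gamma>" "Z \<in> \<Gamma>" for X X' Y Z
    using that by (auto simp: fun_eq_iff add)
  have add2: "\<eta> [Y, X + X', Z] = \<eta> [Y, X, Z] + \<eta> [Y, X', Z]"
    and add3: "\<eta> [Y, Z, X + X'] = \<eta> [Y, Z, X] + \<eta> [Y, Z, X']"
    if "X \<in> \<Gamma>" "X' \<in> \<Gamma>" "Y \<in> \<Gamma>" "Z \<in> \<Gamma>" for X X' Y Z
    by (auto simp: fun_eq_iff add that to2[OF that(1,3,4)] to2[OF that(2,3,4)]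
        to2[OF section_add[OF that(1,2)] that(3,4)] to3[OF that(1,3,4)] to3[OF that(2,3,4)]
        to3[OF section_add[OF that(1,2)] that(3,4)])
  have smult1: "\<eta> [smult f X, Y, Z] = f * \<eta> [X, Y, Z]"
    if "X \<in> \<Gamma>" "Y \<in> \<Gamma>" "Z \<in> \<Gamma>" "f \<in> F" for f X Y Z
    using that by (auto simp: fun_eq_iff smult)
  have smult2: "\<eta> [Y, smult f X, Z] = f * \<eta> [Y, X, Z]"
    and smult3: "\<eta> [Y, Z, smult f X] = f * \<eta> [Y, Z, X]"
    if "X \<in> \<Gamma>" "Y \<in> \<Gamma>" "Z \<in> \<Gamma>" "f \<in> F" for f X Y Z
    by (auto simp: fun_eq_iff smult that to2[OF that(1,2,3)] to3[OF that(1,2,3)]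
        to2[OF section_smult[OF that(4,1)] that(2,3)] to3[OF section_smult[OF that(4,1)] that(2,3)])
  show ?thesis
    unfolding forms_def mem_Collect_eq
  proof (rule conjI; intro allI impI)
    fix Xs :: "('m \<Rightarrow> 'v) list"
    assume "\<not> (length Xs = 3 \<and> set Xs \<subseteq> \<Gamma>)"
    then show "\<eta> Xs = 0" by (rule supportedD[OF assms(1)])
  next
    fix Xs :: "('m \<Rightarrow> 'v) list"
    assume "length Xs = 3 \<and> set Xs \<subseteq> \<Gamma>"
    then obtain X Y Z where Xs: "Xs = [X, Y, Z]" and XYZ: "X \<in> \<Gamma>" "Y \<in> \<Gamma>" "Z \<in> \<Gamma>"
      by (auto simp: numeral_3_eq_3 length_Suc_conv)
    show "\<eta> Xs \<in> F \<and> (\<not> distinct Xs \<longrightarrow> \<eta> Xs = 0) \<and>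
        (\<forall>i<3. \<forall>U\<in>\<Gamma>. \<forall>V\<in>\<Gamma>. \<eta> (Xs[i := U + V]) = \<eta> (Xs[i := U]) + \<eta> (Xs[i := V])) \<and>
        (\<forall>i<3. \<forall>U\<in>\<Gamma>. \<forall>f\<in>F. \<eta> (Xs[i := smult f U]) = f * \<eta> (Xs[i := U]))"
    proof (intro conjI allI impI ballI)
      show "\<eta> Xs \<in> F" unfolding Xs by (rule smooth[OF XYZ])
      show "\<eta> Xs = 0" if "\<not> distinct Xs"
      proof -
        from that consider "X = Y" | "X = Z" | "Y = Z" by (auto simp: Xs)
        then show ?thesis unfolding Xs by cases (simp_all only: alt XYZ)
      qed
      fix i :: nat assume "i < 3"
      then consider "i = 0" | "i = Suc 0" | "i = Suc (Suc 0)" by linarith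
      note i = this
      show "\<eta> (Xs[i := U + V]) = \<eta> (Xs[i := U]) + \<eta> (Xs[i := V])"
        if "U \<in> \<Gamma>" "V \<in> \<Gamma>" for U V
        using i unfolding Xs
        by cases (simp_all only: list_update.simps nat.case add1 add2 add3 that XYZ)
      show "\<eta> (Xs[i := smult f U]) = f * \<eta> (Xs[i := U])" if "U \<in> \<Gamma>" "f \<in> F" for U f
        using i unfolding Xs
        by cases (simp_all only: list_update.simps nat.case smult1 smult2 smult3 that XYZ)
    qed
  qed
qed

lemma ins_form2 [simp]:
  assumes \<eta>: "\<eta> \<in> forms A 2" and X: "X \<in> \<Gamma>"
  shows "ins X \<eta> \<in> covectors A"
proof (rule covectorI)
  show "ins X \<eta> Ys = 0" if "\<not> (\<exists>Y\<in>\<Gamma>. Ys = [Y])" for Ys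
    unfolding ins_def using that
    by (intro form_outside[OF \<eta>]) (auto simp: numeral_2_eq_2 length_Suc_conv)
qed (use form2_linear[OF \<eta>] X form_smooth[OF \<eta>] in \<open>simp_all add: ins_def\<close>)

lemma ins2_form3 [simp]:
  assumes \<eta>: "\<eta> \<in> forms A 3" and X: "X \<in> \<Gamma>" and Y: "Y \<in> \<Gamma>"
  shows "ins2 X Y \<eta> \<in> covectors A"
proof (rule covectorI)
  show "ins2 X Y \<eta> Zs = 0" if "\<not> (\<exists>Z\<in>\<Gamma>. Zs = [Z])" for Zs
    unfolding ins2_def ins_def using that
    by (intro form_outside[OF \<eta>]) (auto simp: numeral_3_eq_3 length_Suc_conv)
  show "ins2 X Y \<eta> [U + V] = ins2 X Y \<eta> [U] + ins2 X Y \<eta> [V]" if "U \<in> \<Gamma>" "V \<in> \<Gamma>" for U V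
    using form_slot(1)[OF \<eta>, of "[Y, X, X]" 2 U V] that X Y
    by (simp add: ins2_def ins_def numeral_2_eq_2)
  show "ins2 X Y \<eta> [smult f U] = f * ins2 X Y \<eta> [U]" if "U \<in> \<Gamma>" "f \<in> F" for f U
    using form_slot(2)[OF \<eta>, of "[Y, X, X]" 2 U f] that X Y
    by (simp add: ins2_def ins_def numeral_2_eq_2)
qed (simp add: ins2_def ins_def form_smooth[OF \<eta>])

lemma ins_zero_section: "\<eta> \<in> forms A k \<Longrightarrow> ins 0 \<eta> = 0"
proof
  fix Ys assume \<eta>: "\<eta> \<in> forms A k"
  show "ins 0 \<eta> Ys = 0 Ys"
  proof (cases "length (0 # Ys) = k \<and> set (0 # Ys) \<subseteq> \<Gamma>")
    case True
    then have "\<eta> ((0 # Ys)[0 := smult 0 0]) = 0 * \<eta> ((0 # Ys)[0 := 0])"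
      by (intro form_slot(2)[OF \<eta>]) auto
    then show ?thesis by (simp add: ins_def)
  next
    case False
    then show ?thesis using form_outside[OF \<eta> False] by (simp add: ins_def)
  qed
qed

subsection \<open>The differential\<close>

lemma d_0: "X \<in> \<Gamma> \<Longrightarrow> d A \<eta> [X] p = \<rho> X (\<eta> []) p"
  by (simp add: d_def on_sections_def drop_nth_def)

lemma d_1:
  "X \<in> \<Gamma> \<Longrightarrow> Y \<in> \<Gamma> \<Longrightarrow> d A \<eta> [X, Y] p = \<rho> X (\<eta> [Y]) p - \<rho> Y (\<eta> [X]) p - \<eta> [br X Y] p"
  by (simp add: d_def on_sections_def drop_nth_def lessThan_Suc)

lemma d_2:
  "X \<in> \<Gamma> \<Longrightarrow> Y \<in> \<Gamma> \<Longrightarrow> Z \<in> \<Gamma> \<Longrightarrow> d A \<eta> [X, Y, Z] p =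
    \<rho> X (\<eta> [Y, Z]) p - \<rho> Y (\<eta> [X, Z]) p + \<rho> Z (\<eta> [X, Y]) p
    - \<eta> [br X Y, Z] p + \<eta> [br X Z, Y] p - \<eta> [br Y Z, X] p"
  by (simp add: d_def on_sections_def drop_nth_def lessThan_Suc)

lemma d_3:
  "W \<in> \<Gamma> \<Longrightarrow> X \<in> \<Gamma> \<Longrightarrow> Y \<in> \<Gamma> \<Longrightarrow> Z \<in> \<Gamma> \<Longrightarrow> d A \<eta> [W, X, Y, Z] p =
    \<rho> W (\<eta> [X, Y, Z]) p - \<rho> X (\<eta> [W, Y, Z]) p + \<rho> Y (\<eta> [W, X, Z]) p - \<rho> Z (\<eta> [W, X, Y]) p
    - \<eta> [br W X, Y, Z] p + \<eta> [br W Y, X, Z] p - \<eta> [br W Z, X, Y] p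
    - \<eta> [br X Y, W, Z] p + \<eta> [br X Z, W, Y] p - \<eta> [br Y Z, W, X] p"
  by (simp add: d_def on_sections_def drop_nth_def lessThan_Suc)

lemma d_linear:
  assumes "\<And>Xs. set Xs \<subseteq> \<Gamma> \<Longrightarrow> \<eta> Xs \<in> F"
  shows d_add: "(\<And>Xs. set Xs \<subseteq> \<Gamma> \<Longrightarrow> \<theta> Xs \<in> F) \<Longrightarrow> d A (\<eta> + \<theta>) = d A \<eta> + d A \<theta>"
    and d_scale: "d A (smult_form (\<lambda>_. c) \<eta>) = smult_form (\<lambda>_. c) (d A \<eta>)"
proof -
  have dn: "set (drop_nth i Xs) \<subseteq> \<Gamma>" if "set Xs \<subseteq> \<Gamma>" for i Xs
    using that set_take_subset[of i Xs] set_drop_subset[of "Suc i" Xs] by (auto simp: drop_nth_def)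
  show "d A (\<eta> + \<theta>) = d A \<eta> + d A \<theta>" if \<theta>: "\<And>Xs. set Xs \<subseteq> \<Gamma> \<Longrightarrow> \<theta> Xs \<in> F"
  proof (intro ext)
    fix Xs p
    show "d A (\<eta> + \<theta>) Xs p = (d A \<eta> + d A \<theta>) Xs p"
    proof (cases "set Xs \<subseteq> \<Gamma>")
      case True
      have "\<rho> (Xs ! i) (\<eta> (drop_nth i Xs) + \<theta> (drop_nth i Xs)) p =
          \<rho> (Xs ! i) (\<eta> (drop_nth i Xs)) p + \<rho> (Xs ! i) (\<theta> (drop_nth i Xs)) p"
        if "i < length Xs" for i
      proof -
        have "Xs ! i \<in> \<Gamma>" using that True by auto
        from anchor_fun_add[OF this assms[OF dn[OF True]] \<theta>[OF dn[OF True]]] show ?thesis by simp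
      qed
      then show ?thesis
        using True by (simp add: d_def on_sections_def distrib_left sum.distrib)
    qed (simp add: d_def on_sections_def)
  qed
  show "d A (smult_form (\<lambda>_. c) \<eta>) = smult_form (\<lambda>_. c) (d A \<eta>)"
  proof (intro ext)
    fix Xs p
    show "d A (smult_form (\<lambda>_. c) \<eta>) Xs p = smult_form (\<lambda>_. c) (d A \<eta>) Xs p"
    proof (cases "set Xs \<subseteq> \<Gamma>")
      case True
      have "\<rho> (Xs ! i) ((\<lambda>_. c) * \<eta> (drop_nth i Xs)) p = c * \<rho> (Xs ! i) (\<eta> (drop_nth i Xs)) p"
        if "i < length Xs" for i
      proof -
        have "Xs ! i \<in> \<Gamma>" using that True by auto
        then show ?thesis by (rule anchor_fun_scale[OF _ assms[OF dn[OF True]]])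
      qed
      then show ?thesis
        using True
        by (simp add: d_def on_sections_def smult_form_def sum_distrib_left distrib_left mult_ac)
    qed (simp add: d_def on_sections_def smult_form_def)
  qed
qed

lemma uminus_form: "- \<eta> = smult_form (\<lambda>_. - 1) (\<eta> :: ('m, 'v) form)"
  by (intro ext) (simp add: smult_form_def)

lemma d_uminus: "(\<And>Xs. set Xs \<subseteq> \<Gamma> \<Longrightarrow> \<eta> Xs \<in> F) \<Longrightarrow> d A (- \<eta>) = - d A \<eta>"
  unfolding uminus_form by (rule d_scale)

lemma d_zero: "d A 0 = 0"
proof -
  have "d A (smult_form (\<lambda>_. 0) 0) = smult_form (\<lambda>_. 0) (d A 0)"
    by (rule d_scale) simp
  moreover have "smult_form (\<lambda>_. 0) \<eta> = 0" for \<eta> :: "('m, 'v) form"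
    by (intro ext) (simp add: smult_form_def)
  ultimately show ?thesis by metis
qed

lemma d_fun_form_covector [simp]:
  assumes "f \<in> F" shows "d A (fun_form f) \<in> covectors A"
proof (rule covectorI)
  have s: "supported 1 (d A (fun_form f))"
    using supported_d[OF supported_fun_form] by (simp add: One_nat_def)
  show "d A (fun_form f) Xs = 0" if "\<not> (\<exists>X\<in>\<Gamma>. Xs = [X])" for Xs
    using that by (intro supportedD[OF s]) (auto simp: One_nat_def length_Suc_conv)
  have ev: "d A (fun_form f) [X] = \<rho> X f" if "X \<in> \<Gamma>" for X
    by (rule ext) (simp add: d_0[OF that] fun_form_def)
  show "d A (fun_form f) [X] \<in> F" if "X \<in> \<Gamma>" for X
    using that assms by (simp add: ev)
  show "d A (fun_form f) [X + Y] = d A (fun_form f) [X] + d A (fun_form f) [Y]"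
    if "X \<in> \<Gamma>" "Y \<in> \<Gamma>" for X Y
    using that assms by (simp only: ev section_add anchor_add)
  show "d A (fun_form f) [smult g X] = g * d A (fun_form f) [X]" if "X \<in> \<Gamma>" "g \<in> F" for X g
    using that assms by (simp only: ev section_smult anchor_smult)
qed

lemma d_covector_form2 [simp]:
  assumes \<beta>: "\<beta> \<in> covectors A" shows "d A \<beta> \<in> forms A 2"
proof (rule form2I)
  note lin = covector_linear[OF \<beta>] covector_smooth[OF \<beta>]
  show "supported 2 (d A \<beta>)"
    using supported_d[OF form_supported[OF \<beta>]] by (simp add: One_nat_def numeral_2_eq_2)
  show "d A \<beta> [X, Y] \<in> F" if "X \<in> \<Gamma>" "Y \<in> \<Gamma>" for X Y
  proof -
    have "d A \<beta> [X, Y] = \<rho> X (\<beta> [Y]) - \<rho> Y (\<beta> [X]) - \<beta> [br X Y]"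
      by (rule ext) (simp add: d_1 that)
    then show ?thesis using that lin by simp
  qed
  show "d A \<beta> [X, Y] p = - d A \<beta> [Y, X] p" if "X \<in> \<Gamma>" "Y \<in> \<Gamma>" for X Y p
    using that bracket_skew[of X Y] by (simp add: d_1 lin)
  show "d A \<beta> [X + X', Y] p = d A \<beta> [X, Y] p + d A \<beta> [X', Y] p"
    if "X \<in> \<Gamma>" "X' \<in> \<Gamma>" "Y \<in> \<Gamma>" for X X' Y p
    using that by (simp add: d_1 lin anchor_add anchor_fun_add bracket_add_left)
  show "d A \<beta> [smult f X, Y] p = f p * d A \<beta> [X, Y] p" if "X \<in> \<Gamma>" "Y \<in> \<Gamma>" "f \<in> F" for f X Y p
    using that
    by (simp add: d_1 lin anchor_smult anchor_fun_mult bracket_smult_left algebra_simps)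
qed

lemma form2_diff:
  assumes \<eta>: "\<eta> \<in> forms A 2" and "U \<in> \<Gamma>" "V \<in> \<Gamma>" "Z \<in> \<Gamma>"
  shows "\<eta> [- U, Z] p = - \<eta> [U, Z] p" "\<eta> [U - V, Z] p = \<eta> [U, Z] p - \<eta> [V, Z] p"
proof -
  have n: "\<eta> [- V, Z] p = - \<eta> [V, Z] p" if "V \<in> \<Gamma>" for V
    using form2_linear(3)[OF \<eta> that that assms(4) F_const[of "- 1"]] by (simp add: smult_minus_one)
  show "\<eta> [- U, Z] p = - \<eta> [U, Z] p" by (rule n[OF assms(2)])
  show "\<eta> [U - V, Z] p = \<eta> [U, Z] p - \<eta> [V, Z] p"
    using form2_linear(1)[OF \<eta> assms(2) section_uminus[OF assms(3)] assms(4)] n[OF assms(3)] by simp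
qed

lemma d_form2_form3 [simp]:
  assumes \<sigma>: "\<sigma> \<in> forms A 2" shows "d A \<sigma> \<in> forms A 3"
proof (rule form3I)
  note lin = form2_linear[OF \<sigma>] form2_diff[OF \<sigma>] form_smooth[OF \<sigma>]
  show "supported 3 (d A \<sigma>)"
    using supported_d[OF form_supported[OF \<sigma>]] by (simp add: numeral_2_eq_2 numeral_3_eq_3)
  show "d A \<sigma> [X, Y, Z] \<in> F" if "X \<in> \<Gamma>" "Y \<in> \<Gamma>" "Z \<in> \<Gamma>" for X Y Z
  proof -
    have "d A \<sigma> [X, Y, Z] = \<rho> X (\<sigma> [Y, Z]) - \<rho> Y (\<sigma> [X, Z]) + \<rho> Z (\<sigma> [X, Y])
        - \<sigma> [br X Y, Z] + \<sigma> [br X Z, Y] - \<sigma> [br Y Z, X]"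
      by (rule ext) (simp add: d_2 that)
    then show ?thesis using that lin by simp
  qed
  have skew: "\<rho> X (\<sigma> [Y, Z]) p = - \<rho> X (\<sigma> [Z, Y]) p" "\<sigma> [br X Y, Z] p = - \<sigma> [br Y X, Z] p"
    if "X \<in> \<Gamma>" "Y \<in> \<Gamma>" "Z \<in> \<Gamma>" for X Y Z p
  proof -
    show "\<rho> X (\<sigma> [Y, Z]) p = - \<rho> X (\<sigma> [Z, Y]) p"
      unfolding form2_skew[OF \<sigma> that(2,3)]
      using anchor_fun_uminus[OF that(1) form_smooth[OF \<sigma>]] by simp
    show "\<sigma> [br X Y, Z] p = - \<sigma> [br Y X, Z] p"
      unfolding bracket_skew[OF that(1,2)] using that by (simp add: lin)
  qed
  show "d A \<sigma> [Y, X, Z] p = - d A \<sigma> [X, Y, Z] p" if "X \<in> \<Gamma>" "Y \<in> \<Gamma>" "Z \<in> \<Gamma>" for X Y Z p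
    using skew(1)[of Z X Y p] skew(2)[of X Y Z p] that by (simp add: d_2)
  show "d A \<sigma> [X, Z, Y] p = - d A \<sigma> [X, Y, Z] p" if "X \<in> \<Gamma>" "Y \<in> \<Gamma>" "Z \<in> \<Gamma>" for X Y Z p
    using skew(1)[of X Y Z p] skew(2)[of Y Z X p] that by (simp add: d_2)
  show "d A \<sigma> [X + X', Y, Z] p = d A \<sigma> [X, Y, Z] p + d A \<sigma> [X', Y, Z] p"
    if "X \<in> \<Gamma>" "X' \<in> \<Gamma>" "Y \<in> \<Gamma>" "Z \<in> \<Gamma>" for X X' Y Z p
    using that by (simp add: d_2 lin anchor_add anchor_fun_add bracket_add_left)
  show "d A \<sigma> [smult f X, Y, Z] p = f p * d A \<sigma> [X, Y, Z] p"
    if "X \<in> \<Gamma>" "Y \<in> \<Gamma>" "Z \<in> \<Gamma>" "f \<in> F" for f X Y Z p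
  proof -
    have "\<sigma> [X, Y] p = - \<sigma> [Y, X] p" "\<sigma> [X, Z] p = - \<sigma> [Z, X] p"
      using form2_skew[OF \<sigma>, of X Y] form2_skew[OF \<sigma>, of X Z] that by simp_all
    then show ?thesis
      using that
      by (simp add: d_2 lin anchor_smult anchor_fun_mult bracket_smult_left algebra_simps)
  qed
qed

text \<open>
  After expansion, the iterated anchors cancel because the anchor is a morphism of brackets, the
  terms with a double bracket cancel by the Jacobi identity, and the terms with two brackets cancel
  by skew-symmetry.
\<close>

lemma dd_form2:
  assumes \<sigma>: "\<sigma> \<in> forms A 2" shows "d A (d A \<sigma>) = 0"
proof (intro ext)
  fix Xs p
  have s: "supported 4 (d A (d A \<sigma>))"
    using supported_d[OF form_supported[OF d_form2_form3[OF \<sigma>]]] by simp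
  note lin = form2_linear[OF \<sigma>] form2_diff[OF \<sigma>] form_smooth[OF \<sigma>]
  have *: "d A (d A \<sigma>) [W, X, Y, Z] p = 0" if "W \<in> \<Gamma>" "X \<in> \<Gamma>" "Y \<in> \<Gamma>" "Z \<in> \<Gamma>" for W X Y Z
  proof -
    have fn: "d A \<sigma> [X, Y, Z] = \<rho> X (\<sigma> [Y, Z]) - \<rho> Y (\<sigma> [X, Z]) + \<rho> Z (\<sigma> [X, Y])
        - \<sigma> [br X Y, Z] + \<sigma> [br X Z, Y] - \<sigma> [br Y Z, X]"
      if "X \<in> \<Gamma>" "Y \<in> \<Gamma>" "Z \<in> \<Gamma>" for X Y Z
      by (rule ext) (simp add: d_2 that)
    have ab: "\<rho> (br X Y) f p = \<rho> X (\<rho> Y f) p - \<rho> Y (\<rho> X f) p"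
      if "X \<in> \<Gamma>" "Y \<in> \<Gamma>" "f \<in> F" for X Y f
      using anchor_bracket[OF that] by simp
    have jac: "\<sigma> [br (br X Y) Z, V] p = \<sigma> [br (br X Z) Y, V] p - \<sigma> [br (br Y Z) X, V] p"
      if "X \<in> \<Gamma>" "Y \<in> \<Gamma>" "Z \<in> \<Gamma>" "V \<in> \<Gamma>" for X Y Z V
    proof -
      have "br (br X Y) Z = br (br X Z) Y - br (br Y Z) X"
        using jacobi[OF that(1-3)] bracket_skew[of Y "br X Z"] bracket_skew[of X "br Y Z"] that
        by (simp add: algebra_simps)
      then show ?thesis using that by (simp add: lin)
    qed
    have skew: "\<sigma> [br X Y, br Z V] p = - \<sigma> [br Z V, br X Y] p"
      if "X \<in> \<Gamma>" "Y \<in> \<Gamma>" "Z \<in> \<Gamma>" "V \<in> \<Gamma>" for X Y Z V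
      using form2_skew[OF \<sigma>, of "br X Y" "br Z V"] that by simp
    have skewa: "\<rho> V (\<sigma> [X, br Y Z]) p = - \<rho> V (\<sigma> [br Y Z, X]) p"
      if "X \<in> \<Gamma>" "Y \<in> \<Gamma>" "Z \<in> \<Gamma>" "V \<in> \<Gamma>" for X Y Z V
      unfolding form2_skew[OF \<sigma> that(1) bracket_section[OF that(2,3)]]
      using anchor_fun_uminus[OF that(4) form_smooth[OF \<sigma>]] by simp
    show ?thesis
      using that jac[of W X Y Z] jac[of W X Z Y] jac[of W Y Z X] jac[of X Y Z W]
        skew[of W X Y Z] skew[of W Y X Z] skew[of W Z X Y]
      by (simp add: d_3 fn anchor_fun_add anchor_fun_diff lin ab d_2 skewa)
  qed
  show "d A (d A \<sigma>) Xs p = 0 Xs p"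
  proof (cases "length Xs = 4 \<and> set Xs \<subseteq> \<Gamma>")
    case True
    then have "length Xs = Suc (Suc (Suc (Suc 0)))" by simp
    then obtain W X Y Z where "Xs = [W, X, Y, Z]" by (auto simp: length_Suc_conv)
    with True * show ?thesis by simp
  next
    case False
    then show ?thesis by (simp only: supportedD[OF s False] zero_fun_apply)
  qed
qed

lemma lie_eval:
  assumes "X \<in> \<Gamma>" "Z \<in> \<Gamma>"
  shows "lie A X \<beta> [Z] p = d A \<beta> [X, Z] p + \<rho> Z (\<beta> [X]) p"
  using assms by (simp add: lie_def ins_def d_0)

lemma ins_covector: "\<beta> \<in> covectors A \<Longrightarrow> ins X \<beta> = fun_form (\<beta> [X])"
  by (rule ext) (auto simp: ins_def fun_form_def intro!: form_outside[of \<beta> 1])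

lemma lie_covector [simp]: "X \<in> \<Gamma> \<Longrightarrow> \<beta> \<in> covectors A \<Longrightarrow> lie A X \<beta> \<in> covectors A"
  by (simp add: lie_def ins_covector)

section \<open>The Schouten square of a bivector\<close>

lemma bracket_pi_covector [simp]:
  assumes "P \<in> bivectors A" "\<alpha> \<in> covectors A" "\<beta> \<in> covectors A"
  shows "bracket_pi A P \<alpha> \<beta> \<in> covectors A"
  unfolding bracket_pi_def
  using assms by (intro form_diff_covector lie_covector sharp_section d_fun_form_covector bivectorD(1))

lemma bracket_pi_eval:
  assumes P: "P \<in> bivectors A" and \<alpha>: "\<alpha> \<in> covectors A" and \<beta>: "\<beta> \<in> covectors A" and Z: "Z \<in> \<Gamma>"
  shows "bracket_pi A P \<alpha> \<beta> [Z] p =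
    d A \<beta> [sharp A P \<alpha>, Z] p - d A \<alpha> [sharp A P \<beta>, Z] p + \<rho> Z (P \<alpha> \<beta>) p"
proof -
  have "\<rho> Z (P \<beta> \<alpha>) p = - \<rho> Z (P \<alpha> \<beta>) p"
    unfolding bivector_skew[OF P \<beta> \<alpha>] using anchor_fun_uminus[OF Z bivectorD(1)[OF P \<alpha> \<beta>]] by simp
  then show ?thesis
    using Z sharp_section[OF P \<alpha>] sharp_section[OF P \<beta>]
    by (simp add: bracket_pi_def lie_eval d_0 fun_form_def covector_sharp[OF P \<alpha> \<beta>]
        covector_sharp[OF P \<beta> \<alpha>])
qed

text \<open>
  If \<open>\<pi>\<^sup>\<sharp>\<close> is a bracket morphism, pairing the defect with a third covector and using
  \<open>\<gamma>(\<pi>\<^sup>\<sharp>\<omega>) = - \<omega>(\<pi>\<^sup>\<sharp>\<gamma>)\<close> gives the Jacobi identity of \<open>\<pi>\<close> in its cyclic form.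
\<close>

lemma sharp_morphism_imp_cyclic_identity:
  assumes P: "P \<in> bivectors A"
    and \<alpha>: "\<alpha> \<in> covectors A" and \<beta>: "\<beta> \<in> covectors A" and \<gamma>: "\<gamma> \<in> covectors A"
    and a: "a = sharp A P \<alpha>" and b: "b = sharp A P \<beta>" and c: "c = sharp A P \<gamma>"
    and mor: "br a b = sharp A P (bracket_pi A P \<alpha> \<beta>)"
  shows "\<gamma> [br a b] p + \<beta> [br c a] p + \<alpha> [br b c] p
    - \<rho> a (P \<beta> \<gamma>) p - \<rho> b (P \<gamma> \<alpha>) p - \<rho> c (P \<alpha> \<beta>) p = 0"
proof -
  let ?w = "bracket_pi A P \<alpha> \<beta>"
  have s: "a \<in> \<Gamma>" "b \<in> \<Gamma>" "c \<in> \<Gamma>"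
    unfolding a b c using sharp_section[OF P] \<alpha> \<beta> \<gamma> by auto
  have w: "?w \<in> covectors A" using P \<alpha> \<beta> by simp
  have "\<gamma> [br a b] p = - ?w [c] p"
    using mor covector_sharp[OF P w \<gamma>] covector_sharp[OF P \<gamma> w] bivector_skew[OF P w \<gamma>] c by simp
  also have "?w [c] p = d A \<beta> [a, c] p - d A \<alpha> [b, c] p + \<rho> c (P \<alpha> \<beta>) p"
    using bracket_pi_eval[OF P \<alpha> \<beta> s(3)] a b by simp
  finally have 1: "\<gamma> [br a b] p =
      - (d A \<beta> [a, c] p - d A \<alpha> [b, c] p + \<rho> c (P \<alpha> \<beta>) p)" .
  have ev: "\<beta> [c] = P \<gamma> \<beta>" "\<beta> [a] = P \<alpha> \<beta>" "\<alpha> [c] = P \<gamma> \<alpha>" "\<alpha> [b] = P \<beta> \<alpha>"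
    unfolding a b c using covector_sharp[OF P] \<alpha> \<beta> \<gamma> by auto
  have 2: "d A \<beta> [a, c] p = \<rho> a (P \<gamma> \<beta>) p - \<rho> c (P \<alpha> \<beta>) p - \<beta> [br a c] p"
    "d A \<alpha> [b, c] p = \<rho> b (P \<gamma> \<alpha>) p - \<rho> c (P \<beta> \<alpha>) p - \<alpha> [br b c] p"
    by (simp_all only: d_1[OF s(1,3)] d_1[OF s(2,3)] ev)
  have 3: "\<rho> a (P \<gamma> \<beta>) p = - \<rho> a (P \<beta> \<gamma>) p" "\<rho> c (P \<beta> \<alpha>) p = - \<rho> c (P \<alpha> \<beta>) p"
    unfolding bivector_skew[OF P \<gamma> \<beta>] bivector_skew[OF P \<beta> \<alpha>]
    using anchor_fun_uminus[OF s(1) bivectorD(1)[OF P \<beta> \<gamma>]]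
      anchor_fun_uminus[OF s(3) bivectorD(1)[OF P \<alpha> \<beta>]] by simp_all
  have 4: "\<beta> [br a c] p = - \<beta> [br c a] p"
    unfolding bracket_skew[OF s(1,3)] using covector_uminus[OF \<beta>] s by simp
  show ?thesis using 1 2 3 4 by linarith
qed

text \<open>This is \<open>(X \<and> Y)\<^sup>\<sharp>\<alpha>\<close>.\<close>

definition wedge_sharp :: "('m \<Rightarrow> 'v) \<Rightarrow> ('m \<Rightarrow> 'v) \<Rightarrow> ('m, 'v) form \<Rightarrow> 'm \<Rightarrow> 'v" where
  "wedge_sharp X Y \<alpha> = smult (\<alpha> [X]) Y - smult (\<alpha> [Y]) X"

lemma wedge_sharp_section [simp]:
  "\<alpha> \<in> covectors A \<Longrightarrow> X \<in> \<Gamma> \<Longrightarrow> Y \<in> \<Gamma> \<Longrightarrow> wedge_sharp X Y \<alpha> \<in> \<Gamma>"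
  by (simp add: wedge_sharp_def)

lemma wedge2_smooth [simp]:
  "\<alpha> \<in> covectors A \<Longrightarrow> \<beta> \<in> covectors A \<Longrightarrow> wedge2 X Y \<alpha> \<beta> \<in> F"
  by (simp add: wedge2_def)

lemma covector_wedge_sharp:
  "\<alpha> \<in> covectors A \<Longrightarrow> \<beta> \<in> covectors A \<Longrightarrow> X \<in> \<Gamma> \<Longrightarrow> Y \<in> \<Gamma> \<Longrightarrow>
    \<beta> [wedge_sharp X Y \<alpha>] = wedge2 X Y \<alpha> \<beta>"
  by (rule ext)
    (simp add: wedge_sharp_def wedge2_def covector_linear[of \<beta>] mult.commute)

lemma bracket_uminus_right: "X \<in> \<Gamma> \<Longrightarrow> Y \<in> \<Gamma> \<Longrightarrow> br X (- Y) = - br X Y"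
  using bracket_const_right[of X Y "- 1"] by (simp only: smult_minus_one)

lemma bracket_uminus_left: "X \<in> \<Gamma> \<Longrightarrow> Y \<in> \<Gamma> \<Longrightarrow> br (- X) Y = - br X Y"
  using bracket_const_left[of X Y "- 1"] by (simp only: smult_minus_one)

lemma covector_bracket_smult:
  assumes \<gamma>: "\<gamma> \<in> covectors A" and X: "X \<in> \<Gamma>" and Y: "Y \<in> \<Gamma>" and f: "f \<in> F" and g: "g \<in> F"
  shows "\<gamma> [br (smult f X) (smult g Y)] p =
    f p * g p * \<gamma> [br X Y] p + f p * \<rho> X g p * \<gamma> [Y] p - g p * \<rho> Y f p * \<gamma> [X] p"
proof -
  have "br (smult f X) (smult g Y) =
      smult g (smult f (br X Y) - smult (\<rho> Y f) X) + smult (f * \<rho> X g) Y"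
    using leibniz[OF section_smult[OF f X] Y g] bracket_smult_left[OF X Y f] anchor_smult[OF X g f]
    by simp
  then show ?thesis
    using X Y f g by (simp add: covector_linear[OF \<gamma>] algebra_simps)
qed

lemma bracket_diff_right: "X \<in> \<Gamma> \<Longrightarrow> Y \<in> \<Gamma> \<Longrightarrow> Z \<in> \<Gamma> \<Longrightarrow> br X (Y - Z) = br X Y - br X Z"
  unfolding diff_conv_add_uminus
  by (simp only: bracket_add_right section_uminus bracket_uminus_right)

lemma bracket_diff_left: "X \<in> \<Gamma> \<Longrightarrow> Y \<in> \<Gamma> \<Longrightarrow> Z \<in> \<Gamma> \<Longrightarrow> br (Y - Z) X = br Y X - br Z X"
  unfolding diff_conv_add_uminus
  by (simp only: bracket_add_left section_uminus bracket_uminus_left)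

lemma covector_bracket_diff:
  assumes \<gamma>: "\<gamma> \<in> covectors A" and s: "U \<in> \<Gamma>" "V \<in> \<Gamma>" "W \<in> \<Gamma>" "T \<in> \<Gamma>"
  shows "\<gamma> [br (U - V) (W - T)] p = \<gamma> [br U W] p - \<gamma> [br U T] p - \<gamma> [br V W] p + \<gamma> [br V T] p"
  using s
  by (simp only: bracket_diff_left bracket_diff_right section_diff bracket_section
      covector_diff[OF \<gamma>] minus_apply)

lemma covector_bracket_wedge_sharp:
  assumes \<alpha>: "\<alpha> \<in> covectors A" and \<beta>: "\<beta> \<in> covectors A" and \<gamma>: "\<gamma> \<in> covectors A"
    and X: "X1 \<in> \<Gamma>" "X2 \<in> \<Gamma>" and Y: "Y1 \<in> \<Gamma>" "Y2 \<in> \<Gamma>"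
  shows "\<gamma> [br (wedge_sharp X1 X2 \<alpha>) (wedge_sharp Y1 Y2 \<beta>)] p =
    (\<alpha> [X1] p * \<beta> [Y1] p * \<gamma> [br X2 Y2] p + \<alpha> [X1] p * \<rho> X2 (\<beta> [Y1]) p * \<gamma> [Y2] p
      - \<beta> [Y1] p * \<rho> Y2 (\<alpha> [X1]) p * \<gamma> [X2] p)
    - (\<alpha> [X1] p * \<beta> [Y2] p * \<gamma> [br X2 Y1] p + \<alpha> [X1] p * \<rho> X2 (\<beta> [Y2]) p * \<gamma> [Y1] p
      - \<beta> [Y2] p * \<rho> Y1 (\<alpha> [X1]) p * \<gamma> [X2] p)
    - (\<alpha> [X2] p * \<beta> [Y1] p * \<gamma> [br X1 Y2] p + \<alpha> [X2] p * \<rho> X1 (\<beta> [Y1]) p * \<gamma> [Y2] p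
      - \<beta> [Y1] p * \<rho> Y2 (\<alpha> [X2]) p * \<gamma> [X1] p)
    + (\<alpha> [X2] p * \<beta> [Y2] p * \<gamma> [br X1 Y1] p + \<alpha> [X2] p * \<rho> X1 (\<beta> [Y2]) p * \<gamma> [Y1] p
      - \<beta> [Y2] p * \<rho> Y1 (\<alpha> [X2]) p * \<gamma> [X1] p)"
  unfolding wedge_sharp_def
  using \<alpha> \<beta> X Y
  by (simp only: covector_bracket_diff[OF \<gamma>] covector_bracket_smult[OF \<gamma>] section_smult
      covector_smooth[OF \<alpha>] covector_smooth[OF \<beta>])

lemma anchor_wedge_sharp_wedge2:
  assumes \<alpha>: "\<alpha> \<in> covectors A" and \<beta>: "\<beta> \<in> covectors A" and \<gamma>: "\<gamma> \<in> covectors A"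
    and X: "X1 \<in> \<Gamma>" "X2 \<in> \<Gamma>"
  shows "\<rho> (wedge_sharp X1 X2 \<alpha>) (wedge2 Y1 Y2 \<beta> \<gamma>) p =
    \<alpha> [X1] p * (\<beta> [Y1] p * \<rho> X2 (\<gamma> [Y2]) p + \<gamma> [Y2] p * \<rho> X2 (\<beta> [Y1]) p
      - \<beta> [Y2] p * \<rho> X2 (\<gamma> [Y1]) p - \<gamma> [Y1] p * \<rho> X2 (\<beta> [Y2]) p)
    - \<alpha> [X2] p * (\<beta> [Y1] p * \<rho> X1 (\<gamma> [Y2]) p + \<gamma> [Y2] p * \<rho> X1 (\<beta> [Y1]) p
      - \<beta> [Y2] p * \<rho> X1 (\<gamma> [Y1]) p - \<gamma> [Y1] p * \<rho> X1 (\<beta> [Y2]) p)"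
proof -
  have w: "\<rho> X (wedge2 Y1 Y2 \<beta> \<gamma>) p = \<beta> [Y1] p * \<rho> X (\<gamma> [Y2]) p + \<gamma> [Y2] p * \<rho> X (\<beta> [Y1]) p
      - \<beta> [Y2] p * \<rho> X (\<gamma> [Y1]) p - \<gamma> [Y1] p * \<rho> X (\<beta> [Y2]) p" if "X \<in> \<Gamma>" for X
    using that covector_smooth[OF \<beta>] covector_smooth[OF \<gamma>]
    by (simp add: wedge2_def anchor_fun_diff anchor_fun_mult)
  have "\<rho> (wedge_sharp X1 X2 \<alpha>) f p = \<alpha> [X1] p * \<rho> X2 f p - \<alpha> [X2] p * \<rho> X1 f p" if "f \<in> F" for f
    using X that covector_smooth[OF \<alpha>]
    by (simp add: wedge_sharp_def anchor_diff anchor_smult)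
  then show ?thesis using w X \<beta> \<gamma> by simp
qed

text \<open>
  The left-hand side of the cyclic identity is quadratic in \<open>\<pi>\<close>. Here the first occurrence of \<open>\<pi>\<close> in
  each term is \<open>X\<^sub>1 \<and> X\<^sub>2\<close> and the second is \<open>Y\<^sub>1 \<and> Y\<^sub>2\<close>.
\<close>

definition cyclic_expr ::
    "('m \<Rightarrow> 'v) \<times> ('m \<Rightarrow> 'v) \<Rightarrow> ('m \<Rightarrow> 'v) \<times> ('m \<Rightarrow> 'v)
      \<Rightarrow> ('m, 'v) form \<Rightarrow> ('m, 'v) form \<Rightarrow> ('m, 'v) form \<Rightarrow> 'm \<Rightarrow> real" where
  "cyclic_expr = (\<lambda>(X1, X2) (Y1, Y2) \<alpha> \<beta> \<gamma> p.
     \<gamma> [br (wedge_sharp X1 X2 \<alpha>) (wedge_sharp Y1 Y2 \<beta>)] p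
     + \<beta> [br (wedge_sharp X1 X2 \<gamma>) (wedge_sharp Y1 Y2 \<alpha>)] p
     + \<alpha> [br (wedge_sharp X1 X2 \<beta>) (wedge_sharp Y1 Y2 \<gamma>)] p
     - \<rho> (wedge_sharp X1 X2 \<alpha>) (wedge2 Y1 Y2 \<beta> \<gamma>) p
     - \<rho> (wedge_sharp X1 X2 \<beta>) (wedge2 Y1 Y2 \<gamma> \<alpha>) p
     - \<rho> (wedge_sharp X1 X2 \<gamma>) (wedge2 Y1 Y2 \<alpha> \<beta>) p)"

text \<open>
  A single \<open>cyclic_expr\<close> is not tensorial; its derivative terms cancel against those of the
  transposed one.
\<close>

lemma cyclic_expr_symmetrised:
  assumes \<alpha>: "\<alpha> \<in> covectors A" and \<beta>: "\<beta> \<in> covectors A" and \<gamma>: "\<gamma> \<in> covectors A"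
    and X: "X1 \<in> \<Gamma>" "X2 \<in> \<Gamma>" and Y: "Y1 \<in> \<Gamma>" "Y2 \<in> \<Gamma>"
  shows "cyclic_expr (X1, X2) (Y1, Y2) \<alpha> \<beta> \<gamma> p + cyclic_expr (Y1, Y2) (X1, X2) \<alpha> \<beta> \<gamma> p
    = schouten_decomposable A (X1, X2) (Y1, Y2) \<alpha> \<beta> \<gamma> p"
proof -
  have skew: "\<delta> [br Y1 X1] p = - \<delta> [br X1 Y1] p" "\<delta> [br Y1 X2] p = - \<delta> [br X2 Y1] p"
    "\<delta> [br Y2 X1] p = - \<delta> [br X1 Y2] p" "\<delta> [br Y2 X2] p = - \<delta> [br X2 Y2] p"
    if "\<delta> \<in> covectors A" for \<delta>
  proof -
    have "\<delta> [br V U] p = - \<delta> [br U V] p" if "U \<in> \<Gamma>" "V \<in> \<Gamma>" for U V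
      unfolding bracket_skew[OF that(2,1)] using covector_uminus[OF \<open>\<delta> \<in> covectors A\<close>] that by simp
    then show "\<delta> [br Y1 X1] p = - \<delta> [br X1 Y1] p" "\<delta> [br Y1 X2] p = - \<delta> [br X2 Y1] p"
      "\<delta> [br Y2 X1] p = - \<delta> [br X1 Y2] p" "\<delta> [br Y2 X2] p = - \<delta> [br X2 Y2] p"
      using X Y by blast+
  qed
  note skews = skew[OF \<alpha>] skew[OF \<beta>] skew[OF \<gamma>]
  have lhs: "cyclic_expr (U1, U2) (V1, V2) \<alpha> \<beta> \<gamma> p =
     \<gamma> [br (wedge_sharp U1 U2 \<alpha>) (wedge_sharp V1 V2 \<beta>)] p
     + \<beta> [br (wedge_sharp U1 U2 \<gamma>) (wedge_sharp V1 V2 \<alpha>)] p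
     + \<alpha> [br (wedge_sharp U1 U2 \<beta>) (wedge_sharp V1 V2 \<gamma>)] p
     - \<rho> (wedge_sharp U1 U2 \<alpha>) (wedge2 V1 V2 \<beta> \<gamma>) p
     - \<rho> (wedge_sharp U1 U2 \<beta>) (wedge2 V1 V2 \<gamma> \<alpha>) p
     - \<rho> (wedge_sharp U1 U2 \<gamma>) (wedge2 V1 V2 \<alpha> \<beta>) p" for U1 U2 V1 V2
    by (simp only: cyclic_expr_def prod.case)
  show ?thesis
    unfolding lhs
      covector_bracket_wedge_sharp[OF \<alpha> \<beta> \<gamma> X Y] covector_bracket_wedge_sharp[OF \<gamma> \<alpha> \<beta> X Y]
      covector_bracket_wedge_sharp[OF \<beta> \<gamma> \<alpha> X Y] covector_bracket_wedge_sharp[OF \<alpha> \<beta> \<gamma> Y X]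
      covector_bracket_wedge_sharp[OF \<gamma> \<alpha> \<beta> Y X] covector_bracket_wedge_sharp[OF \<beta> \<gamma> \<alpha> Y X]
      anchor_wedge_sharp_wedge2[OF \<alpha> \<beta> \<gamma> X] anchor_wedge_sharp_wedge2[OF \<beta> \<gamma> \<alpha> X]
      anchor_wedge_sharp_wedge2[OF \<gamma> \<alpha> \<beta> X] anchor_wedge_sharp_wedge2[OF \<alpha> \<beta> \<gamma> Y]
      anchor_wedge_sharp_wedge2[OF \<beta> \<gamma> \<alpha> Y] anchor_wedge_sharp_wedge2[OF \<gamma> \<alpha> \<beta> Y]
    unfolding skews schouten_decomposable_def prod.case wedge3_def wedge2_def
      plus_fun_apply times_fun_apply minus_apply
    by (simp only: ring_distribs minus_mult_left[symmetric] minus_mult_right[symmetric] mult_ac)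
qed

lemma covector_bracket_sums:
  assumes \<gamma>: "\<gamma> \<in> covectors A" and a: "\<And>i. i < n \<Longrightarrow> a i \<in> \<Gamma>" and b: "\<And>i. i < n \<Longrightarrow> b i \<in> \<Gamma>"
  shows "\<gamma> [br (\<Sum>i<(n::nat). a i) (\<Sum>j<n. b j)] p = (\<Sum>i<n. \<Sum>j<n. \<gamma> [br (a i) (b j)] p)"
proof -
  have s: "(\<Sum>i<k. a i) \<in> \<Gamma>" "(\<Sum>i<k. b i) \<in> \<Gamma>" if "k \<le> n" for k
    by (rule section_sum, use a b that in simp)+
  have r: "\<gamma> [br U (\<Sum>j<k. b j)] p = (\<Sum>j<k. \<gamma> [br U (b j)] p)" if "U \<in> \<Gamma>" "k \<le> n" for U k
    using that(2)
  proof (induction k)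
    case 0
    show ?case
      unfolding lessThan_0 sum.empty bracket_zero_right[OF that(1)] covector_zero[OF \<gamma>]
      by (rule zero_fun_apply)
  next
    case (Suc k)
    then have k: "k \<le> n" "k < n" by simp_all
    have "\<gamma> [br U ((\<Sum>j<k. b j) + b k)] = \<gamma> [br U (\<Sum>j<k. b j)] + \<gamma> [br U (b k)]"
      using that s(2)[OF k(1)] b[OF k(2)]
      by (simp only: bracket_add_right covector_add[OF \<gamma>] bracket_section)
    note E = this
    show ?case
      unfolding sum.lessThan_Suc E Suc.IH[OF k(1), symmetric] by (rule plus_fun_apply)
  qed
  have "\<gamma> [br (\<Sum>i<k. a i) (\<Sum>j<n. b j)] p = (\<Sum>i<k. \<gamma> [br (a i) (\<Sum>j<n. b j)] p)" if "k \<le> n" for k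
    using that
  proof (induction k)
    case 0
    show ?case
      unfolding lessThan_0 sum.empty bracket_zero_left[OF s(2)[OF order_refl]] covector_zero[OF \<gamma>]
      by (rule zero_fun_apply)
  next
    case (Suc k)
    then have k: "k \<le> n" "k < n" by simp_all
    have E: "\<gamma> [br ((\<Sum>i<k. a i) + a k) (\<Sum>j<n. b j)] =
        \<gamma> [br (\<Sum>i<k. a i) (\<Sum>j<n. b j)] + \<gamma> [br (a k) (\<Sum>j<n. b j)]"
      using s(1)[OF k(1)] s(2)[OF order_refl] a[OF k(2)]
      by (simp only: bracket_add_left covector_add[OF \<gamma>] bracket_section)
    show ?case
      unfolding sum.lessThan_Suc[of a] sum.lessThan_Suc[of "\<lambda>i. \<gamma> [br (a i) (\<Sum>j<n. b j)] p"]
        E Suc.IH[OF k(1), symmetric]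
      by (rule plus_fun_apply)
  qed
  from this[of n] show ?thesis using r[of _ n] a by simp
qed

lemma anchor_sums:
  assumes a: "\<And>i. i < n \<Longrightarrow> a i \<in> \<Gamma>" and f: "\<And>i. i < n \<Longrightarrow> f i \<in> F"
  shows "\<rho> (\<Sum>i<(n::nat). a i) (\<Sum>j<n. f j) p = (\<Sum>i<n. \<Sum>j<n. \<rho> (a i) (f j) p)"
proof -
  have s: "(\<Sum>i<k. a i) \<in> \<Gamma>" "(\<Sum>i<k. f i) \<in> F" if "k \<le> n" for k
    by (rule section_sum F_sum, use a f that in simp)+
  have z: "\<rho> 0 g p = 0" if "g \<in> F" for g
    using anchor_add[OF section_zero section_zero that] by (simp add: fun_eq_iff)
  have r: "\<rho> U (\<Sum>j<k. f j) p = (\<Sum>j<k. \<rho> U (f j) p)" if "U \<in> \<Gamma>" "k \<le> n" for U k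
    using that(2)
  proof (induction k)
    case 0
    show ?case
      unfolding lessThan_0 sum.empty anchor_fun_zero[OF that(1)] by (rule zero_fun_apply)
  next
    case (Suc k)
    then have k: "k \<le> n" "k < n" by simp_all
    show ?case
      unfolding sum.lessThan_Suc anchor_fun_add[OF that(1) s(2)[OF k(1)] f[OF k(2)]]
        Suc.IH[OF k(1), symmetric]
      by (rule plus_fun_apply)
  qed
  have "\<rho> (\<Sum>i<k. a i) (\<Sum>j<n. f j) p = (\<Sum>i<k. \<rho> (a i) (\<Sum>j<n. f j) p)" if "k \<le> n" for k
    using that
  proof (induction k)
    case 0
    show ?case
      unfolding lessThan_0 sum.empty z[OF s(2)[OF order_refl]] ..
  next
    case (Suc k)
    then have k: "k \<le> n" "k < n" by simp_all
    show ?case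
      unfolding sum.lessThan_Suc[of a] sum.lessThan_Suc[of "\<lambda>i. \<rho> (a i) (\<Sum>j<n. f j) p"]
        anchor_add[OF s(1)[OF k(1)] a[OF k(2)] s(2)[OF order_refl]] Suc.IH[OF k(1), symmetric]
      by (rule plus_fun_apply)
  qed
  from this[of n] show ?thesis using r[of _ n] a by simp
qed

text \<open>
  The decomposition of \<open>\<pi>\<close> holds only on \<open>U\<close>; with the covectors multiplied by a bump function
  supported in \<open>U\<close> it holds everywhere, so that the brackets can be expanded. At the point in
  question the multiplication changes nothing, since the Schouten bracket is tensorial.
\<close>

lemma sharp_morphism_imp_poisson:
  assumes P: "P \<in> bivectors A"
    and mor: "\<And>\<alpha> \<beta>. \<alpha> \<in> covectors A \<Longrightarrow> \<beta> \<in> covectors A \<Longrightarrow>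
      br (sharp A P \<alpha>) (sharp A P \<beta>) = sharp A P (bracket_pi A P \<alpha> \<beta>)"
  shows "poisson A P"
  unfolding poisson_def is_schouten_def
proof (intro conjI allI P)
  fix p
  show "\<exists>U xs ys. open U \<and> p \<in> U \<and> decomposes_on A U P xs \<and> decomposes_on A U P ys \<and>
      (\<forall>\<alpha>\<in>covectors A. \<forall>\<beta>\<in>covectors A. \<forall>\<gamma>\<in>covectors A. \<forall>q\<in>U.
        0 \<alpha> \<beta> \<gamma> q = (\<Sum>x\<leftarrow>xs. \<Sum>y\<leftarrow>ys. schouten_decomposable A x y \<alpha> \<beta> \<gamma> q))"
  proof (rule bivector_decomposes_locally[OF P, of p])
    fix U X Y and n :: nat
    assume U: "open U" "p \<in> U" and X: "\<And>i. i < n \<Longrightarrow> X i \<in> \<Gamma>" and Y: "\<And>i. i < n \<Longrightarrow> Y i \<in> \<Gamma>"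
      and dec: "\<And>\<alpha> \<beta> q. \<alpha> \<in> covectors A \<Longrightarrow> \<beta> \<in> covectors A \<Longrightarrow> q \<in> U \<Longrightarrow>
        P \<alpha> \<beta> q = (\<Sum>i<n. wedge2 (X i) (Y i) \<alpha> \<beta> q)"
    define xs where "xs = map (\<lambda>i. (X i, Y i)) [0..<n]"
    have list_sum: "(\<Sum>x\<leftarrow>xs. g x) = (\<Sum>i<n. g (X i, Y i))" for g :: "_ \<Rightarrow> real"
      unfolding xs_def map_map comp_def
      by (simp add: interv_sum_list_conv_sum_set_nat atLeast0LessThan)
    have "decomposes_on A U P xs"
      unfolding decomposes_on_def list_sum using dec X Y by (auto simp: xs_def)
    moreover have "(\<Sum>x\<leftarrow>xs. \<Sum>y\<leftarrow>xs. schouten_decomposable A x y \<alpha> \<beta> \<gamma> q) = 0"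
      if \<alpha>: "\<alpha> \<in> covectors A" and \<beta>: "\<beta> \<in> covectors A" and \<gamma>: "\<gamma> \<in> covectors A" and q: "q \<in> U"
      for \<alpha> \<beta> \<gamma> q
    proof -
      obtain h W K where h: "h \<in> F" "q \<in> W" "K \<subseteq> U" "\<And>r. r \<in> W \<Longrightarrow> h r = 1" "\<And>r. r \<notin> K \<Longrightarrow> h r = 0"
        using bump[OF U(1) q] by metis
      define cut where "cut \<delta> = smult_form h \<delta>" for \<delta> :: "('m, 'v) form"
      have cut: "cut \<delta> \<in> covectors A" if "\<delta> \<in> covectors A" for \<delta>
        using that h(1) by (simp add: cut_def)
      have cut_q: "cut \<delta> Xs q = \<delta> Xs q" for \<delta> Xs
        using h(2,4) by (simp add: cut_def smult_form_def)
      have P_cut: "P (cut \<delta>) \<epsilon> = (\<Sum>i<n. wedge2 (X i) (Y i) (cut \<delta>) \<epsilon>)"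
        if \<delta>: "\<delta> \<in> covectors A" and \<epsilon>: "\<epsilon> \<in> covectors A" for \<delta> \<epsilon>
      proof
        fix r
        show "P (cut \<delta>) \<epsilon> r = (\<Sum>i<n. wedge2 (X i) (Y i) (cut \<delta>) \<epsilon>) r"
        proof (cases "r \<in> U")
          case True
          then show ?thesis using dec[OF cut[OF \<delta>] \<epsilon>] by (simp add: sum_fun_apply)
        next
          case False
          then have "h r = 0" using h(3,5) by blast
          then show ?thesis
            unfolding cut_def bivectorD(5)[OF P \<delta> \<epsilon> h(1)]
            by (simp add: sum_fun_apply wedge2_def smult_form_def)
        qed
      qed
      let ?s = "\<lambda>\<delta> i. wedge_sharp (X i) (Y i) (cut \<delta>)"
      let ?w = "\<lambda>\<delta> \<epsilon> i. wedge2 (X i) (Y i) (cut \<delta>) (cut \<epsilon>)"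
      have sec: "?s \<delta> i \<in> \<Gamma>" if "\<delta> \<in> covectors A" "i < n" for \<delta> i
        using cut X Y that by simp
      have wF: "?w \<delta> \<epsilon> i \<in> F" if "\<delta> \<in> covectors A" "\<epsilon> \<in> covectors A" for \<delta> \<epsilon> i
        using cut that by simp
      have sharp_cut: "sharp A P (cut \<delta>) = (\<Sum>i<n. ?s \<delta> i)" if \<delta>: "\<delta> \<in> covectors A" for \<delta>
      proof (rule sharp_eqI[OF P cut[OF \<delta>]])
        show "(\<Sum>i<n. ?s \<delta> i) \<in> \<Gamma>" by (rule section_sum) (use sec \<delta> in simp)
        fix \<epsilon> assume \<epsilon>: "\<epsilon> \<in> covectors A"
        have "\<epsilon> [\<Sum>i<n. ?s \<delta> i] = (\<Sum>i<n. \<epsilon> [?s \<delta> i])"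
          by (rule covector_sum[OF \<epsilon>]) (use sec \<delta> in auto)
        also have "\<dots> = P (cut \<delta>) \<epsilon>"
          unfolding P_cut[OF \<delta> \<epsilon>]
          by (rule sum.cong[OF refl], rule covector_wedge_sharp) (use cut[OF \<delta>] \<epsilon> X Y in auto)
        finally show "\<epsilon> [\<Sum>i<n. ?s \<delta> i] = P (cut \<delta>) \<epsilon>" .
      qed
      note c = cut[OF \<alpha>] cut[OF \<beta>] cut[OF \<gamma>]
      let ?T = "\<lambda>i j. cyclic_expr (X i, Y i) (X j, Y j) (cut \<alpha>) (cut \<beta>) (cut \<gamma>) q"
      have br_sums: "\<delta> [br (\<Sum>i<n. ?s \<epsilon> i) (\<Sum>j<n. ?s \<zeta> j)] q = (\<Sum>i<n. \<Sum>j<n. \<delta> [br (?s \<epsilon> i) (?s \<zeta> j)] q)"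
        if "\<delta> \<in> covectors A" "\<epsilon> \<in> covectors A" "\<zeta> \<in> covectors A" for \<delta> \<epsilon> \<zeta>
        by (rule covector_bracket_sums[OF that(1) sec[OF that(2)] sec[OF that(3)]])
      have an_sums: "\<rho> (\<Sum>i<n. ?s \<delta> i) (\<Sum>j<n. ?w \<epsilon> \<zeta> j) q = (\<Sum>i<n. \<Sum>j<n. \<rho> (?s \<delta> i) (?w \<epsilon> \<zeta> j) q)"
        if "\<delta> \<in> covectors A" "\<epsilon> \<in> covectors A" "\<zeta> \<in> covectors A" for \<delta> \<epsilon> \<zeta>
        by (rule anchor_sums[OF sec[OF that(1)] wF[OF that(2,3)]])
      have "(\<Sum>i<n. \<Sum>j<n. ?T i j) = 0"
        using sharp_morphism_imp_cyclic_identity[OF P c refl refl refl mor[OF c(1,2)], of q]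
        unfolding sharp_cut[OF \<alpha>] sharp_cut[OF \<beta>] sharp_cut[OF \<gamma>]
          P_cut[OF \<beta> c(3)] P_cut[OF \<gamma> c(1)] P_cut[OF \<alpha> c(2)]
          br_sums[OF c(3) \<alpha> \<beta>] br_sums[OF c(2) \<gamma> \<alpha>] br_sums[OF c(1) \<beta> \<gamma>]
          an_sums[OF \<alpha> \<beta> \<gamma>] an_sums[OF \<beta> \<gamma> \<alpha>] an_sums[OF \<gamma> \<alpha> \<beta>]
        by (simp only: cyclic_expr_def prod.case sum.distrib sum_subtractf)
      moreover have "(\<Sum>i<n. \<Sum>j<n. ?T j i) = (\<Sum>i<n. \<Sum>j<n. ?T i j)"
        by (rule sum.swap)
      ultimately have "0 = (\<Sum>i<n. \<Sum>j<n. ?T i j + ?T j i)"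
        by (simp only: sum.distrib add_0)
      also have "\<dots> = (\<Sum>i<n. \<Sum>j<n. schouten_decomposable A (X i, Y i) (X j, Y j) \<alpha> \<beta> \<gamma> q)"
      proof (intro sum.cong refl)
        fix i j assume "i \<in> {..<n}" "j \<in> {..<n}"
        then have "?T i j + ?T j i
            = schouten_decomposable A (X i, Y i) (X j, Y j) (cut \<alpha>) (cut \<beta>) (cut \<gamma>) q"
          by (intro cyclic_expr_symmetrised c) (use X Y in auto)
        then show "?T i j + ?T j i = schouten_decomposable A (X i, Y i) (X j, Y j) \<alpha> \<beta> \<gamma> q"
          by (simp add: schouten_decomposable_def wedge3_def wedge2_def cut_q)
      qed
      finally show ?thesis by (simp only: list_sum)
    qed
    ultimately show ?thesis
      using U by (intro exI[of _ U] exI[of _ xs]) simp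
  qed
qed

section \<open>The components of \<open>J\<^sup>2\<close> and of the torsion of \<open>J\<close>\<close>

lemma form2_skew_apply:
  assumes "\<eta> \<in> forms A 2" "X \<in> \<Gamma>" "Y \<in> \<Gamma>" shows "\<eta> [X, Y] p = - \<eta> [Y, X] p"
  unfolding form2_skew[OF assms] by simp

lemma flat_eq_ins: "flat \<sigma> X = ins X \<sigma>"
  by (simp add: flat_def ins_def)

lemma flat_covector [simp]: "\<sigma> \<in> forms A 2 \<Longrightarrow> X \<in> \<Gamma> \<Longrightarrow> flat \<sigma> X \<in> covectors A"
  by (simp add: flat_eq_ins)

lemma flat_eval: "flat \<sigma> X [Z] = \<sigma> [X, Z]"
  by (simp add: flat_def)

lemma ins_0: "ins X 0 = 0"
  by (intro ext) (simp add: ins_def)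

lemma lie_0: "lie A X 0 = 0"
  unfolding lie_def ins_0 d_zero by (rule add_0)

lemma lie_zero_section: "\<beta> \<in> covectors A \<Longrightarrow> lie A 0 \<beta> = 0"
  unfolding lie_def using ins_zero_section[of \<beta> 1] ins_zero_section[of "d A \<beta>" 2]
  by (simp only: d_covector_form2 d_zero add_0)

lemma ins2_zero_left: "ins2 0 X \<eta> = 0" if "\<eta> \<in> forms A 3" "X \<in> \<Gamma>"
proof (rule supported1_eqI)
  have c: "ins2 0 X \<eta> \<in> covectors A" using that by simp
  show "supported 1 (ins2 0 X \<eta>)" by (rule form_supported[OF c])
  show "ins2 0 X \<eta> [Z] p = 0 [Z] p" if Z: "Z \<in> \<Gamma>" for Z p
    using form3_swap(1)[OF \<open>\<eta> \<in> forms A 3\<close> section_zero \<open>X \<in> \<Gamma>\<close> Z, of p]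
      ins_zero_section[OF \<open>\<eta> \<in> forms A 3\<close>]
    by (simp add: ins2_def ins_def fun_eq_iff)
qed simp

lemma ins2_zero_right: "\<eta> \<in> forms A 3 \<Longrightarrow> ins2 X 0 \<eta> = 0"
  unfolding ins2_def by (simp only: ins_zero_section ins_0)

lemma sharp_uminus:
  assumes P: "P \<in> bivectors A" and \<alpha>: "\<alpha> \<in> covectors A"
  shows "sharp A P (- \<alpha>) = - sharp A P \<alpha>"
proof -
  have "sharp A P \<alpha> + sharp A P (- \<alpha>) = 0"
    using sharp_add[OF P \<alpha> form_uminus_covector[OF \<alpha>]] sharp_0[OF P] by (simp only: right_minus)
  then show ?thesis by (metis minus_unique)
qed

lemma endo:
  assumes "N \<in> endomorphisms A"
  shows endo_section: "X \<in> \<Gamma> \<Longrightarrow> N X \<in> \<Gamma>"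
    and endo_add: "X \<in> \<Gamma> \<Longrightarrow> Y \<in> \<Gamma> \<Longrightarrow> N (X + Y) = N X + N Y"
    and endo_smult: "X \<in> \<Gamma> \<Longrightarrow> f \<in> F \<Longrightarrow> N (smult f X) = smult f (N X)"
  using assms unfolding endomorphisms_def by blast+

lemma endo_zero: "N \<in> endomorphisms A \<Longrightarrow> N 0 = 0"
  using endo_smult[of N 0 0] by (simp only: smult_zero section_zero F_zero)

lemma endo_uminus: "N \<in> endomorphisms A \<Longrightarrow> X \<in> \<Gamma> \<Longrightarrow> N (- X) = - N X"
  unfolding smult_minus_one[symmetric] by (simp only: endo_smult F_const)

lemma endo_diff: "N \<in> endomorphisms A \<Longrightarrow> X \<in> \<Gamma> \<Longrightarrow> Y \<in> \<Gamma> \<Longrightarrow> N (X - Y) = N X - N Y"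
  unfolding diff_conv_add_uminus by (simp only: endo_add endo_uminus section_uminus)

lemma transp_eval: "X \<in> \<Gamma> \<Longrightarrow> transp A N \<alpha> [X] = \<alpha> [N X]"
  by (simp add: transp_def on_sections_def)

lemma transp_covector [simp]:
  assumes N: "N \<in> endomorphisms A" and \<alpha>: "\<alpha> \<in> covectors A" shows "transp A N \<alpha> \<in> covectors A"
proof (rule covectorI)
  show "transp A N \<alpha> Xs = 0" if "\<not> (\<exists>X\<in>\<Gamma>. Xs = [X])" for Xs
  proof (cases "set Xs \<subseteq> \<Gamma>")
    case True
    then have "length (map N Xs) \<noteq> 1" using that by (auto simp: One_nat_def length_Suc_conv)
    then have "\<alpha> (map N Xs) = 0" by (intro form_outside[OF \<alpha>]) blast
    then show ?thesis by (simp add: transp_def on_sections_def)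
  qed (simp add: transp_def on_sections_def)
  show "transp A N \<alpha> [X] \<in> F" if "X \<in> \<Gamma>" for X
    using that \<alpha> by (simp add: transp_eval)
  show "transp A N \<alpha> [X + Y] = transp A N \<alpha> [X] + transp A N \<alpha> [Y]" if "X \<in> \<Gamma>" "Y \<in> \<Gamma>" for X Y
    using that
    by (simp only: transp_eval section_add endo_add[OF N] covector_add[OF \<alpha>] endo_section[OF N])
  show "transp A N \<alpha> [smult f X] = f * transp A N \<alpha> [X]" if "X \<in> \<Gamma>" "f \<in> F" for X f
    using that
    by (simp only: transp_eval section_smult endo_smult[OF N] covector_smult[OF \<alpha>] endo_section[OF N])
qed

lemma transp_0: "transp A N 0 = 0"
  by (rule ext) (simp add: transp_def on_sections_def)

lemma transp_uminus: "transp A N (- \<alpha>) = - transp A N \<alpha>"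
  by (rule ext) (simp add: transp_def on_sections_def)

lemma ins_end_covector:
  assumes N: "N \<in> endomorphisms A" and \<alpha>: "\<alpha> \<in> covectors A"
  shows "ins_end A N \<alpha> = transp A N \<alpha>"
proof (rule supported1_eqI)
  show "supported 1 (ins_end A N \<alpha>)" by (rule supported_ins_end[OF form_supported[OF \<alpha>]])
  show "supported 1 (transp A N \<alpha>)" by (rule form_supported[OF transp_covector[OF N \<alpha>]])
  show "ins_end A N \<alpha> [Z] p = transp A N \<alpha> [Z] p" if "Z \<in> \<Gamma>" for Z p
    using that by (simp add: transp_eval ins_end_def on_sections_def)
qed

lemma J_of_pair: "J_of A P N \<sigma> (X, \<alpha>) = (N X + sharp A P \<alpha>, flat \<sigma> X - transp A N \<alpha>)"
  by (simp add: J_of_def)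

lemma dorfman_pair: "dorfman A H (X, \<alpha>) (Y, \<beta>) =
    (br X Y, lie A X \<beta> - ins Y (d A \<alpha>) + ins2 X Y H)"
  by (simp add: dorfman_def)

lemma J_of_section:
  assumes "P \<in> bivectors A"
  shows "J_of A P N \<sigma> (X, 0) = (N X, flat \<sigma> X)"
  unfolding J_of_pair sharp_0[OF assms] transp_0 by (simp only: add_0_right diff_zero)

lemma J_of_covector:
  assumes "N \<in> endomorphisms A" "\<sigma> \<in> forms A 2"
  shows "J_of A P N \<sigma> (0, \<alpha>) = (sharp A P \<alpha>, - transp A N \<alpha>)"
  unfolding J_of_pair endo_zero[OF assms(1)] flat_eq_ins ins_zero_section[OF assms(2)]
  by (simp only: add_0 diff_0)

subsection \<open>Consequences of \<open>J\<^sup>2 = \<lambda>\<close>\<close>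

context
  fixes P N \<sigma> l
  assumes P: "P \<in> bivectors A" and N: "N \<in> endomorphisms A" and \<sigma>: "\<sigma> \<in> forms A 2"
    and JJ: "\<And>u. u \<in> dsections A \<Longrightarrow> J_of A P N \<sigma> (J_of A P N \<sigma> u) = smult_dsection (\<lambda>_. l) u"
begin

lemma square_endo_sharp: "\<alpha> \<in> covectors A \<Longrightarrow> N (sharp A P \<alpha>) = sharp A P (transp A N \<alpha>)"
proof -
  assume \<alpha>: "\<alpha> \<in> covectors A"
  have "smult (\<lambda>_. l) 0 = (0 :: 'm \<Rightarrow> 'v)" by (rule ext) (simp add: smult_def)
  then have "N (sharp A P \<alpha>) + sharp A P (- transp A N \<alpha>) = 0"
    using JJ[of "(0, \<alpha>)"] \<alpha>
    unfolding J_of_covector[OF N \<sigma>]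
    unfolding J_of_pair smult_dsection_def dsections_def by simp
  then show ?thesis
    unfolding sharp_uminus[OF P transp_covector[OF N \<alpha>]] by (metis add_eq_0_iff2 minus_minus)
qed

lemma square_flat_sharp:
  assumes \<alpha>: "\<alpha> \<in> covectors A" and Z: "Z \<in> \<Gamma>"
  shows "\<sigma> [sharp A P \<alpha>, Z] p + \<alpha> [N (N Z)] p = l * \<alpha> [Z] p"
proof -
  have "flat \<sigma> (sharp A P \<alpha>) - transp A N (- transp A N \<alpha>) = smult_form (\<lambda>_. l) \<alpha>"
    using JJ[of "(0, \<alpha>)"] \<alpha>
    unfolding J_of_covector[OF N \<sigma>]
    unfolding J_of_pair smult_dsection_def dsections_def by simp
  then have "(flat \<sigma> (sharp A P \<alpha>) - transp A N (- transp A N \<alpha>)) [Z] p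
      = smult_form (\<lambda>_. l) \<alpha> [Z] p" by (simp only:)
  then show ?thesis
    using Z endo_section[OF N Z] by (simp add: transp_uminus transp_eval flat_eval smult_form_def)
qed

lemma square_flat_endo:
  assumes X: "X \<in> \<Gamma>" and Z: "Z \<in> \<Gamma>"
  shows "\<sigma> [N X, Z] = \<sigma> [X, N Z]"
proof -
  have "smult_form (\<lambda>_. l) 0 = (0 :: ('m, 'v) form)"
    by (intro ext) (simp add: smult_form_def)
  then have "flat \<sigma> (N X) - transp A N (flat \<sigma> X) = 0"
    using JJ[of "(X, 0)"] X
    unfolding J_of_section[OF P]
    unfolding J_of_pair smult_dsection_def dsections_def by simp
  then have "flat \<sigma> (N X) [Z] = transp A N (flat \<sigma> X) [Z]" by simp
  then show ?thesis using Z by (simp only: transp_eval flat_eval)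
qed

text \<open>This is skew because \<open>\<sigma>\<^sup>\<flat>N = \<^sup>tN\<sigma>\<^sup>\<flat>\<close>.\<close>

definition twisted_form :: "('m, 'v) form" where
  "twisted_form = on_sections A (\<lambda>Xs. case Xs of [X, Y] \<Rightarrow> \<sigma> [N X, Y] | _ \<Rightarrow> 0)"

lemma twisted_form_eval: "X \<in> \<Gamma> \<Longrightarrow> Y \<in> \<Gamma> \<Longrightarrow> twisted_form [X, Y] = \<sigma> [N X, Y]"
  by (simp add: twisted_form_def on_sections_def)

lemma twisted_form_form2: "twisted_form \<in> forms A 2"
proof (rule form2I)
  show "supported 2 twisted_form"
    unfolding supported_def twisted_form_def on_sections_def
    by (auto split: list.split)
  show "twisted_form [X, Y] \<in> F" if "X \<in> \<Gamma>" "Y \<in> \<Gamma>" for X Y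
    using that form_smooth[OF \<sigma>] by (simp add: twisted_form_eval)
  show "twisted_form [X, Y] p = - twisted_form [Y, X] p" if X: "X \<in> \<Gamma>" and Y: "Y \<in> \<Gamma>" for X Y p
    using form2_skew[OF \<sigma> endo_section[OF N X] Y] square_flat_endo[OF Y X]
    by (simp add: twisted_form_eval X Y)
  show "twisted_form [X + X', Y] p = twisted_form [X, Y] p + twisted_form [X', Y] p"
    if "X \<in> \<Gamma>" "X' \<in> \<Gamma>" "Y \<in> \<Gamma>" for X X' Y p
    using form2_linear(1)[OF \<sigma> endo_section[OF N that(1)] endo_section[OF N that(2)] that(3)]
    by (simp add: twisted_form_eval that endo_add[OF N that(1,2)])
  show "twisted_form [smult f X, Y] p = f p * twisted_form [X, Y] p"
    if "X \<in> \<Gamma>" "Y \<in> \<Gamma>" "f \<in> F" for X Y f p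
    using form2_linear(3)[OF \<sigma> endo_section[OF N that(1)] endo_section[OF N that(1)] that(2,3)]
    by (simp add: twisted_form_eval that endo_smult[OF N that(1,3)])
qed

subsection \<open>Consequences of the vanishing of the torsion\<close>

context
  fixes H
  assumes H: "H \<in> forms A 3"
    and T: "\<And>u v. u \<in> dsections A \<Longrightarrow> v \<in> dsections A \<Longrightarrow> courant_torsion A H (J_of A P N \<sigma>) u v = 0"
begin

text \<open>
  The bracket of two covectors is zero, and the two mixed brackets \<open>[a, \<beta>]\<close> and \<open>[\<alpha>, b]\<close> add up to
  \<open>[\<alpha>, \<beta>]\<^sub>\<pi>\<close>, to which the outer \<open>J\<close> is applied.
\<close>

lemma torsion_on_covectors:
  assumes \<alpha>: "\<alpha> \<in> covectors A" and \<beta>: "\<beta> \<in> covectors A"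
    and a: "a = sharp A P \<alpha>" and b: "b = sharp A P \<beta>"
  shows "br a b = sharp A P (bracket_pi A P \<alpha> \<beta>)"
    and "lie A a (- transp A N \<beta>) - ins b (d A (- transp A N \<alpha>)) + ins2 a b H
      + transp A N (bracket_pi A P \<alpha> \<beta>) = 0"
proof -
  have s: "a \<in> \<Gamma>" "b \<in> \<Gamma>" unfolding a b using sharp_section[OF P] \<alpha> \<beta> by auto
  have ta: "- transp A N \<alpha> \<in> covectors A" "- transp A N \<beta> \<in> covectors A"
    using transp_covector[OF N] \<alpha> \<beta> by simp_all
  let ?w = "lie A a \<beta> - ins b (d A \<alpha>)"
  have w: "?w = bracket_pi A P \<alpha> \<beta>"
  proof (rule covector_eqI)
    show "?w \<in> covectors A" using s \<alpha> \<beta> by simp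
    show "bracket_pi A P \<alpha> \<beta> \<in> covectors A" using P \<alpha> \<beta> by simp
    show "?w [Z] = bracket_pi A P \<alpha> \<beta> [Z]" if Z: "Z \<in> \<Gamma>" for Z
    proof
      fix p
      have "\<beta> [a] = P \<alpha> \<beta>" unfolding a by (rule covector_sharp[OF P \<alpha> \<beta>])
      then show "?w [Z] p = bracket_pi A P \<alpha> \<beta> [Z] p"
        unfolding bracket_pi_eval[OF P \<alpha> \<beta> Z, folded a b]
        by (simp add: lie_eval s Z ins_def)
    qed
  qed
  have "courant_torsion A H (J_of A P N \<sigma>) (0, \<alpha>) (0, \<beta>) =
      (br a b - sharp A P ?w,
       lie A a (- transp A N \<beta>) - ins b (d A (- transp A N \<alpha>)) + ins2 a b H + transp A N ?w)"
    unfolding courant_torsion_def J_of_covector[OF N \<sigma>] a[symmetric] b[symmetric] dorfman_pair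
      bracket_zero_left[OF s(2)] bracket_zero_right[OF s(1)] bracket_self[OF section_zero]
      lie_zero_section[OF \<beta>] lie_zero_section[OF ta(2)]
      ins_zero_section[OF d_covector_form2[OF \<alpha>]] ins_zero_section[OF d_covector_form2[OF ta(1)]]
      ins2_zero_right[OF H] ins2_zero_left[OF H s(2)]
    by (simp only: add_Pair diff_Pair diff_zero add_0_right add_0 diff_0_right J_of_covector[OF N \<sigma>]
        sharp_0[OF P] transp_0 minus_zero add_uminus_conv_diff diff_0 diff_minus_eq_add)
  moreover have "courant_torsion A H (J_of A P N \<sigma>) (0, \<alpha>) (0, \<beta>) = 0"
    using \<alpha> \<beta> by (intro T) (simp_all add: dsections_def)
  ultimately have "br a b - sharp A P ?w = 0"
    "lie A a (- transp A N \<beta>) - ins b (d A (- transp A N \<alpha>)) + ins2 a b H + transp A N ?w = 0"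
    by (simp_all add: zero_prod_def)
  then show "br a b = sharp A P (bracket_pi A P \<alpha> \<beta>)"
    "lie A a (- transp A N \<beta>) - ins b (d A (- transp A N \<alpha>)) + ins2 a b H
      + transp A N (bracket_pi A P \<alpha> \<beta>) = 0"
    unfolding w by simp_all
qed

lemma torsion_free_poisson: "poisson A P"
  by (rule sharp_morphism_imp_poisson[OF P torsion_on_covectors(1)[OF _ _ refl refl]])

text \<open>
  Expanded by Cartan's formula, the concomitant is twice
  \<open>\<^sup>tN[\<alpha>, \<beta>]\<^sub>\<pi> - \<L>\<^sub>a(\<^sup>tN\<beta>) + i\<^sub>b d(\<^sup>tN\<alpha>)\<close>, where \<open>a = \<pi>\<^sup>\<sharp>\<alpha>\<close> and \<open>b = \<pi>\<^sup>\<sharp>\<beta>\<close>; the covector part of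
  the torsion evaluates this expression.
\<close>

lemma torsion_free_concomitant:
  assumes \<alpha>: "\<alpha> \<in> covectors A" and \<beta>: "\<beta> \<in> covectors A"
  shows "concomitant A P N \<alpha> \<beta> =
    smult_form (\<lambda>_. - 2) (ins2 (sharp A P \<alpha>) (sharp A P \<beta>) H)"
proof (rule supported1_eqI)
  define a b where a: "a = sharp A P \<alpha>" and b: "b = sharp A P \<beta>"
  define t where "t = transp A N"
  have s: "a \<in> \<Gamma>" "b \<in> \<Gamma>" unfolding a b using sharp_section[OF P] \<alpha> \<beta> by auto
  have tc: "t \<delta> \<in> covectors A" if "\<delta> \<in> covectors A" for \<delta>
    unfolding t_def using transp_covector[OF N that] .
  have te: "t \<delta> [X] = \<delta> [N X]" if "X \<in> \<Gamma>" for \<delta> X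
    unfolding t_def using transp_eval[OF that] .
  have Nab: "N a = sharp A P (t \<alpha>)" "N b = sharp A P (t \<beta>)"
    unfolding a b t_def using square_endo_sharp \<alpha> \<beta> by auto
  let ?B = "bracket_pi A P"
  have fF: "P \<alpha> \<beta> \<in> F" by (rule bivectorD(1)[OF P \<alpha> \<beta>])
  have dN2: "supported 2 (dN A N \<delta>)" if "\<delta> \<in> covectors A" for \<delta>
  proof -
    have "supported 2 (d A \<delta>)" by (rule form_supported[OF d_covector_form2[OF that]])
    moreover have "supported 2 (d A (ins_end A N \<delta>))"
      unfolding ins_end_covector[OF N that]
      by (rule form_supported[OF d_covector_form2[OF transp_covector[OF N that]]])
    ultimately show ?thesis unfolding dN_def by (intro supported_diff supported_ins_end)
  qed
  have dN1: "supported 1 (dN A N (fun_form f))" for f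
    unfolding dN_def
    using supported_d[OF supported_fun_form[of f]]
      supported_d[OF supported_ins_end[OF supported_fun_form[of f]]]
    by (intro supported_diff supported_ins_end) (simp_all add: One_nat_def)
  have lieN1: "supported 1 (lieN A N X \<delta>)" if "\<delta> \<in> covectors A" "X \<in> \<Gamma>" for X \<delta>
    unfolding lieN_def ins_covector[OF that(1)]
    using dN1 supported_ins[of 1 "dN A N \<delta>" X] dN2[OF that(1)] that(2)
    by (intro supported_add) (simp_all add: One_nat_def numeral_2_eq_2)
  show "supported 1 (concomitant A P N \<alpha> \<beta>)"
    unfolding concomitant_def a[symmetric] b[symmetric] t_def[symmetric]
    by (intro supported_diff supported_add lieN1 dN1 \<alpha> \<beta> s form_supported[OF bracket_pi_covector[OF P]]
        form_supported[OF tc[OF bracket_pi_covector[OF P]]] tc)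
  show "supported 1 (smult_form (\<lambda>_. - 2) (ins2 (sharp A P \<alpha>) (sharp A P \<beta>) H))"
    unfolding a[symmetric] b[symmetric]
    by (rule supported_smult_form[OF form_supported[OF ins2_form3[OF H s]]])
  fix Z p assume Z: "Z \<in> \<Gamma>"
  have NZ: "N Z \<in> \<Gamma>" by (rule endo_section[OF N Z])
  have ev: "\<beta> [a] = P \<alpha> \<beta>" "\<alpha> [b] = P \<beta> \<alpha>"
    unfolding a b using covector_sharp[OF P] \<alpha> \<beta> by auto
  have skew: "P \<beta> \<alpha> = - P \<alpha> \<beta>" by (rule bivector_skew[OF P \<beta> \<alpha>])
  \<comment> \<open>The common value of \<open>\<pi>(\<^sup>tN\<alpha>, \<beta>)\<close> and \<open>\<pi>(\<alpha>, \<^sup>tN\<beta>)\<close>.\<close>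
  define g where "g = \<beta> [N a]"
  have g1: "P (t \<alpha>) \<beta> = g"
    unfolding g_def Nab(1) by (rule covector_sharp[OF P tc[OF \<alpha>] \<beta>, symmetric])
  have g3: "t \<beta> [a] = g" unfolding g_def by (rule te[OF s(1)])
  have g2: "P \<alpha> (t \<beta>) = g"
    using covector_sharp[OF P \<alpha> tc[OF \<beta>]] g3 unfolding a by metis
  note g = g1 g2 g3
  have dN_eval: "ins X (dN A N \<delta>) [Z] p = d A \<delta> [N X, Z] p + d A \<delta> [X, N Z] p - d A (t \<delta>) [X, Z] p"
    if "\<delta> \<in> covectors A" "X \<in> \<Gamma>" for \<delta> X
    unfolding dN_def ins_end_covector[OF N that(1)] t_def
    using that Z by (simp add: ins_def ins_end_def on_sections_def lessThan_Suc)
  have dN_fun: "dN A N (fun_form f) [Z] p = \<rho> (N Z) f p" for f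
  proof -
    have "ins_end A N (fun_form f) = 0"
      by (intro ext) (simp add: ins_end_def on_sections_def fun_form_def)
    then have "dN A N (fun_form f) [Z] p = d A (fun_form f) [N Z] p"
      unfolding dN_def using Z by (simp add: d_zero ins_end_def on_sections_def)
    then show ?thesis using NZ by (simp add: d_0 fun_form_def)
  qed
  have lieN_eval: "lieN A N X \<delta> [Z] p = d A \<delta> [N X, Z] p + d A \<delta> [X, N Z] p - d A (t \<delta>) [X, Z] p
      + \<rho> (N Z) (\<delta> [X]) p" if "\<delta> \<in> covectors A" "X \<in> \<Gamma>" for \<delta> X
    unfolding lieN_def ins_covector[OF that(1), of X]
    using dN_eval[OF that] dN_fun by simp
  have "lie A a (- t \<beta>) [Z] p - ins b (d A (- t \<alpha>)) [Z] p + ins2 a b H [Z] p + t (?B \<alpha> \<beta>) [Z] p = 0"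
    using fun_cong[OF fun_cong[OF torsion_on_covectors(2)[OF \<alpha> \<beta> a b]], of "[Z]" p]
    by (simp add: t_def)
  moreover have "lie A a (- t \<beta>) [Z] p = - d A (t \<beta>) [a, Z] p - \<rho> Z g p"
  proof -
    have "d A (- t \<beta>) = - d A (t \<beta>)" by (rule d_uminus[OF form_smooth[OF tc[OF \<beta>]]])
    moreover have "\<rho> Z (- g) p = - \<rho> Z g p"
      using anchor_fun_uminus[OF Z, of g] covector_smooth[OF \<beta>] by (simp add: g_def)
    moreover have "(- t \<beta>) [a] = - g" using g(3) by simp
    ultimately show ?thesis unfolding lie_eval[OF s(1) Z] by simp
  qed
  moreover have "ins b (d A (- t \<alpha>)) [Z] p = - d A (t \<alpha>) [b, Z] p"
    using d_uminus[OF form_smooth[OF tc[OF \<alpha>]]] by (simp add: ins_def)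
  moreover have "t (?B \<alpha> \<beta>) [Z] p = d A \<beta> [a, N Z] p - d A \<alpha> [b, N Z] p + \<rho> (N Z) (P \<alpha> \<beta>) p"
    unfolding te[OF Z] using bracket_pi_eval[OF P \<alpha> \<beta> NZ] by (simp only: a b)
  moreover have "?B (t \<alpha>) \<beta> [Z] p = d A \<beta> [N a, Z] p - d A (t \<alpha>) [b, Z] p + \<rho> Z g p"
    using bracket_pi_eval[OF P tc[OF \<alpha>] \<beta> Z] by (simp only: Nab b g)
  moreover have "?B \<alpha> (t \<beta>) [Z] p = d A (t \<beta>) [a, Z] p - d A \<alpha> [N b, Z] p + \<rho> Z g p"
    using bracket_pi_eval[OF P \<alpha> tc[OF \<beta>] Z] by (simp only: Nab a g)
  moreover have "\<rho> (N Z) (\<alpha> [b]) p = - \<rho> (N Z) (P \<alpha> \<beta>) p"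
    unfolding ev skew using anchor_fun_uminus[OF NZ fF] by simp
  moreover have "concomitant A P N \<alpha> \<beta> [Z] p =
      lieN A N a \<beta> [Z] p - lieN A N b \<alpha> [Z] p - dN A N (fun_form (P \<alpha> \<beta>)) [Z] p
      - (?B (t \<alpha>) \<beta> [Z] p + ?B \<alpha> (t \<beta>) [Z] p - t (?B \<alpha> \<beta>) [Z] p)"
    by (simp only: concomitant_def a b t_def plus_fun_apply minus_apply)
  ultimately have "concomitant A P N \<alpha> \<beta> [Z] p = - 2 * ins2 a b H [Z] p"
    using lieN_eval[OF \<beta> s(1)] lieN_eval[OF \<alpha> s(2)] dN_fun[of "P \<alpha> \<beta>"] ev(1) by (simp only:)
  then show "concomitant A P N \<alpha> \<beta> [Z] p =
      smult_form (\<lambda>_. - 2) (ins2 (sharp A P \<alpha>) (sharp A P \<beta>) H) [Z] p"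
    by (simp add: smult_form_def a b)
qed

text \<open>
  \<open>W + \<omega>\<close> is the element to which the outer \<open>J\<close> is applied. The terms of \<open>\<omega>\<close> that contain \<open>\<sigma>\<close>
  combine by the identity
  \<open>\<L>\<^sub>X(\<sigma>\<^sup>\<flat>Y) - i\<^sub>Y d(\<sigma>\<^sup>\<flat>X) - \<sigma>\<^sup>\<flat>[X, Y] = d\<sigma>(X, Y, \<cdot>)\<close>.
\<close>

lemma torsion_on_sections:
  assumes X: "X \<in> \<Gamma>" and Y: "Y \<in> \<Gamma>"
  defines "h \<equiv> ins2 X Y H"
  defines "W \<equiv> br (N X) Y + br X (N Y) - (N (br X Y) + sharp A P h)"
  obtains \<omega> where "\<omega> \<in> covectors A"
    "\<And>Z p. Z \<in> \<Gamma> \<Longrightarrow> \<omega> [Z] p = d A \<sigma> [X, Y, Z] p + H [Y, N X, Z] p + H [N Y, X, Z] p + h [N Z] p"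
    "br (N X) (N Y) = N W + sharp A P \<omega>"
    "lie A (N X) (flat \<sigma> Y) - ins (N Y) (d A (flat \<sigma> X)) + ins2 (N X) (N Y) H
      - (flat \<sigma> W - transp A N \<omega>) = 0"
proof -
  let ?w = "(- ins Y (d A (flat \<sigma> X)) + ins2 (N X) Y H) + (lie A X (flat \<sigma> Y) + ins2 X (N Y) H)
    - (flat \<sigma> (br X Y) - transp A N h)"
  note NX = endo_section[OF N X] endo_section[OF N Y]
  have h: "h \<in> covectors A" unfolding h_def using H X Y by simp
  have "?w \<in> covectors A"
    using NX X Y H \<sigma> N h by simp
  moreover have "?w [Z] p = d A \<sigma> [X, Y, Z] p + H [Y, N X, Z] p + H [N Y, X, Z] p + h [N Z] p"
    if Z: "Z \<in> \<Gamma>" for Z p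
  proof -
    have "\<sigma> [Y, br X Z] p = - \<sigma> [br X Z, Y] p" "\<sigma> [X, br Y Z] p = - \<sigma> [br Y Z, X] p"
      by (rule form2_skew_apply[OF \<sigma>]; simp add: X Y Z)+
    then show ?thesis
      using X Y Z
      by (simp add: lie_eval d_1 d_2 flat_eval transp_eval ins_def[of Y] ins2_def ins_def)
  qed
  moreover have "br (N X) (N Y) = N W + sharp A P ?w \<and>
    lie A (N X) (flat \<sigma> Y) - ins (N Y) (d A (flat \<sigma> X)) + ins2 (N X) (N Y) H
      - (flat \<sigma> W - transp A N ?w) = 0"
  proof -
    have "courant_torsion A H (J_of A P N \<sigma>) (X, 0) (Y, 0) =
      (br (N X) (N Y) - (N W + sharp A P ?w),
       lie A (N X) (flat \<sigma> Y) - ins (N Y) (d A (flat \<sigma> X)) + ins2 (N X) (N Y) H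
        - (flat \<sigma> W - transp A N ?w))"
      unfolding courant_torsion_def J_of_section[OF P]
      unfolding dorfman_pair J_of_pair lie_0 d_zero ins_0 W_def h_def
      by (simp only: add_Pair diff_Pair diff_0 diff_zero add_0 J_of_pair)
    moreover have "courant_torsion A H (J_of A P N \<sigma>) (X, 0) (Y, 0) = 0"
      using X Y by (intro T) (simp_all add: dsections_def)
    ultimately show ?thesis by (simp add: zero_prod_def)
  qed
  ultimately show thesis using that by blast
qed

text \<open>
  The covector \<open>\<omega>\<close> exceeds the argument of \<open>\<pi>\<^sup>\<sharp>\<close> in the claim by \<open>\<^sup>tN(i\<^bsub>X \<and> Y\<^esub>H)\<close>, whose image
  under \<open>\<pi>\<^sup>\<sharp>\<close> cancels the term \<open>N\<pi>\<^sup>\<sharp>(i\<^bsub>X \<and> Y\<^esub>H)\<close> that comes from \<open>NW\<close>.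
\<close>

lemma torsion_free_endo_torsion:
  assumes X: "X \<in> \<Gamma>" and Y: "Y \<in> \<Gamma>"
  shows "torsion A N X Y = sharp A P (ins2 (N X) Y H - ins2 (N Y) X H + ins2 X Y (- d A \<sigma>))"
    (is "_ = sharp A P ?\<theta>")
proof (rule torsion_on_sections[OF X Y])
  let ?h = "ins2 X Y H"
  fix \<omega> assume \<omega>: "\<omega> \<in> covectors A"
    and ev: "\<And>Z p. Z \<in> \<Gamma> \<Longrightarrow> \<omega> [Z] p =
      d A \<sigma> [X, Y, Z] p + H [Y, N X, Z] p + H [N Y, X, Z] p + ?h [N Z] p"
    and br: "br (N X) (N Y) =
      N (br (N X) Y + br X (N Y) - (N (br X Y) + sharp A P ?h)) + sharp A P \<omega>"
  note NX = endo_section[OF N X] endo_section[OF N Y]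
  have h: "?h \<in> covectors A" and th: "transp A N ?h \<in> covectors A" using H X Y N by simp_all
  have d\<sigma>: "d A \<sigma> \<in> forms A 3" using \<sigma> by simp
  have neg: "ins2 X Y (- d A \<sigma>) = - ins2 X Y (d A \<sigma>)"
    by (intro ext) (simp add: ins2_def ins_def)
  have \<theta>: "?\<theta> \<in> covectors A" unfolding neg using NX X Y H d\<sigma> by simp
  have "\<omega> = ?\<theta> + transp A N ?h"
  proof (rule supported1_eqI)
    show "supported 1 \<omega>" "supported 1 (?\<theta> + transp A N ?h)"
      using form_supported[OF \<omega>] form_supported[OF form_add_covector[OF \<theta> th]] .
    show "\<omega> [Z] p = (?\<theta> + transp A N ?h) [Z] p" if Z: "Z \<in> \<Gamma>" for Z p
      using form3_swap(1)[OF H NX(2) X Z, of p] form3_swap(1)[OF d\<sigma> X Y Z, of p]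
      by (simp add: ev[OF Z] neg transp_eval[OF Z]) (simp add: ins2_def ins_def)
  qed
  then have "sharp A P \<omega> = sharp A P ?\<theta> + N (sharp A P ?h)"
    by (simp only: sharp_add[OF P \<theta> th] square_endo_sharp[OF h])
  moreover have "N (br (N X) Y + br X (N Y) - (N (br X Y) + sharp A P ?h)) =
      N (br (N X) Y + br X (N Y) - N (br X Y)) - N (sharp A P ?h)"
  proof -
    have "br (N X) Y + br X (N Y) - (N (br X Y) + sharp A P ?h)
        = (br (N X) Y + br X (N Y) - N (br X Y)) - sharp A P ?h"
      by (rule diff_diff_add[symmetric])
    note E = this
    have "br (N X) Y + br X (N Y) - N (br X Y) \<in> \<Gamma>"
      using NX X Y endo_section[OF N] by simp
    then show ?thesis
      unfolding E by (rule endo_diff[OF N _ sharp_section[OF P h]])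
  qed
  ultimately show "torsion A N X Y = sharp A P ?\<theta>"
    unfolding torsion_def bracketN_def br by simp
qed

text \<open>
  The remaining component of the torsion says \<open>i\<^sub>N d\<sigma> = d(\<sigma>(N\<cdot>, \<cdot>)) + \<H> + \<lambda>H\<close>; the last term comes
  from \<open>\<sigma>\<^sup>\<flat>\<pi>\<^sup>\<sharp> + (\<^sup>tN)\<^sup>2 = \<lambda>\<close>.
\<close>

lemma torsion_free_ins_end_d:
  "ins_end A N (d A \<sigma>) = d A twisted_form + curly_H A N H + smult_form (\<lambda>_. l) H"
proof (rule supported3_eqI)
  show "supported 3 (ins_end A N (d A \<sigma>))"
    by (rule supported_ins_end[OF form_supported[OF d_form2_form3[OF \<sigma>]]])
  have "supported 3 (curly_H A N H)"
    unfolding supported_def curly_H_def on_sections_def by (auto split: list.split)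
  then show "supported 3 (d A twisted_form + curly_H A N H + smult_form (\<lambda>_. l) H)"
    using form_supported[OF d_form2_form3[OF twisted_form_form2]] form_supported[OF H] by simp
  fix X Y Z p assume X: "X \<in> \<Gamma>" and Y: "Y \<in> \<Gamma>" and Z: "Z \<in> \<Gamma>"
  note NX = endo_section[OF N X] endo_section[OF N Y] endo_section[OF N Z]
  let ?h = "ins2 X Y H"
  have h: "?h \<in> covectors A" using H X Y by simp
  have "d A \<sigma> [N X, Y, Z] p + d A \<sigma> [X, N Y, Z] p + d A \<sigma> [X, Y, N Z] p = d A twisted_form [X, Y, Z] p
    + (H [N X, N Y, Z] p + H [N Y, N Z, X] p + H [N Z, N X, Y] p) + l * H [X, Y, Z] p"
  proof (rule torsion_on_sections[OF X Y])
    let ?W = "br (N X) Y + br X (N Y) - (N (br X Y) + sharp A P ?h)"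
    fix \<omega> assume \<omega>: "\<omega> \<in> covectors A"
      and ev: "\<And>Z p. Z \<in> \<Gamma> \<Longrightarrow> \<omega> [Z] p =
        d A \<sigma> [X, Y, Z] p + H [Y, N X, Z] p + H [N Y, X, Z] p + ?h [N Z] p"
      and eq: "lie A (N X) (flat \<sigma> Y) - ins (N Y) (d A (flat \<sigma> X)) + ins2 (N X) (N Y) H
        - (flat \<sigma> ?W - transp A N \<omega>) = 0"
    have "lie A (N X) (flat \<sigma> Y) [Z] p - d A (flat \<sigma> X) [N Y, Z] p + H [N Y, N X, Z] p
        - (\<sigma> [?W, Z] p - \<omega> [N Z] p) = 0"
      using fun_cong[OF fun_cong[OF eq], of "[Z]" p]
      by (simp only: minus_apply plus_fun_apply zero_fun_apply transp_eval[OF Z] flat_eval)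
        (simp add: ins2_def ins_def)
    moreover have "lie A (N X) (flat \<sigma> Y) [Z] p = \<rho> (N X) (\<sigma> [Y, Z]) p - \<sigma> [Y, br (N X) Z] p"
      by (simp add: lie_eval[OF NX(1) Z] d_1[OF NX(1) Z] flat_eval)
    moreover have "d A (flat \<sigma> X) [N Y, Z] p =
        \<rho> (N Y) (\<sigma> [X, Z]) p - \<rho> Z (\<sigma> [X, N Y]) p - \<sigma> [X, br (N Y) Z] p"
      by (simp add: d_1[OF NX(2) Z] flat_eval)
    moreover have "\<sigma> [?W, Z] p = \<sigma> [br (N X) Y, Z] p + \<sigma> [br X (N Y), Z] p
        - (\<sigma> [N (br X Y), Z] p + \<sigma> [sharp A P ?h, Z] p)"
    proof -
      have s: "br (N X) Y \<in> \<Gamma>" "br X (N Y) \<in> \<Gamma>" "N (br X Y) \<in> \<Gamma>" "sharp A P ?h \<in> \<Gamma>"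
        using NX X Y endo_section[OF N] sharp_section[OF P h] by simp_all
      show ?thesis
        unfolding form2_diff(2)[OF \<sigma> section_add[OF s(1,2)] section_add[OF s(3,4)] Z]
          form2_linear(1)[OF \<sigma> s(1,2) Z] form2_linear(1)[OF \<sigma> s(3,4) Z]
        by (simp only: plus_fun_apply)
    qed
    moreover have "\<sigma> [sharp A P ?h, Z] p + ?h [N (N Z)] p = l * ?h [Z] p"
      by (rule square_flat_sharp[OF h Z])
    moreover have "\<omega> [N Z] p =
        d A \<sigma> [X, Y, N Z] p + H [Y, N X, N Z] p + H [N Y, X, N Z] p + ?h [N (N Z)] p"
      by (rule ev[OF NX(3)])
    moreover have "d A \<sigma> [N X, Y, Z] p = \<rho> (N X) (\<sigma> [Y, Z]) p - \<rho> Y (\<sigma> [N X, Z]) p + \<rho> Z (\<sigma> [N X, Y]) p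
        - \<sigma> [br (N X) Y, Z] p + \<sigma> [br (N X) Z, Y] p - \<sigma> [br Y Z, N X] p"
      by (rule d_2[OF NX(1) Y Z])
    moreover have "d A \<sigma> [X, N Y, Z] p = \<rho> X (\<sigma> [N Y, Z]) p - \<rho> (N Y) (\<sigma> [X, Z]) p + \<rho> Z (\<sigma> [X, N Y]) p
        - \<sigma> [br X (N Y), Z] p + \<sigma> [br X Z, N Y] p - \<sigma> [br (N Y) Z, X] p"
      by (rule d_2[OF X NX(2) Z])
    moreover have "d A twisted_form [X, Y, Z] p =
        \<rho> X (\<sigma> [N Y, Z]) p - \<rho> Y (\<sigma> [N X, Z]) p + \<rho> Z (\<sigma> [N X, Y]) p
        - \<sigma> [N (br X Y), Z] p + \<sigma> [br X Z, N Y] p - \<sigma> [br Y Z, N X] p"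
      using X Y Z
      by (simp only: d_2 twisted_form_eval bracket_section square_flat_endo[OF bracket_section[OF X Z] Y]
          square_flat_endo[OF bracket_section[OF Y Z] X])
    moreover have "\<sigma> [Y, br (N X) Z] p = - \<sigma> [br (N X) Z, Y] p"
      "\<sigma> [X, br (N Y) Z] p = - \<sigma> [br (N Y) Z, X] p"
      by (rule form2_skew_apply[OF \<sigma>]; simp add: NX X Y Z)+
    moreover have "H [N Y, N X, Z] p = - H [N X, N Y, Z] p" "H [Y, N X, N Z] p = - H [N X, Y, N Z] p"
      "H [N Y, X, N Z] p = - H [X, N Y, N Z] p" "H [Y, X, Z] p = - H [X, Y, Z] p"
      "H [N Y, N Z, X] p = - H [N Y, X, N Z] p"
      "H [N Z, N X, Y] p = - H [N X, N Z, Y] p" "H [N X, N Z, Y] p = - H [N X, Y, N Z] p"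
      using form3_swap[OF H] NX X Y Z by blast+
    moreover have "?h [Z] p = H [Y, X, Z] p" by (simp add: ins2_def ins_def)
    ultimately show ?thesis by (simp only:)
  qed
  then show "ins_end A N (d A \<sigma>) [X, Y, Z] p =
      (d A twisted_form + curly_H A N H + smult_form (\<lambda>_. l) H) [X, Y, Z] p"
    using X Y Z
    by (simp add: ins_end_def curly_H_def on_sections_def smult_form_def lessThan_Suc algebra_simps)
qed

text \<open>
  Since \<open>d\<sigma>\<close> is closed, the left-hand side is \<open>d i\<^sub>N d\<sigma>\<close>.
\<close>

lemma torsion_free_dN:
  assumes dH: "d A H = 0"
  shows "dN A N (- d A \<sigma>) = d A (curly_H A N H)"
proof -
  have d\<sigma>: "d A \<sigma> \<in> forms A 3" and dt: "d A twisted_form \<in> forms A 3"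
    using \<sigma> twisted_form_form2 by simp_all
  have cF: "curly_H A N H Xs \<in> F" for Xs
    unfolding curly_H_def on_sections_def
    using form_smooth[OF H] by (auto split: list.split)
  have lF: "smult_form (\<lambda>_. l) H Xs \<in> F" for Xs
    using form_smooth[OF H] by (simp add: smult_form_def)
  have sF: "(d A twisted_form + curly_H A N H) Xs \<in> F" for Xs
    using form_smooth[OF dt] cF by simp
  have iF: "ins_end A N (d A \<sigma>) Xs \<in> F" for Xs
    unfolding torsion_free_ins_end_d using sF lF by simp
  have "d A (ins_end A N (d A \<sigma>)) =
      d A (d A twisted_form) + d A (curly_H A N H) + smult_form (\<lambda>_. l) (d A H)"
    unfolding torsion_free_ins_end_d
    by (simp only: d_add[OF sF lF] d_add[OF form_smooth[OF dt] cF] d_scale[OF form_smooth[OF H]])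
  also have "\<dots> = d A (curly_H A N H)"
    unfolding dd_form2[OF twisted_form_form2] dH by (intro ext) (simp add: smult_form_def)
  finally have 1: "d A (ins_end A N (d A \<sigma>)) = d A (curly_H A N H)" .
  have "ins_end A N (- d A \<sigma>) = - ins_end A N (d A \<sigma>)"
    by (intro ext) (simp add: ins_end_def on_sections_def sum_negf)
  moreover have "d A (- d A \<sigma>) = 0"
    unfolding d_uminus[OF form_smooth[OF d\<sigma>]] dd_form2[OF \<sigma>] by (rule minus_zero)
  moreover have "ins_end A N 0 = 0"
    by (intro ext) (simp add: ins_end_def on_sections_def)
  ultimately show ?thesis
    unfolding dN_def using d_uminus[OF iF] 1 by (simp only: diff_0 minus_minus)
qed

lemma torsion_free_imp_poisson_quasi_nijenhuis_background:
  assumes dH: "d A H = 0"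
  shows "poisson_quasi_nijenhuis_background A P N (- d A \<sigma>) H"
proof -
  have d\<sigma>: "d A \<sigma> \<in> forms A 3" using \<sigma> by simp
  have sw: "(- d A \<sigma>) [X, Y, Z] p = - d A \<sigma> [X, Y, Z] p" for X Y Z p by simp
  have "- d A \<sigma> \<in> forms A 3"
  proof (rule form3I)
    show "supported 3 (- d A \<sigma>)" by (rule supported_uminus[OF form_supported[OF d\<sigma>]])
    show "(- d A \<sigma>) [X, Y, Z] \<in> F" for X Y Z
      using form_smooth[OF d\<sigma>] by simp
    show "(- d A \<sigma>) [X + X', Y, Z] p = (- d A \<sigma>) [X, Y, Z] p + (- d A \<sigma>) [X', Y, Z] p"
      if "X \<in> \<Gamma>" "X' \<in> \<Gamma>" "Y \<in> \<Gamma>" "Z \<in> \<Gamma>" for X X' Y Z p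
      using form_slot(1)[OF d\<sigma>, of "[X, Y, Z]" 0 X X'] that by simp
    show "(- d A \<sigma>) [smult f X, Y, Z] p = f p * (- d A \<sigma>) [X, Y, Z] p"
      if "X \<in> \<Gamma>" "Y \<in> \<Gamma>" "Z \<in> \<Gamma>" "f \<in> F" for f X Y Z p
      using form_slot(2)[OF d\<sigma>, of "[X, Y, Z]" 0 X f] that by simp
    show "(- d A \<sigma>) [Y, X, Z] p = - (- d A \<sigma>) [X, Y, Z] p"
      "(- d A \<sigma>) [X, Z, Y] p = - (- d A \<sigma>) [X, Y, Z] p"
      if "X \<in> \<Gamma>" "Y \<in> \<Gamma>" "Z \<in> \<Gamma>" for X Y Z p
      unfolding sw using form3_swap[OF d\<sigma> that, of p] by linarith+
  qed
  moreover have "d A (- d A \<sigma>) = 0"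
    unfolding d_uminus[OF form_smooth[OF d\<sigma>]] dd_form2[OF \<sigma>] by (rule minus_zero)
  ultimately show ?thesis
    unfolding poisson_quasi_nijenhuis_background_def
    by (intro conjI ballI P N H dH square_endo_sharp torsion_free_poisson torsion_free_concomitant
        torsion_free_endo_torsion torsion_free_dN)
qed

end

end

end

theorem theorem2p5:
  fixes A :: "('m::{t2_space,second_countable_topology}, 'e::real_inner, 'v::real_vector) algebroid"
    and H \<sigma> :: "('m, 'v) form"
    and \<pi> :: "('m, 'v) form \<Rightarrow> ('m, 'v) form \<Rightarrow> 'm \<Rightarrow> real"
    and N :: "('m \<Rightarrow> 'v) \<Rightarrow> 'm \<Rightarrow> 'v"
  assumes "lie_algebroid A"
    and "H \<in> forms A 3" and "d A H = 0"
    and "\<pi> \<in> bivectors A" and "N \<in> endomorphisms A" and "\<sigma> \<in> forms A 2"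
    and "cps A H (J_of A \<pi> N \<sigma>)"
  shows "poisson_quasi_nijenhuis_background A \<pi> N (- d A \<sigma>) H"
proof -
  interpret lie_algebroid_on A by standard (rule assms(1))
  obtain l where "\<forall>u\<in>dsections A. J_of A \<pi> N \<sigma> (J_of A \<pi> N \<sigma> u) = smult_dsection (\<lambda>_. l) u"
    using assms(7) unfolding cps_def almost_cps_def by blast
  moreover have "\<forall>u\<in>dsections A. \<forall>v\<in>dsections A. courant_torsion A H (J_of A \<pi> N \<sigma>) u v = 0"
    using assms(7) unfolding cps_def by blast
  ultimately show ?thesis
    using torsion_free_imp_poisson_quasi_nijenhuis_background[OF assms(4-6) _ assms(2) _ assms(3)]
    by blast
qed

end
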